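(* (a) For any thresholds $A,B>1$ and any weights $\mathbf q_0,\mathbf q_1$, $$\mathsf P_0(d_M=1)\le\frac{|\mathbf q_1|}{B},\quad \mathsf P_0(d_N=1)\le\frac{|\mathbf q_1|}{B},$$ and for every $1\le i\le K$, $$\mathsf P_i(d_M=0)\le\frac{1}{A\,q_0^i},\quad \mathsf P_i(d_N=0)\le\frac{1}{A\,q_0^i}.$$ (b) As $A,B\to\infty$, $$\mathsf P_0(d_M=1)=\frac1B\Big(\sum_{j=1}^K q_1^j\gamma_j\Big)(1+o(1)),\qquad \mathsf P_0(d_N=1)\le\frac1B\Big(\sum_{j=1}^K q_1^j\gamma_j\Big)(1+o(1)).$$ If in addition $r=1$, then for every $1\le i\le K$, as $A,B\to\infty$, $$\mathsf P_i(d_M=0)\le\frac{\gamma_0^1}{q_0^iA}(1+o(1)),\qquad \mathsf P_i(d_N=0)\le\frac{\gamma_0^1}{q_0^iA}(1+o(1)).$$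
   Context: Setup: $X_1,X_2,\dots$ are i.i.d. random vectors in $\mathbb R^d$ with common density $f$ with respect to a non-degenerate $\sigma$-finite measure $\nu$; $\mathcal F_t=\sigma(X_1,\dots,X_t)$. Let $f_0,f_1,\dots,f_K$ ($K\ge 1$) be densities with common support; $\mathsf P_j,\mathsf E_j$ denote probability and expectation when $f=f_j$, $j=0,1,\dots,K$. One tests $H_0:f=f_0$ versus $H_1:f\in\{f_1,\dots,f_K\}$. For $1\le i\le K$ let $\Lambda^i_t=\prod_{n=1}^t f_i(X_n)/f_0(X_n)$ and $Z^i_t=\log\Lambda^i_t$. Standing assumptions: for each $i$, $f_i\neq f_0$ on a set of positive $\nu$-measure; $Z^i_1$ is non-arithmetic under $\mathsf P_0$ and under $\mathsf P_i$; $I_i:=\mathsf E_i[Z^i_1]<\infty$ and $I^i_0:=\mathsf E_0[-Z^i_1]<\infty$ (both are then positive). The densities are ordered so that $I_0:=\min_{1\le i\le K}I^i_0=I^1_0=\dots=I^r_0<I^{r+1}_0\le\dots\le I^K_0$ for some integer $1\le r\le K$. Overshoot constants: for $c>0$ let $\tau^i_c=\inf\{t:Z^i_t\ge c\}$ and $\sigma^i_c=\inf\{t:Z^i_t\le -c\}$; let $\mathcal H_i(x)=\lim_{c\to\infty}\mathsf P_i(Z^i_{\tau^i_c}-c\le x)$ and $\mathcal H^i_0(x)=\lim_{c\to\infty}\mathsf P_0(|Z^i_{\sigma^i_c}+c|\le x)$, $x>0$, be the limiting overshoot distributions, and $\gamma_i=\int_0^\infty e^{-x}\mathcal H_i(dx)$,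 $\gamma^i_0=\int_0^\infty e^{-x}\mathcal H^i_0(dx)$. Tests: a weight is a vector $\mathbf q=(q^1,\dots,q^K)$ with all $q^i>0$; $|\mathbf q|=\sum_i q^i$; $\Lambda_t(\mathbf q)=\sum_{i=1}^K q^i\Lambda^i_t$, $\hat\Lambda_t(\mathbf q)=\max_{1\le i\le K}q^i\Lambda^i_t$, $Z_t(\mathbf q)=\log\Lambda_t(\mathbf q)$, $\hat Z_t(\mathbf q)=\log\hat\Lambda_t(\mathbf q)$. Given two weights $\mathbf q_0=(q_0^1,\dots,q_0^K)$, $\mathbf q_1=(q_1^1,\dots,q_1^K)$ and thresholds $A,B>1$, the Mixture Likelihood Ratio Test (MiLRT) is $M=\inf\{t:\Lambda_t(\mathbf q_1)\ge B\text{ or }\Lambda_t(\mathbf q_0)\le A^{-1}\}$, $d_M=\mathbf 1\{\Lambda_M(\mathbf q_1)\ge B\}$, and the Weighted Generalized Likelihood Ratio Test (WGLRT) is $N=\inf\{t:\hat\Lambda_t(\mathbf q_1)\ge B\text{ or }\hat\Lambda_t(\mathbf q_0)\le A^{-1}\}$, $d_N=\mathbf 1\{\hat\Lambda_N(\mathbf q_1)\ge B\}$ (decision $1$ means accept $H_1$, $0$ means accept $H_0$; the events $\{d=j\}$ are understood to include $\{T<\infty\}$). *)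

theory Defs
  imports "HOL-Probability.Probability"
begin

text \<open>Canonical model: a sample path is omega :: nat => 'x, where omega n is the observation
  X_(n+1).  Under hypothesis j the law is the infinite product of the density measure f_j d nu.\<close>

definition obs_law :: "'x measure \<Rightarrow> (nat \<Rightarrow> 'x \<Rightarrow> real) \<Rightarrow> nat \<Rightarrow> (nat \<Rightarrow> 'x) measure" where
  "obs_law \<nu> f j = PiM UNIV (\<lambda>_::nat. density \<nu> (\<lambda>x. ennreal (f j x)))"

definition LR :: "(nat \<Rightarrow> 'x \<Rightarrow> real) \<Rightarrow> nat \<Rightarrow> nat \<Rightarrow> (nat \<Rightarrow> 'x) \<Rightarrow> real" where
  "LR f i t \<omega> = (\<Prod>n<t. f i (\<omega> n) / f 0 (\<omega> n))"

definition LLR :: "(nat \<Rightarrow> 'x \<Rightarrow> real) \<Rightarrow> nat \<Rightarrow> nat \<Rightarrow> (nat \<Rightarrow> 'x) \<Rightarrow> real" where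
  "LLR f i t \<omega> = ln (LR f i t \<omega>)"

definition arithmetic :: "'w measure \<Rightarrow> ('w \<Rightarrow> real) \<Rightarrow> bool" where
  "arithmetic M Y \<longleftrightarrow> (\<exists>h>0. AE \<omega> in M. Y \<omega> \<in> range (\<lambda>k::int. h * of_int k))"

definition first_up :: "(nat \<Rightarrow> 'w \<Rightarrow> real) \<Rightarrow> real \<Rightarrow> 'w \<Rightarrow> nat" where
  "first_up Z c \<omega> = (LEAST t. c \<le> Z t \<omega>)"

definition first_down :: "(nat \<Rightarrow> 'w \<Rightarrow> real) \<Rightarrow> real \<Rightarrow> 'w \<Rightarrow> nat" where
  "first_down Z c \<omega> = (LEAST t. Z t \<omega> \<le> - c)"

definition overshoot_up_cdf :: "'w measure \<Rightarrow> (nat \<Rightarrow> 'w \<Rightarrow> real) \<Rightarrow> real \<Rightarrow> real" where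
  "overshoot_up_cdf M Z x = Lim at_top (\<lambda>c::real. measure M
     {\<omega> \<in> space M. (\<exists>t. c \<le> Z t \<omega>) \<and> Z (first_up Z c \<omega>) \<omega> - c \<le> x})"

definition overshoot_down_cdf :: "'w measure \<Rightarrow> (nat \<Rightarrow> 'w \<Rightarrow> real) \<Rightarrow> real \<Rightarrow> real" where
  "overshoot_down_cdf M Z x = Lim at_top (\<lambda>c::real. measure M
     {\<omega> \<in> space M. (\<exists>t. Z t \<omega> \<le> - c) \<and> \<bar>Z (first_down Z c \<omega>) \<omega> + c\<bar> \<le> x})"

definition laplace_at_one :: "(real \<Rightarrow> real) \<Rightarrow> real" where
  "laplace_at_one H = (LINT x:{0..}|interval_measure H. exp (- x))"

definition gamma_up :: "'x measure \<Rightarrow> (nat \<Rightarrow> 'x \<Rightarrow> real) \<Rightarrow> nat \<Rightarrow> real" where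
  "gamma_up \<nu> f i = laplace_at_one (overshoot_up_cdf (obs_law \<nu> f i) (LLR f i))"

definition gamma_down :: "'x measure \<Rightarrow> (nat \<Rightarrow> 'x \<Rightarrow> real) \<Rightarrow> nat \<Rightarrow> real" where
  "gamma_down \<nu> f i = laplace_at_one (overshoot_down_cdf (obs_law \<nu> f 0) (LLR f i))"

definition mixLR :: "(nat \<Rightarrow> 'x \<Rightarrow> real) \<Rightarrow> nat \<Rightarrow> (nat \<Rightarrow> real) \<Rightarrow> nat \<Rightarrow> (nat \<Rightarrow> 'x) \<Rightarrow> real" where
  "mixLR f K q t \<omega> = (\<Sum>i\<in>{1..K}. q i * LR f i t \<omega>)"

definition maxLR :: "(nat \<Rightarrow> 'x \<Rightarrow> real) \<Rightarrow> nat \<Rightarrow> (nat \<Rightarrow> real) \<Rightarrow> nat \<Rightarrow> (nat \<Rightarrow> 'x) \<Rightarrow> real" where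
  "maxLR f K q t \<omega> = Max ((\<lambda>i. q i * LR f i t \<omega>) ` {1..K})"

definition stop_time :: "(nat \<Rightarrow> 'w \<Rightarrow> real) \<Rightarrow> (nat \<Rightarrow> 'w \<Rightarrow> real) \<Rightarrow> real \<Rightarrow> real \<Rightarrow> 'w \<Rightarrow> nat" where
  "stop_time L0 L1 A B \<omega> = (LEAST t. 1 \<le> t \<and> (B \<le> L1 t \<omega> \<or> L0 t \<omega> \<le> 1 / A))"

definition accept1 :: "'w measure \<Rightarrow> (nat \<Rightarrow> 'w \<Rightarrow> real) \<Rightarrow> (nat \<Rightarrow> 'w \<Rightarrow> real) \<Rightarrow> real \<Rightarrow> real \<Rightarrow> 'w set" where
  "accept1 M L0 L1 A B = {\<omega> \<in> space M. (\<exists>t\<ge>1. B \<le> L1 t \<omega> \<or> L0 t \<omega> \<le> 1 / A)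
      \<and> B \<le> L1 (stop_time L0 L1 A B \<omega>) \<omega>}"

definition accept0 :: "'w measure \<Rightarrow> (nat \<Rightarrow> 'w \<Rightarrow> real) \<Rightarrow> (nat \<Rightarrow> 'w \<Rightarrow> real) \<Rightarrow> real \<Rightarrow> real \<Rightarrow> 'w set" where
  "accept0 M L0 L1 A B = {\<omega> \<in> space M. (\<exists>t\<ge>1. B \<le> L1 t \<omega> \<or> L0 t \<omega> \<le> 1 / A)
      \<and> \<not> B \<le> L1 (stop_time L0 L1 A B \<omega>) \<omega>}"

end

theory Submission
  imports Defs
begin

text \<open>Write \<open>S\<close> for a random walk with positive drift and non-arithmetic steps, and \<open>R\<^sub>c\<close> for its
overshoot over \<open>c\<close>. The function \<open>c \<mapsto> P(R\<^sub>c \<le> x)\<close>, averaged over a window of levels, is a Lipschitz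
function \<open>v\<close> with \<open>v(c) = E v(c - X)\<close> for \<open>c > 0\<close>. A variance argument gives
\<open>E (v(c - X) - v(c))\<^sup>2 \<longlonglongrightarrow> 0\<close>, so the set of asymptotic periods of \<open>v\<close> is a closed subgroup of the
reals containing the support of the step; by non-arithmeticity it is everything. For a primitive \<open>W\<close> of
\<open>v\<close>, the quantity \<open>E (W(c) - W(c - X))\<close> does not depend on \<open>c > 0\<close> and is asymptotically
\<open>v(c) E X\<close>, so \<open>v\<close> converges. The inequality \<open>P(R\<^sub>c\<^sub>+\<^sub>d \<le> x) \<le> P(R\<^sub>c \<le> x + d)\<close> removes the averaging.

Changing measure at the stopping time turns \<open>B P\<^sub>0(d = 1)\<close> into \<open>\<Sum>\<^sub>j q\<^sub>j E\<^sub>j (B / \<Lambda>\<^sub>T)\<close>, where \<open>B / \<Lambda>\<^sub>T\<close> is the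
exponential of minus the overshoot of \<open>log \<Lambda>\<close>. Under \<open>P\<^sub>j\<close> the process \<open>log \<Lambda>\<close> differs from \<open>Z\<^sup>j\<close> by a term
that converges almost surely, since each ratio of likelihoods tends to 0 (Hellinger affinity) or is constant;
such a perturbation does not change the limiting overshoot. The bounds on \<open>P\<^sub>i(d = 0)\<close> come in
the same way from the walk \<open>-Z\<^sup>1\<close> under \<open>P\<^sub>0\<close>; there the ratios tend to 0 because the drifts differ.\<close>

subsection \<open>Oscillation of harmonic functions of a random walk\<close>

text \<open>The constants \<open>gamma_up\<close> and \<open>gamma_down\<close> are built from
  \<open>Lim\<close>, which says nothing unless the limits exist; so the overshoot limit theorem
  comes first. Averaging over levels is forced because an overshoot probability may jump in the
  level, while closedness of the set of periods and uniformity on bounded sets of shifts need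
  equicontinuity. Harmonicity holds at positive levels only, since a level \<open>c \<le> 0\<close>
  is already crossed at time 0; the error terms of the variance argument stem from there. The limit
  of a harmonic function is given by an explicit integral and so depends continuously on the
  function; this makes the limiting overshoot law continuous and of total mass 1. Continuity at 0 is
  what makes perturbations harmless: once the perturbation has settled, the passage time can change
  only if the overshoot is small. In the two-sided test the lower boundary is handled by the paths
  that cross it first: multiplied by \<open>B\<close>, their probability is of order
  \<open>1 / A\<close>, uniformly in \<open>B\<close>, so both thresholds may grow
  independently.\<close>

lemma filterlim_shift_at_top: "filterlim (\<lambda>c. c - x) at_top (at_top :: real filter)" for x :: real
  unfolding filterlim_at_top
proof
  fix Z
  show "\<forall>\<^sub>F c in at_top. Z \<le> c - x"
    using eventually_ge_at_top[of "Z + x"] by eventually_elim auto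
qed

lemma (in prob_space) square_integral_le:
  fixes f :: "'a \<Rightarrow> real"
  assumes "integrable M f" "integrable M (\<lambda>x. (f x)\<^sup>2)"
  shows "(integral\<^sup>L M f)\<^sup>2 \<le> (\<integral>x. (f x)\<^sup>2 \<partial>M)"
  using variance_positive[of f] assms by (simp add: variance_eq)

text \<open>The law of one step is isolated from the walk: the study of harmonic functions sees only
  this measure on the line.\<close>

locale drift_law = real_distribution F for F +
  assumes int_F: "integrable F (\<lambda>x. x)"
    and mean_pos: "0 < (\<integral>x. x \<partial>F)"
    and nonarith_F: "\<not> arithmetic F (\<lambda>x. x)"
begin

text \<open>The equation is demanded at positive levels only, because a level
  \<open>c \<le> 0\<close> is crossed at time 0 and no step is taken. The range is the unit interval
  since the functions in question are averaged probabilities.\<close>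

definition harm :: "real \<Rightarrow> (real \<Rightarrow> real) \<Rightarrow> bool" where
  "harm L v \<longleftrightarrow> (\<forall>c. 0 \<le> v c \<and> v c \<le> 1) \<and> (\<forall>c c'. \<bar>v c - v c'\<bar> \<le> L * \<bar>c - c'\<bar>)
     \<and> (\<forall>c>0. v c = (\<integral>x. v (c - x) \<partial>F))"

lemma prob_UNIV [simp]: "measure F UNIV = 1"
  using prob_space by simp

lemma int_bdd:
  assumes "g \<in> borel_measurable borel" "\<And>x. \<bar>g x\<bar> \<le> (C::real)"
  shows "integrable F g"
  by (rule integrable_const_bound[where B=C]) (use assms in auto)

text \<open>Averaging over one step keeps bounded functions that vanish at infinity in that class,
  so error terms survive iteration.\<close>

lemma T_tendsto:
  assumes [measurable]: "g \<in> borel_measurable borel" and "\<And>x. \<bar>g x\<bar> \<le> (C::real)" and "(g \<longlongrightarrow> 0) at_top"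
  shows "((\<lambda>c. \<integral>x. g (c - x) \<partial>F) \<longlongrightarrow> 0) at_top"
proof -
  have "((\<lambda>c. \<integral>x. g (c - x) \<partial>F) \<longlongrightarrow> (\<integral>x. 0 \<partial>F)) at_top"
  proof (rule integral_dominated_convergence_at_top[where w="\<lambda>_. C"])
    show "AE x in F. ((\<lambda>c. g (c - x)) \<longlongrightarrow> 0) at_top"
      by (intro AE_I2 filterlim_compose[OF assms(3)] filterlim_shift_at_top)
  qed (use assms in auto)
  then show ?thesis by simp
qed

lemma harm_measurable: assumes "harm L v" shows "v \<in> borel_measurable borel"
proof -
  have "L-lipschitz_on UNIV v"
  proof (rule lipschitz_onI)
    show "dist (v x) (v y) \<le> L * dist x y" for x y
      using assms by (auto simp: harm_def dist_real_def)
    show "0 \<le> L" using assms unfolding harm_def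
      by (metis abs_ge_zero abs_one diff_zero mult.right_neutral order_trans)
  qed
  then show ?thesis
    by (intro borel_measurable_continuous_onI lipschitz_on_continuous_on)
qed

text \<open>For \<open>c > 0\<close> this is the variance of \<open>v (c - X)\<close>, since
  \<open>v c\<close> is its mean.\<close>

definition osc :: "(real \<Rightarrow> real) \<Rightarrow> real \<Rightarrow> real" where
  "osc v c = (\<integral>x. (v (c - x) - v c)\<^sup>2 \<partial>F)"

text \<open>Write \<open>T g(c) = E g(c - X)\<close>. Up to terms that vanish as \<open>c \<rightarrow> \<infinity>\<close>, Jensen's inequality gives
  \<open>osc v \<le> T (osc v)\<close>, and harmonicity gives \<open>osc v = T (v\<^sup>2) - v\<^sup>2\<close>. Summing the second relation along the
  powers of \<open>T\<close> bounds \<open>n\<close> times \<open>osc v\<close> by 1.\<close>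

lemma osc_multiple_le:
  assumes h: "harm L v"
  shows "\<exists>g C. g \<in> borel_measurable borel \<and> (\<forall>c. \<bar>g c\<bar> \<le> (C::real)) \<and> (g \<longlongrightarrow> 0) at_top
     \<and> (\<forall>c. real n * osc v c + (v c)\<^sup>2 \<le> 1 + g c)"
proof -
  note [measurable] = harm_measurable[OF h]
  have v01: "0 \<le> v c" "v c \<le> 1" for c using h by (auto simp: harm_def)
  have d1: "\<bar>v a - v b\<bar> \<le> 1" for a b using v01[of a] v01[of b] by auto
  have vh: "v c = (\<integral>x. v (c - x) \<partial>F)" if "c > 0" for c using h that unfolding harm_def by blast
  have sq1: "(v a - v b)\<^sup>2 \<le> 1" for a b
    using d1[of a b] by (simp add: abs_square_le_1)
  have v2: "(v a)\<^sup>2 \<le> 1" for a using v01[of a] by (simp add: power_le_one)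
  have [measurable]: "osc v \<in> borel_measurable borel" unfolding osc_def by measurable
  have osc01: "0 \<le> osc v c" "osc v c \<le> 1" for c
  proof -
    show "0 \<le> osc v c" unfolding osc_def by (rule integral_nonneg_AE) auto
    have "osc v c \<le> (\<integral>x. 1 \<partial>F)" unfolding osc_def
      by (intro integral_mono int_bdd[where C=1]) (use sq1 in auto)
    then show "osc v c \<le> 1" by (simp add: prob_space)
  qed
  \<comment> \<open>The first summand is the probability of a step of length at least
    \<open>c\<close>, after which harmonicity is no longer available; the second covers
    \<open>c \<le> 0\<close>, where only \<open>osc v c \<le> 1\<close> is known.\<close>
  define e where "e = (\<lambda>c. (\<integral>y. (if c \<le> y then 1 else 0) \<partial>F) + (if c \<le> 0 then 1 else 0 :: real))"
  have [measurable]: "e \<in> borel_measurable borel" unfolding e_def by measurable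
  have i0: "0 \<le> (\<integral>y. (if c \<le> y then 1 else 0 :: real) \<partial>F)" for c
    by (rule integral_nonneg_AE) auto
  have i1: "(\<integral>y. (if c \<le> y then 1 else 0 :: real) \<partial>F) \<le> 1" for c
  proof -
    have "(\<integral>y. (if c \<le> y then 1 else 0 :: real) \<partial>F) \<le> (\<integral>y. 1 \<partial>F)"
      by (intro integral_mono int_bdd[where C=1]) auto
    then show ?thesis by (simp add: prob_space)
  qed
  have e0: "0 \<le> e c" for c using i0[of c] by (auto simp: e_def)
  have e2: "e c \<le> 2" for c using i1[of c] by (auto simp: e_def)
  have e_lim: "(e \<longlongrightarrow> 0) at_top"
  proof -
    have "((\<lambda>c. \<integral>y. (if c \<le> y then 1 else 0::real) \<partial>F) \<longlongrightarrow> (\<integral>y. 0 \<partial>F)) at_top"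
    proof (rule integral_dominated_convergence_at_top[where w="\<lambda>_. 1"])
      show "AE y in F. ((\<lambda>c. if c \<le> y then 1 else 0::real) \<longlongrightarrow> 0) at_top"
      proof (intro AE_I2 tendsto_eventually)
        fix y :: real
        show "\<forall>\<^sub>F c in at_top. (if c \<le> y then 1 else 0::real) = 0"
          using eventually_gt_at_top[of y] by eventually_elim auto
      qed
    qed auto
    moreover have "((\<lambda>c. if c \<le> 0 then 1 else 0 :: real) \<longlongrightarrow> 0) (at_top :: real filter)"
    proof (rule tendsto_eventually)
      show "\<forall>\<^sub>F c in at_top. (if c \<le> (0::real) then 1 else 0::real) = 0"
        using eventually_gt_at_top[of "0::real"] by eventually_elim auto
    qed
    ultimately show ?thesis unfolding e_def
      by (auto intro: tendsto_add[where a="0::real" and b="0::real", simplified])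
  qed
  interpret FF: pair_prob_space F F ..
  have oscT: "osc v c \<le> (\<integral>z. osc v (c - z) \<partial>F) + e c" for c
  proof (cases "c \<le> 0")
    case True
    have "0 \<le> (\<integral>z. osc v (c - z) \<partial>F)" by (rule integral_nonneg_AE) (use osc01 in auto)
    moreover have "1 \<le> e c" using True i0[of c] unfolding e_def by simp
    ultimately show ?thesis using osc01(2)[of c] by linarith
  next
    case False
    then have c: "c > 0" by simp
    have pt: "(v (c - y) - v c)\<^sup>2 \<le> (\<integral>z. (v (c - z - y) - v (c - z))\<^sup>2 \<partial>F) + (if c \<le> y then 1 else 0)" for y
    proof (cases "c \<le> y")
      case True
      have "0 \<le> (\<integral>z. (v (c - z - y) - v (c - z))\<^sup>2 \<partial>F)" by (rule integral_nonneg_AE) auto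
      moreover have "(if c \<le> y then 1 else 0) = (1 :: real)" using True by simp
      ultimately show ?thesis using sq1[of "c - y" c] by linarith
    next
      case False
      \<comment> \<open>Harmonicity at \<open>c - y\<close>, legitimate as \<open>y < c\<close>, and
        at \<open>c\<close>, with the same averaged step \<open>z\<close>. Jensen's inequality
        follows, and exchanging \<open>y\<close> and \<open>z\<close> turns the mean over
        \<open>y\<close> into \<open>osc v (c - z)\<close>.\<close>
      have "v (c - y) - v c = (\<integral>z. v (c - y - z) \<partial>F) - (\<integral>z. v (c - z) \<partial>F)"
        using vh[OF c] vh[of "c - y"] False by simp
      also have "\<dots> = (\<integral>z. v (c - z - y) - v (c - z) \<partial>F)"
        by (subst Bochner_Integration.integral_diff)
          (auto intro!: int_bdd[where C=1] simp: v01 abs_le_iff algebra_simps intro: order_trans[OF v01(2)] order_trans[OF _ v01(1)])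
      finally have "(v (c - y) - v c)\<^sup>2 = (\<integral>z. v (c - z - y) - v (c - z) \<partial>F)\<^sup>2" by simp
      also have "\<dots> \<le> (\<integral>z. (v (c - z - y) - v (c - z))\<^sup>2 \<partial>F)"
        by (intro square_integral_le int_bdd[where C=1]) (use d1 sq1 in auto)
      finally show ?thesis using False by simp
    qed
    have "osc v c \<le> (\<integral>y. (\<integral>z. (v (c - z - y) - v (c - z))\<^sup>2 \<partial>F) + (if c \<le> y then 1 else 0) \<partial>F)"
      unfolding osc_def
    proof (rule integral_mono)
      have "\<bar>\<integral>z. (v (c - z - y) - v (c - z))\<^sup>2 \<partial>F\<bar> \<le> 1" for y
      proof -
        have "(\<integral>z. (v (c - z - y) - v (c - z))\<^sup>2 \<partial>F) \<le> (\<integral>z. 1 \<partial>F)"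
          by (intro integral_mono int_bdd[where C=1]) (use sq1 in auto)
        moreover have "0 \<le> (\<integral>z. (v (c - z - y) - v (c - z))\<^sup>2 \<partial>F)" by (rule integral_nonneg_AE) auto
        ultimately show ?thesis by (simp add: prob_space)
      qed
      then show "integrable F (\<lambda>y. (\<integral>z. (v (c - z - y) - v (c - z))\<^sup>2 \<partial>F) + (if c \<le> y then 1 else 0))"
        by (intro Bochner_Integration.integrable_add int_bdd[where C=1]) auto
    qed (use pt in \<open>auto intro!: int_bdd[where C=1] simp: sq1\<close>)
    also have "\<dots> = (\<integral>y. (\<integral>z. (v (c - z - y) - v (c - z))\<^sup>2 \<partial>F) \<partial>F) + (\<integral>y. (if c \<le> y then 1 else 0) \<partial>F)"
    proof (rule Bochner_Integration.integral_add)
      have "\<bar>\<integral>z. (v (c - z - y) - v (c - z))\<^sup>2 \<partial>F\<bar> \<le> 1" for y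
      proof -
        have "(\<integral>z. (v (c - z - y) - v (c - z))\<^sup>2 \<partial>F) \<le> (\<integral>z. 1 \<partial>F)"
          by (intro integral_mono int_bdd[where C=1]) (use sq1 in auto)
        moreover have "0 \<le> (\<integral>z. (v (c - z - y) - v (c - z))\<^sup>2 \<partial>F)" by (rule integral_nonneg_AE) auto
        ultimately show ?thesis by (simp add: prob_space)
      qed
      then show "integrable F (\<lambda>y. (\<integral>z. (v (c - z - y) - v (c - z))\<^sup>2 \<partial>F))"
        by (intro int_bdd[where C=1]) auto
    qed (auto intro!: int_bdd[where C=1])
    also have "(\<integral>y. (\<integral>z. (v (c - z - y) - v (c - z))\<^sup>2 \<partial>F) \<partial>F) = (\<integral>z. osc v (c - z) \<partial>F)"
      unfolding osc_def
      by (rule FF.Fubini_integral, rule FF.integrable_const_bound[where B=1]) (use sq1 in auto)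
    finally show ?thesis using False by (simp add: e_def)
  qed
  \<comment> \<open>For \<open>c > 0\<close> this is the variance formula, with equality. For
    \<open>c \<le> 0\<close> each of \<open>osc v c\<close> and \<open>(v c)\<^sup>2\<close> is at
    most 1, whence the factor 2.\<close>
  have Tv2: "osc v c + (v c)\<^sup>2 \<le> (\<integral>x. (v (c - x))\<^sup>2 \<partial>F) + 2 * (if c \<le> 0 then 1 else 0)" for c
  proof (cases "c \<le> 0")
    case True
    have "0 \<le> (\<integral>x. (v (c - x))\<^sup>2 \<partial>F)" by (rule integral_nonneg_AE) auto
    moreover have "(if c \<le> 0 then 1 else 0) = (1 :: real)" using True by simp
    ultimately show ?thesis using osc01(2)[of c] v2[of c] by linarith
  next
    case False
    have i1: "integrable F (\<lambda>x. (v (c - x))\<^sup>2)" by (rule int_bdd[where C=1]) (use v2 in auto)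
    have i2: "integrable F (\<lambda>x. v (c - x))" by (rule int_bdd[where C=1]) (use v01 in auto)
    have "osc v c = (\<integral>x. (v (c - x))\<^sup>2 - 2 * v c * v (c - x) + (v c)\<^sup>2 \<partial>F)"
      unfolding osc_def by (intro Bochner_Integration.integral_cong) (auto simp: power2_eq_square algebra_simps)
    also have "\<dots> = (\<integral>x. (v (c - x))\<^sup>2 \<partial>F) - 2 * v c * (\<integral>x. v (c - x) \<partial>F) + (v c)\<^sup>2"
      using i1 i2 by (simp add: prob_space)
    also have "(\<integral>x. v (c - x) \<partial>F) = v c" using vh[of c] False by simp
    finally show ?thesis using False by (simp add: power2_eq_square)
  qed
  show ?thesis
  proof (induction n)
    case 0
    show ?case using v2 by (intro exI[of _ "\<lambda>_. 0"] exI[of _ 0]) auto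
  next
    case (Suc n)
    then obtain g C where g[measurable]: "g \<in> borel_measurable borel"
      and gC: "\<And>c. \<bar>g c\<bar> \<le> C" and glim: "(g \<longlongrightarrow> 0) at_top"
      and gle: "\<And>c. real n * osc v c + (v c)\<^sup>2 \<le> 1 + g c" by blast
    \<comment> \<open>The old error is averaged over one more step; added are \<open>n\<close>
      copies of the Jensen error \<open>e\<close> and one error from \<open>Tv2\<close>.\<close>
    define g' where "g' c = (\<integral>x. g (c - x) \<partial>F) + (real n * e c + 2 * (if c \<le> 0 then 1 else 0))" for c
    have [measurable]: "g' \<in> borel_measurable borel" unfolding g'_def by measurable
    have bd: "\<bar>\<integral>x. g (c - x) \<partial>F\<bar> \<le> C" for c
    proof -
      have "\<bar>\<integral>x. g (c - x) \<partial>F\<bar> \<le> (\<integral>x. \<bar>g (c - x)\<bar> \<partial>F)" by (rule integral_abs_bound)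
      also have "\<dots> \<le> (\<integral>x. C \<partial>F)" by (intro integral_mono int_bdd[where C=C]) (use gC order_trans[OF abs_ge_zero gC] in auto)
      finally show ?thesis by (simp add: prob_space)
    qed
    have "\<bar>g' c\<bar> \<le> C + (real n * 2 + 2)" for c
    proof -
      have "\<bar>real n * e c + 2 * (if c \<le> 0 then 1 else 0)\<bar> \<le> real n * 2 + 2"
        using mult_left_mono[OF e2[of c], of "real n"] e0[of c] by auto
      then show ?thesis using bd[of c] unfolding g'_def by linarith
    qed
    moreover have "(g' \<longlongrightarrow> 0) at_top"
    proof -
      have a: "((\<lambda>c. if c \<le> 0 then 1 else 0 :: real) \<longlongrightarrow> 0) (at_top :: real filter)"
      proof (rule tendsto_eventually)
        show "\<forall>\<^sub>F c in at_top. (if c \<le> (0::real) then 1 else 0::real) = 0"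
          using eventually_gt_at_top[of "0::real"] by eventually_elim auto
      qed
      have "(g' \<longlongrightarrow> 0 + (real n * 0 + 2 * 0)) at_top"
        unfolding g'_def by (intro tendsto_intros T_tendsto[OF g gC glim] e_lim a)
      then show ?thesis by simp
    qed
    moreover have "real (Suc n) * osc v c + (v c)\<^sup>2 \<le> 1 + g' c" for c
    proof -
      have io: "integrable F (\<lambda>x. osc v (c - x))" by (rule int_bdd[where C=1]) (use osc01 in auto)
      have iv: "integrable F (\<lambda>x. (v (c - x))\<^sup>2)" by (rule int_bdd[where C=1]) (use v2 in auto)
      have ig: "integrable F (\<lambda>x. g (c - x))" by (rule int_bdd[where C=C]) (use gC in auto)
      have "real (Suc n) * osc v c + (v c)\<^sup>2 \<le> real n * ((\<integral>x. osc v (c - x) \<partial>F) + e c) + ((\<integral>x. (v (c - x))\<^sup>2 \<partial>F) + 2 * (if c \<le> 0 then 1 else 0))"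
        using mult_left_mono[OF oscT[of c], of "real n"] Tv2[of c] by (simp add: algebra_simps)
      also have "real n * ((\<integral>x. osc v (c - x) \<partial>F) + e c) + ((\<integral>x. (v (c - x))\<^sup>2 \<partial>F) + 2 * (if c \<le> 0 then 1 else 0))
        = (\<integral>x. real n * osc v (c - x) + (v (c - x))\<^sup>2 \<partial>F) + (real n * e c + 2 * (if c \<le> 0 then 1 else 0))"
        using io iv by (simp add: algebra_simps)
      also have "(\<integral>x. real n * osc v (c - x) + (v (c - x))\<^sup>2 \<partial>F) \<le> (\<integral>x. 1 + g (c - x) \<partial>F)"
        using io iv ig by (intro integral_mono) (auto simp: gle)
      also have "\<dots> = 1 + (\<integral>x. g (c - x) \<partial>F)" using ig by (simp add: prob_space)
      finally show ?thesis by (simp add: g'_def algebra_simps)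
    qed
    ultimately show ?case by (intro exI[of _ g'] exI[of _ "C + (real n * 2 + 2)"]) auto
  qed
qed

text \<open>For every fixed \<open>n\<close> the bound \<open>n * osc v c \<le> 1 + o(1)\<close>
  holds as \<open>c\<close> grows, so the upper limit is at most \<open>1 / n\<close>. The choice
  \<open>2 / a < n\<close> leaves room for the error: eventually it is below 1 and the right-hand
  side below 2.\<close>

lemma osc_tendsto:
  assumes h: "harm L v"
  shows "(osc v \<longlongrightarrow> 0) at_top"
proof (rule order_tendstoI)
  fix a :: real assume "a < 0"
  moreover have "0 \<le> osc v c" for c unfolding osc_def by (rule integral_nonneg_AE) auto
  ultimately show "\<forall>\<^sub>F c in at_top. a < osc v c" by (intro always_eventually) (metis order_less_le_trans)
next
  fix a :: real assume a: "0 < a"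
  obtain n :: nat where n: "2 / a < real n" using reals_Archimedean2 by blast
  moreover have "0 < 2 / a" using a by simp
  ultimately have n0: "real n > 0" by linarith
  obtain g C where g: "(g \<longlongrightarrow> 0) at_top" "\<And>c. real n * osc v c + (v c)\<^sup>2 \<le> 1 + g c"
    using osc_multiple_le[OF h, of n] by blast
  have "\<forall>\<^sub>F c in at_top. g c < 1" using g(1) by (rule order_tendstoD) simp
  then show "\<forall>\<^sub>F c in at_top. osc v c < a"
  proof eventually_elim
    case (elim c)
    have "real n * osc v c < 2" using g(2)[of c] elim zero_le_power2[of "v c"] by linarith
    also have "2 < real n * a" using n a by (simp add: field_simps)
    finally show ?case using n0 by simp
  qed
qed

end

section \<open>Supports of measures and closed subgroups of the line\<close>

text \<open>Lindelof's theorem: the union of all open null sets is a countable union of such sets,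
  hence null, and every point outside it belongs to the support.\<close>

lemma AE_support:
  fixes M :: "'a::second_countable_topology measure"
  assumes "sets M = sets borel"
  shows "AE x in M. \<forall>U. open U \<longrightarrow> x \<in> U \<longrightarrow> 0 < emeasure M U"
proof -
  define \<F> where "\<F> = {U :: 'a set. open U \<and> emeasure M U = 0}"
  obtain \<F>' where F': "\<F>' \<subseteq> \<F>" "countable \<F>'" "\<Union>\<F>' = \<Union>\<F>"
    using Lindelof[of \<F>] by (auto simp: \<F>_def)
  have "\<Union>\<F>' \<in> null_sets M"
  proof -
    have "(\<Union>U\<in>\<F>'. U) \<in> null_sets M"
      using F' assms by (intro null_sets_UN') (auto simp: \<F>_def null_sets_def)
    then show ?thesis by simp
  qed
  then have "AE x in M. x \<notin> \<Union>\<F>'" by (rule AE_not_in)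
  then show ?thesis
    unfolding F'(3) by eventually_elim (auto simp: \<F>_def zero_less_iff_neq_zero)
qed

text \<open>With arbitrarily small positive elements, rounding down to multiples shows density.
  Otherwise the least positive element generates, because remainders modulo it lie in the group and
  must vanish. The trivial group falls under the second alternative with
  \<open>h = 1\<close>.\<close>

lemma closed_subgroup_real:
  fixes A :: "real set"
  assumes "closed A" "0 \<in> A" and minus: "\<And>a b. a \<in> A \<Longrightarrow> b \<in> A \<Longrightarrow> a - b \<in> A"
  shows "A = UNIV \<or> (\<exists>h>0. A \<subseteq> range (\<lambda>k::int. h * of_int k))"
proof -
  have neg: "- a \<in> A" if "a \<in> A" for a using minus[OF assms(2) that] by simp
  have plus: "a + b \<in> A" if "a \<in> A" "b \<in> A" for a b using minus[OF that(1) neg[OF that(2)]] by simp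
  have natmult: "of_nat n * a \<in> A" if "a \<in> A" for a :: real and n :: nat
    by (induction n) (use assms(2) plus that in \<open>auto simp: algebra_simps\<close>)
  have intmult: "of_int k * a \<in> A" if "a \<in> A" for a :: real and k :: int
  proof (cases "k \<ge> 0")
    case True
    then show ?thesis using natmult[OF that, of "nat k"] by simp
  next
    case False
    then show ?thesis using neg[OF natmult[OF that, of "nat (- k)"]] by simp
  qed
  have rem: "x - of_int \<lfloor>x / a\<rfloor> * a \<in> {0..<a}" if "a > 0" for x a :: real
  proof -
    have "of_int \<lfloor>x / a\<rfloor> * a \<le> x" using that by (simp add: pos_le_divide_eq[symmetric])
    moreover have "x < (of_int \<lfloor>x / a\<rfloor> + 1) * a" using that floor_correct[of "x/a"] by (simp add: pos_divide_less_eq[symmetric])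
    ultimately show ?thesis by (simp add: algebra_simps)
  qed
  show ?thesis
  proof (cases "\<forall>e>0. \<exists>a\<in>A. 0 < a \<and> a < e")
    case True
    have "x \<in> A" for x
    proof -
      have "\<exists>y\<in>A. dist y x < e" if e: "e > 0" for e
      proof -
        obtain a where a: "a \<in> A" "0 < a" "a < e" using True e by blast
        have "of_int \<lfloor>x / a\<rfloor> * a \<in> A" by (rule intmult[OF a(1)])
        moreover have "dist (of_int \<lfloor>x / a\<rfloor> * a) x < e" using rem[OF a(2), of x] a(3) by (auto simp: dist_real_def)
        ultimately show ?thesis by blast
      qed
      then have "x \<in> closure A" by (simp add: closure_approachable)
      then show ?thesis using assms(1) by simp
    qed
    then show ?thesis by auto
  next
    case False
    then obtain e where e: "e > 0" "\<And>a. a \<in> A \<Longrightarrow> 0 < a \<Longrightarrow> e \<le> a" by force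
    show ?thesis
    proof (cases "A \<inter> {e..} = {}")
      case True
      have "a = 0" if "a \<in> A" for a
        using True e(2)[OF that] e(2)[OF neg[OF that]] that neg[OF that] by (cases a "0::real" rule: linorder_cases) (auto simp: disjoint_iff)
      then show ?thesis by (intro disjI2 exI[of _ 1]) force
    next
      case False
      define h where "h = Inf (A \<inter> {e..})"
      have bb: "bdd_below (A \<inter> {e..})" by (rule bdd_belowI[of _ e]) auto
      have hA: "h \<in> A \<inter> {e..}" unfolding h_def
        by (rule closed_contains_Inf) (use False assms(1) bb in auto)
      have h0: "h > 0" using hA e by auto
      have least: "h \<le> a" if "a \<in> A" "0 < a" for a
        unfolding h_def by (rule cInf_lower[OF _ bb]) (use that e in auto)
      have "a \<in> range (\<lambda>k::int. h * of_int k)" if "a \<in> A" for a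
      proof -
        have "a - of_int \<lfloor>a / h\<rfloor> * h \<in> A" using minus[OF that intmult[of h]] hA by auto
        then have "a = of_int \<lfloor>a / h\<rfloor> * h" using least rem[OF h0, of a] by force
        then show ?thesis by (intro image_eqI[where x="\<lfloor>a / h\<rfloor>"]) (auto simp: mult.commute)
      qed
      then show ?thesis using h0 by blast
    qed
  qed
qed

section \<open>Slow variation of harmonic functions\<close>

context drift_law
begin

lemma harm_lip_nonneg: "harm L v \<Longrightarrow> 0 \<le> L"
  unfolding harm_def by (metis abs_ge_zero abs_one diff_zero mult.right_neutral order_trans)

text \<open>The set \<open>A\<close> of admissible shifts has to be the whole line. Closedness uses
  the Lipschitz constant, differences are handled by moving the argument, and a lattice is excluded
  because almost every step lies in \<open>A\<close>.\<close>

lemma harm_slow_variation: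
  assumes h: "harm L v"
  shows "((\<lambda>c. v (c - a) - v c) \<longlongrightarrow> 0) at_top"
proof -
  note [measurable] = harm_measurable[OF h]
  have v01: "0 \<le> v c" "v c \<le> 1" for c using h by (auto simp: harm_def)
  have d1: "\<bar>v a - v b\<bar> \<le> 1" for a b using v01[of a] v01[of b] by auto
  have sq1: "(v a - v b)\<^sup>2 \<le> 1" for a b using d1[of a b] by (simp add: abs_square_le_1)
  have lip: "\<bar>v c - v c'\<bar> \<le> L * \<bar>c - c'\<bar>" for c c' using h by (auto simp: harm_def)
  have L0: "0 \<le> L" by (rule harm_lip_nonneg[OF h])
  define A where "A = {a. ((\<lambda>c. v (c - a) - v c) \<longlongrightarrow> 0) at_top}"
  have "closed A"
    unfolding closure_subset_eq[symmetric]
  proof (rule subsetI, unfold closure_approachable)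
    fix a assume a: "\<forall>e>0. \<exists>y\<in>A. dist y a < e"
    have "((\<lambda>c. v (c - a) - v c) \<longlongrightarrow> 0) at_top"
    proof (rule tendstoI)
      fix e :: real assume e: "e > 0"
      have "e / (2 * (L + 1)) > 0" using e L0 by simp
      then obtain b where b: "b \<in> A" "\<bar>b - a\<bar> < e / (2 * (L + 1))"
        using a by (metis dist_real_def)
      have "L * \<bar>b - a\<bar> \<le> (L + 1) * (e / (2 * (L + 1)))"
        using b(2) L0 by (intro mult_mono) auto
      also have "\<dots> = e / 2" using L0 by (simp add: field_simps)
      finally have Lb: "L * \<bar>b - a\<bar> \<le> e / 2" .
      have "\<forall>\<^sub>F c in at_top. dist (v (c - b) - v c) 0 < e / 2"
        using b(1) e unfolding A_def by (intro tendstoD) auto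
      then show "\<forall>\<^sub>F c in at_top. dist (v (c - a) - v c) 0 < e"
      proof eventually_elim
        case (elim c)
        have "\<bar>v (c - a) - v (c - b)\<bar> \<le> e / 2" using lip[of "c - a" "c - b"] Lb by simp
        then show ?case using elim unfolding dist_real_def by linarith
      qed
    qed
    then show "a \<in> A" by (simp add: A_def)
  qed
  moreover have "0 \<in> A" by (simp add: A_def)
  moreover have "a - b \<in> A" if "a \<in> A" "b \<in> A" for a b
  proof -
    have sh: "filterlim (\<lambda>c. c + b) at_top (at_top :: real filter)" using filterlim_shift_at_top[of "-b"] by simp
    have "((\<lambda>c. v (c + b - a) - v (c + b)) \<longlongrightarrow> 0) at_top" "((\<lambda>c. v (c + b - b) - v (c + b)) \<longlongrightarrow> 0) at_top"
      using filterlim_compose[OF _ sh, of "\<lambda>c. v (c - a) - v c"] filterlim_compose[OF _ sh, of "\<lambda>c. v (c - b) - v c"] that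
      by (auto simp: A_def)
    from tendsto_diff[OF this] show ?thesis by (simp add: A_def algebra_simps)
  qed
  ultimately have dich: "A = UNIV \<or> (\<exists>h>0. A \<subseteq> range (\<lambda>k::int. h * of_int k))"
    by (rule closed_subgroup_real)
  have AE_A: "AE x in F. x \<in> A"
    using AE_support[of F]
  proof (rule AE_mp[OF _ AE_I2[OF impI]])
    show "sets F = sets borel" by simp
    fix a :: real assume supp: "\<forall>U. open U \<longrightarrow> a \<in> U \<longrightarrow> 0 < emeasure F U"
    have "((\<lambda>c. v (c - a) - v c) \<longlongrightarrow> 0) at_top"
    proof (rule tendstoI)
      fix e :: real assume e: "e > 0"
      \<comment> \<open>If \<open>v (c - a)\<close> and \<open>v c\<close> differed by
        \<open>e\<close>, then by the Lipschitz bound \<open>v (c - x)\<close> and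
        \<open>v c\<close> would differ by at least \<open>e / 2\<close> for all \<open>x\<close>
        within \<open>d\<close> of \<open>a\<close>. That ball has mass \<open>p > 0\<close>, so
        \<open>osc v c\<close> would be at least \<open>p * (e/2)\<^sup>2\<close>.\<close>
      define d where "d = e / (2 * (L + 1))"
      have d0: "d > 0" using e L0 by (simp add: d_def)
      have "L * d \<le> (L + 1) * d" using d0 by (intro mult_right_mono) auto
      also have "\<dots> = e / 2" using L0 by (simp add: d_def field_simps)
      finally have Ld: "L * d \<le> e / 2" .
      define p where "p = measure F (ball a d)"
      have p: "p > 0" using supp[rule_format, of "ball a d"] d0 by (simp add: p_def emeasure_eq_measure)
      have "\<forall>\<^sub>F c in at_top. osc v c < p * (e/2)\<^sup>2"
        using p e by (intro order_tendstoD[OF osc_tendsto[OF h]]) auto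
      then show "\<forall>\<^sub>F c in at_top. dist (v (c - a) - v c) 0 < e"
      proof eventually_elim
        case (elim c)
        show ?case
        proof (rule ccontr)
          assume "\<not> dist (v (c - a) - v c) 0 < e"
          then have big: "e \<le> \<bar>v (c - a) - v c\<bar>" by (simp add: dist_real_def)
          have "p * (e/2)\<^sup>2 = (\<integral>x. indicator (ball a d) x * (e/2)\<^sup>2 \<partial>F)" by (simp add: p_def)
          also have "\<dots> \<le> osc v c" unfolding osc_def
          proof (rule integral_mono)
            fix x :: real
            show "indicator (ball a d) x * (e/2)\<^sup>2 \<le> (v (c - x) - v c)\<^sup>2"
            proof (cases "x \<in> ball a d")
              case True
              have "\<bar>v (c - a) - v (c - x)\<bar> \<le> L * \<bar>x - a\<bar>" using lip[of "c - a" "c - x"] by simp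
              also have "\<dots> \<le> L * d" using True L0 by (intro mult_left_mono) (auto simp: dist_real_def)
              finally have "e / 2 \<le> \<bar>v (c - x) - v c\<bar>" using big Ld by linarith
              then have "(e/2)\<^sup>2 \<le> \<bar>v (c - x) - v c\<bar>\<^sup>2" using e by (intro power_mono) auto
              then show ?thesis using True by simp
            qed auto
          next
            show "integrable F (\<lambda>x. indicator (ball a d) x * (e/2)\<^sup>2)"
              by (rule int_bdd[where C="(e/2)\<^sup>2"]) (auto simp: indicator_def)
            show "integrable F (\<lambda>x. (v (c - x) - v c)\<^sup>2)"
              by (rule int_bdd[where C=1]) (auto simp: sq1)
          qed
          finally show False using elim by simp
        qed
      qed
    qed
    then show "a \<in> A" by (simp add: A_def)
  qed
  have "\<not> (\<exists>h>0. A \<subseteq> range (\<lambda>k::int. h * of_int k))"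
  proof safe
    fix h :: real assume hp: "h > 0" and sub: "A \<subseteq> range (\<lambda>k::int. h * of_int k)"
    have "AE x in F. x \<in> range (\<lambda>k::int. h * of_int k)"
      using AE_A by (rule AE_mp) (use sub in \<open>auto intro!: AE_I2\<close>)
    then show False using nonarith_F hp unfolding arithmetic_def by auto
  qed
  then have "a \<in> A" using dich by blast
  then show ?thesis by (simp add: A_def)
qed

text \<open>Pointwise convergence plus a uniform modulus of continuity: a finite net of mesh
  \<open>d\<close> in the compact interval of shifts suffices.\<close>

lemma harm_locally_uniform:
  assumes h: "harm L v" and e: "e > 0"
  shows "\<forall>\<^sub>F c in at_top. \<forall>a. \<bar>a\<bar> \<le> b \<longrightarrow> \<bar>v (c - a) - v c\<bar> \<le> e"
proof -
  have lip: "\<bar>v c - v c'\<bar> \<le> L * \<bar>c - c'\<bar>" for c c' using h by (auto simp: harm_def)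
  have L0: "0 \<le> L" by (rule harm_lip_nonneg[OF h])
  define d where "d = e / (2 * (L + 1))"
  have d0: "d > 0" using e L0 by (simp add: d_def)
  have "L * d \<le> (L + 1) * d" using d0 by (intro mult_right_mono) auto
  also have "\<dots> = e / 2" using L0 by (simp add: d_def field_simps)
  finally have Ld: "L * d \<le> e / 2" .
  have "\<exists>k. finite k \<and> cball (0::real) b \<subseteq> (\<Union>x\<in>k. ball x d)"
    using compact_eq_totally_bounded[THEN iffD1, THEN conjunct2, OF compact_cball[of "0::real" b]] d0 by simp
  then obtain k where k: "finite k" "cball (0::real) b \<subseteq> (\<Union>x\<in>k. ball x d)" by (elim exE conjE)
  have "\<forall>\<^sub>F c in at_top. \<forall>y\<in>k. \<bar>v (c - y) - v c\<bar> < e / 2"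
  proof (intro eventually_ball_finite k ballI)
    fix y
    show "\<forall>\<^sub>F c in at_top. \<bar>v (c - y) - v c\<bar> < e / 2"
      using tendstoD[OF harm_slow_variation[OF h, of y], of "e/2"] e by (simp add: dist_real_def)
  qed
  then show ?thesis
  proof eventually_elim
    case (elim c)
    show ?case
    proof safe
      fix a assume "\<bar>a\<bar> \<le> b"
      then have "a \<in> cball 0 b" by simp
      then obtain y where y: "y \<in> k" "dist y a < d" using k(2) by (auto simp: ball_def)
      have "\<bar>v (c - a) - v (c - y)\<bar> \<le> L * \<bar>y - a\<bar>" using lip[of "c - a" "c - y"] by simp
      also have "\<dots> \<le> L * d" using y L0 by (intro mult_left_mono) (auto simp: dist_real_def)
      finally show "\<bar>v (c - a) - v c\<bar> \<le> e" using Ld elim[rule_format, OF y(1)] by linarith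
    qed
  qed
qed

section \<open>Convergence of harmonic functions through a primitive\<close>

text \<open>The base point 1 is a positive level, so the constant in \<open>prim_const\<close> can
  be evaluated there with \<open>prim v 1 = 0\<close>.\<close>

definition prim :: "(real \<Rightarrow> real) \<Rightarrow> real \<Rightarrow> real" where
  "prim v x = (LBINT s=1..x. v s)"

lemma prim:
  assumes h: "harm L v"
  shows "(prim v has_real_derivative v x) (at x)"
proof -
  have "L-lipschitz_on UNIV v"
  proof (rule lipschitz_onI)
    show "dist (v x) (v y) \<le> L * dist x y" for x y
      using h by (auto simp: harm_def dist_real_def)
    show "0 \<le> L" by (rule harm_lip_nonneg[OF h])
  qed
  then have cont: "continuous_on S v" for S
    using continuous_on_subset[OF lipschitz_on_continuous_on, of L UNIV v S] by simp
  \<comment> \<open>The fundamental theorem gives a derivative within a closed interval; one that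
    contains the base point 1 and has \<open>x\<close> in its interior yields a two-sided
    derivative.\<close>
  define a where "a = min 1 x - 1"
  define b where "b = max 1 x + 1"
  have ab: "a \<le> 1" "1 \<le> b" "a < x" "x < b" by (auto simp: a_def b_def)
  have "((\<lambda>u. LBINT y=1..u. v y) has_vector_derivative v x) (at x within {a..b})"
    using interval_integral_FTC2[of a 1 b v x] ab cont by (simp add: one_ereal_def)
  then have "((\<lambda>u. LBINT y=1..u. v y) has_vector_derivative v x) (at x within {a<..<b})"
    by (rule has_vector_derivative_within_subset) auto
  then show ?thesis
    using ab by (simp add: has_real_derivative_iff_has_vector_derivative prim_def[abs_def]
        has_vector_derivative_within_open[of x "{a<..<b}"])
qed

lemma prim_mvt:
  assumes h: "harm L v"
  obtains s where "\<bar>s - c\<bar> \<le> \<bar>c' - c\<bar>" "prim v c' - prim v c = (c' - c) * v s"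
proof (cases c c' rule: linorder_cases)
  case less
  then obtain s where "c < s" "s < c'" "prim v c' - prim v c = (c' - c) * v s"
    using MVT2[of c c' "prim v" v] prim[OF h] by blast
  then show ?thesis using less by (intro that[of s]) auto
next
  case equal
  then show ?thesis by (intro that[of c]) auto
next
  case greater
  then obtain s where "c' < s" "s < c" "prim v c - prim v c' = (c - c') * v s"
    using MVT2[of c' c "prim v" v] prim[OF h] by blast
  then show ?thesis using greater by (intro that[of s]) (auto simp: algebra_simps)
qed

lemma prim_bound:
  assumes h: "harm L v"
  shows "\<bar>prim v c - prim v (c - x)\<bar> \<le> \<bar>x\<bar>"
proof -
  obtain s where "prim v c - prim v (c - x) = x * v s"
    using prim_mvt[OF h, of "c - x" c] by auto
  moreover have "0 \<le> v s" "v s \<le> 1" using h by (auto simp: harm_def)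
  ultimately show ?thesis by (simp add: abs_mult mult_left_le)
qed

lemma prim_measurable:
  assumes h: "harm L v" shows "prim v \<in> borel_measurable borel"
  by (rule borel_measurable_continuous_onI) (auto intro!: DERIV_isCont[OF prim[OF h]] continuous_at_imp_continuous_on)

lemma prim_int:
  assumes h: "harm L v"
  shows "integrable F (\<lambda>x. prim v c - prim v (c - x))"
proof -
  note [measurable] = prim_measurable[OF h]
  show ?thesis
    by (rule Bochner_Integration.integrable_bound[OF integrable_abs[OF int_F]])
       (auto intro: prim_bound[OF h])
qed

text \<open>Formally the derivative in \<open>c\<close> is the mean of
  \<open>v c - v (c - X)\<close>, zero by harmonicity. Instead of differentiating under the
  integral, a quadratic bound on the increments of \<open>V\<close> shows that its derivative
  vanishes.\<close>

lemma prim_const: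
  assumes h: "harm L v" and "0 < c1" "0 < c2"
  shows "(\<integral>x. prim v c1 - prim v (c1 - x) \<partial>F) = (\<integral>x. prim v c2 - prim v (c2 - x) \<partial>F)"
proof -
  define V where "V c = (\<integral>x. prim v c - prim v (c - x) \<partial>F)" for c
  note [measurable] = harm_measurable[OF h]
  have v01: "0 \<le> v c" "v c \<le> 1" for c using h by (auto simp: harm_def)
  have lip: "\<bar>v c - v c'\<bar> \<le> L * \<bar>c - c'\<bar>" for c c' using h by (auto simp: harm_def)
  have L0: "0 \<le> L" by (rule harm_lip_nonneg[OF h])
  have lin: "\<bar>prim v c' - prim v c - (c' - c) * v c\<bar> \<le> L * (c' - c)\<^sup>2" for c c'
  proof -
    obtain s where s: "\<bar>s - c\<bar> \<le> \<bar>c' - c\<bar>" "prim v c' - prim v c = (c' - c) * v s"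
      using prim_mvt[OF h] by blast
    have "\<bar>prim v c' - prim v c - (c' - c) * v c\<bar> = \<bar>c' - c\<bar> * \<bar>v s - v c\<bar>"
      using s(2) by (simp add: abs_mult[symmetric] algebra_simps)
    also have "\<dots> \<le> \<bar>c' - c\<bar> * (L * \<bar>c' - c\<bar>)"
      using lip[of s c] s(1) L0 by (intro mult_left_mono order_trans[OF lip[of s c]]) auto
    also have "\<dots> = L * (c' - c)\<^sup>2" by (simp add: power2_eq_square)
    finally show ?thesis .
  qed
  \<comment> \<open>The linear term has mean 0 by harmonicity at \<open>c\<close>. Two Taylor
    remainders are left, one based at \<open>c\<close> and one at \<open>c - x\<close>, each at most
    \<open>L * (c' - c)\<^sup>2\<close>.\<close>
  have key: "\<bar>V c' - V c\<bar> \<le> (2 * L) * (c' - c)\<^sup>2" if "c > 0" for c c'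
  proof -
    have i: "integrable F (\<lambda>x. v (c - x))" by (rule int_bdd[where C=1]) (use v01 in auto)
    define D where "D x = (prim v c' - prim v (c' - x)) - (prim v c - prim v (c - x))" for x
    have iD: "integrable F D"
      unfolding D_def by (intro Bochner_Integration.integrable_diff prim_int[OF h])
    have "V c' - V c = (\<integral>x. D x \<partial>F)"
      unfolding V_def D_def by (rule Bochner_Integration.integral_diff[symmetric]) (intro prim_int[OF h])+
    moreover have "(\<integral>x. (c' - c) * (v c - v (c - x)) \<partial>F) = 0"
    proof -
      have "v c = (\<integral>x. v (c - x) \<partial>F)" using h that unfolding harm_def by blast
      then show ?thesis using i by simp
    qed
    moreover have "(\<integral>x. D x - (c' - c) * (v c - v (c - x)) \<partial>F) = (\<integral>x. D x \<partial>F) - (\<integral>x. (c' - c) * (v c - v (c - x)) \<partial>F)"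
      by (rule Bochner_Integration.integral_diff[OF iD]) (use i in auto)
    ultimately have "V c' - V c = (\<integral>x. D x - (c' - c) * (v c - v (c - x)) \<partial>F)" by linarith
    also have "\<bar>\<dots>\<bar> \<le> (\<integral>x. (2 * L) * (c' - c)\<^sup>2 \<partial>F)"
    proof (rule order_trans[OF integral_abs_bound], rule integral_mono)
      fix x
      have "D x - (c' - c) * (v c - v (c - x)) = (prim v c' - prim v c - (c' - c) * v c)
          - (prim v (c' - x) - prim v (c - x) - (c' - x - (c - x)) * v (c - x))"
        unfolding D_def by (simp add: right_diff_distrib)
      moreover have "\<bar>prim v (c' - x) - prim v (c - x) - (c' - x - (c - x)) * v (c - x)\<bar> \<le> L * (c' - c)\<^sup>2"
      proof -
        have "c' - x - (c - x) = c' - c" by simp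
        then show ?thesis using lin[of "c' - x" "c - x"] by metis
      qed
      ultimately have "\<bar>D x - (c' - c) * (v c - v (c - x))\<bar> \<le> L * (c' - c)\<^sup>2 + L * (c' - c)\<^sup>2"
        using lin[of c' c] by linarith
      also have "\<dots> = (2 * L) * (c' - c)\<^sup>2" by simp
      finally show "\<bar>D x - (c' - c) * (v c - v (c - x))\<bar> \<le> (2 * L) * (c' - c)\<^sup>2" .
    qed (use iD i in auto)
    finally show ?thesis by simp
  qed
  have dV: "(V has_real_derivative 0) (at c)" if "c > 0" for c
    unfolding has_field_derivative_iff
  proof (rule Lim_null_comparison)
    show "\<forall>\<^sub>F y in at c. norm ((V y - V c) / (y - c)) \<le> (2 * L) * \<bar>y - c\<bar>"
      unfolding eventually_at
    proof (intro exI[of _ 1] conjI ballI impI)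
      fix y assume "y \<noteq> c \<and> dist y c < 1"
      then have "0 < \<bar>y - c\<bar>" by simp
      moreover have "\<bar>V y - V c\<bar> \<le> (2 * L * \<bar>y - c\<bar>) * \<bar>y - c\<bar>"
      proof -
        have "(y - c)\<^sup>2 = \<bar>y - c\<bar> * \<bar>y - c\<bar>" by (simp add: power2_eq_square)
        then show ?thesis using key[OF that, of y] by (simp only: mult.assoc)
      qed
      ultimately show "norm ((V y - V c) / (y - c)) \<le> (2 * L) * \<bar>y - c\<bar>"
        unfolding real_norm_def abs_divide by (rule pos_divide_le_eq[THEN iffD2])
    qed simp
    show "((\<lambda>y. (2 * L) * \<bar>y - c\<bar>) \<longlongrightarrow> 0) (at c)"
      by (intro tendsto_mult_right_zero tendsto_rabs_zero LIM_zero tendsto_ident_at)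
  qed
  have "V c1 = V c2"
  proof (rule DERIV_isconst3[of 0 "max c1 c2 + 1" c1 c2 V])
    show "0 < max c1 c2 + 1" "c1 \<in> {0<..<max c1 c2 + 1}" "c2 \<in> {0<..<max c1 c2 + 1}"
      using assms(2,3) by auto
    show "(V has_real_derivative 0) (at x)" if "x \<in> {0<..<max c1 c2 + 1}" for x
      using that by (intro dV) simp
  qed
  then show ?thesis by (simp only: V_def)
qed

text \<open>The mean of \<open>prim v 1 - prim v (1 - X)\<close> divided by the drift. A formula
  instead of \<open>Lim\<close> lets \<open>harm_stable\<close> interchange this limit with
  pointwise limits of harmonic functions.\<close>

definition hlim :: "(real \<Rightarrow> real) \<Rightarrow> real" where
  "hlim v = (\<integral>x. - prim v (1 - x) \<partial>F) / (\<integral>x. x \<partial>F)"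

lemma prim_1 [simp]: "prim v 1 = 0"
  by (simp add: prim_def one_ereal_def)

theorem harm_tendsto:
  assumes h: "harm L v"
  shows "(v \<longlongrightarrow> hlim v) at_top"
proof -
  define m where "m = (\<integral>x. x \<partial>F)"
  have m: "m > 0" using mean_pos by (simp add: m_def)
  note [measurable] = harm_measurable[OF h] prim_measurable[OF h]
  have v01: "0 \<le> v c" "v c \<le> 1" for c using h by (auto simp: harm_def)
  \<comment> \<open>By the mean value theorem \<open>prim v c - prim v (c - x) = x * v s\<close>
    with \<open>s\<close> within \<open>\<bar>x\<bar>\<close> of \<open>c\<close>, where
    \<open>v\<close> is almost constant by locally uniform slow variation; hence the integrand tends
    to 0 for each \<open>x\<close>.\<close>
  have "((\<lambda>c. \<integral>x. prim v c - prim v (c - x) - x * v c \<partial>F) \<longlongrightarrow> (\<integral>x. 0 \<partial>F)) at_top"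
  proof (rule integral_dominated_convergence_at_top[where w="\<lambda>x. 2 * \<bar>x\<bar>"])
    show "integrable F (\<lambda>x. 2 * \<bar>x\<bar>)" using int_F by simp
    have "\<bar>prim v c - prim v (c - x) - x * v c\<bar> \<le> 2 * \<bar>x\<bar>" for c x
    proof -
      have "\<bar>x * v c\<bar> \<le> \<bar>x\<bar>" using v01[of c] by (simp add: abs_mult mult_left_le)
      then show ?thesis using prim_bound[OF h, of c x] by linarith
    qed
    then show "\<forall>\<^sub>F c in at_top. AE x in F. norm (prim v c - prim v (c - x) - x * v c) \<le> 2 * \<bar>x\<bar>"
      by auto
    show "AE x in F. ((\<lambda>c. prim v c - prim v (c - x) - x * v c) \<longlongrightarrow> 0) at_top"
    proof (intro AE_I2 tendstoI)
      fix x e :: real assume e: "e > 0"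
      define d where "d = e / (2 * (\<bar>x\<bar> + 1))"
      have d: "d > 0" using e by (simp add: d_def add_nonneg_pos)
      have "\<bar>x\<bar> * d \<le> (\<bar>x\<bar> + 1) * d" using d by (intro mult_right_mono) auto
      also have "\<dots> = e / 2" by (simp add: d_def field_simps add_nonneg_eq_0_iff)
      finally have xd: "\<bar>x\<bar> * d \<le> e / 2" .
      show "\<forall>\<^sub>F c in at_top. dist (prim v c - prim v (c - x) - x * v c) 0 < e"
        using harm_locally_uniform[OF h d, of "\<bar>x\<bar>"]
      proof eventually_elim
        case (elim c)
        obtain s where s: "\<bar>s - c\<bar> \<le> \<bar>x\<bar>" "prim v (c - x) - prim v c = - x * v s"
          using prim_mvt[OF h, of c "c - x"] by auto
        have "\<bar>prim v c - prim v (c - x) - x * v c\<bar> = \<bar>x\<bar> * \<bar>v s - v c\<bar>"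
          using s(2) by (simp add: abs_mult[symmetric] algebra_simps)
        also have "\<dots> \<le> \<bar>x\<bar> * d"
          using elim[rule_format, of "c - s"] s(1) by (intro mult_left_mono) (auto simp: abs_minus_commute)
        finally show ?case using xd e by (simp add: dist_real_def)
      qed
    qed
  qed auto
  moreover have "\<forall>\<^sub>F c in at_top. (\<integral>x. prim v c - prim v (c - x) - x * v c \<partial>F) = (\<integral>x. - prim v (1 - x) \<partial>F) - m * v c"
    using eventually_gt_at_top[of 0]
  proof eventually_elim
    case (elim c)
    have "(\<integral>x. prim v c - prim v (c - x) - x * v c \<partial>F) = (\<integral>x. prim v c - prim v (c - x) \<partial>F) - m * v c"
      using prim_int[OF h] int_F by (simp add: m_def)
    then show ?case using prim_const[OF h elim, of 1] by simp
  qed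
  ultimately have "((\<lambda>c. (\<integral>x. - prim v (1 - x) \<partial>F) - m * v c) \<longlongrightarrow> 0) at_top"
    by (simp add: tendsto_cong)
  from tendsto_diff[OF tendsto_const[of "\<integral>x. - prim v (1 - x) \<partial>F"] this]
  have "((\<lambda>c. m * v c) \<longlongrightarrow> (\<integral>x. - prim v (1 - x) \<partial>F)) at_top" by simp
  from tendsto_divide[OF this tendsto_const[of m]] m show ?thesis
    by (simp add: hlim_def m_def)
qed

text \<open>Primitives converge pointwise by dominated convergence on bounded intervals, and
  \<open>\<bar>x\<bar>\<close> dominates the integrands in \<open>hlim\<close>. This will show that
  the limiting overshoot law is continuous and has full mass.\<close>

lemma harm_stable:
  assumes h: "\<And>n. harm L (w n)" "harm L v" and lim: "\<And>c. (\<lambda>n. w n c) \<longlonglongrightarrow> v c"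
  shows "(\<lambda>n. hlim (w n)) \<longlonglongrightarrow> hlim v"
proof -
  note [measurable] = harm_measurable[OF h(1)] harm_measurable[OF h(2)] prim_measurable[OF h(1)] prim_measurable[OF h(2)]
  have P: "(\<lambda>n. prim (w n) x) \<longlonglongrightarrow> prim v x" for x
  proof -
    have *: "(\<lambda>n. LBINT s:S. w n s) \<longlonglongrightarrow> (LBINT s:S. v s)" if [measurable]: "S \<in> sets borel" and "emeasure lborel S < \<infinity>" for S
      unfolding set_lebesgue_integral_def
      by (rule integral_dominated_convergence[where w="indicat_real S"])
        (use that h in \<open>auto intro!: tendsto_intros lim split: split_indicator simp: harm_def integrable_indicator_iff\<close>)
    show ?thesis
    proof (cases "1 \<le> x")
      case True
      then show ?thesis using *[of "{1<..<x}"]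
        by (simp add: prim_def interval_lebesgue_integral_def one_ereal_def)
    next
      case False
      then show ?thesis using tendsto_minus[OF *[of "{x<..<1}"]]
        by (simp add: prim_def interval_lebesgue_integral_def one_ereal_def)
    qed
  qed
  have "(\<lambda>n. \<integral>x. - prim (w n) (1 - x) \<partial>F) \<longlonglongrightarrow> (\<integral>x. - prim v (1 - x) \<partial>F)"
  proof (rule integral_dominated_convergence[where w="\<lambda>x. \<bar>x\<bar>"])
    show "AE x in F. norm (- prim (w n) (1 - x)) \<le> \<bar>x\<bar>" for n
      using prim_bound[OF h(1), of n 1] by auto
    show "AE x in F. (\<lambda>n. - prim (w n) (1 - x)) \<longlonglongrightarrow> - prim v (1 - x)"
      by (intro AE_I2 tendsto_minus P)
    show "integrable F (\<lambda>x. \<bar>x\<bar>)" using int_F by simp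
  qed auto
  then show ?thesis unfolding hlim_def
    by (rule tendsto_divide[OF _ tendsto_const]) (use mean_pos in simp)
qed

end

subsection \<open>Sequences of independent, identically distributed observations\<close>

locale iid_seq = prob_space D for D :: "'x measure"
begin

abbreviation "\<Omega> \<equiv> (\<Pi>\<^sub>M i\<in>(UNIV :: nat set). D)"

sublocale seq: sequence_space D
  by unfold_locales

sublocale D\<Omega>: pair_prob_space D \<Omega> ..

definition shift :: "(nat \<Rightarrow> 'x) \<Rightarrow> nat \<Rightarrow> 'x" where
  "shift \<omega> = (\<lambda>k. \<omega> (Suc k))"

lemma shift_case_nat [simp]: "shift (case_nat x \<omega>) = \<omega>"
  by (simp add: shift_def)

lemma measurable_shift [measurable]: "shift \<in> measurable \<Omega> \<Omega>"
  unfolding shift_def by (rule measurable_PiM_single') (auto simp: space_PiM)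

lemma measurable_cons [measurable]: "(\<lambda>(x, \<omega>). case_nat x \<omega>) \<in> measurable (D \<Otimes>\<^sub>M \<Omega>) \<Omega>"
  by (rule measurable_case_nat'[of fst _ _ snd, unfolded split_beta'[symmetric]]) auto

lemma nn_integral_first_step:
  assumes [measurable]: "g \<in> borel_measurable \<Omega>"
  shows "(\<integral>\<^sup>+\<omega>. g \<omega> \<partial>\<Omega>) = (\<integral>\<^sup>+x. (\<integral>\<^sup>+\<omega>. g (case_nat x \<omega>) \<partial>\<Omega>) \<partial>D)"
proof -
  have "(\<integral>\<^sup>+\<omega>. g \<omega> \<partial>\<Omega>) = (\<integral>\<^sup>+\<omega>. g \<omega> \<partial>distr (D \<Otimes>\<^sub>M \<Omega>) \<Omega> (\<lambda>(x, \<omega>). case_nat x \<omega>))"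
    by (simp add: seq.PiM_iter)
  also have "\<dots> = (\<integral>\<^sup>+p. g (case_nat (fst p) (snd p)) \<partial>(D \<Otimes>\<^sub>M \<Omega>))"
    by (subst nn_integral_distr) (auto simp: split_beta')
  also have "\<dots> = (\<integral>\<^sup>+x. (\<integral>\<^sup>+\<omega>. g (case_nat x \<omega>) \<partial>\<Omega>) \<partial>D)"
    by (subst seq.P.nn_integral_fst[symmetric]) (auto simp: split_beta')
  finally show ?thesis .
qed

lemma integrable_first_step:
  fixes g :: "(nat \<Rightarrow> 'x) \<Rightarrow> real"
  assumes "integrable \<Omega> g"
  shows "integrable (D \<Otimes>\<^sub>M \<Omega>) (\<lambda>(x, \<omega>). g (case_nat x \<omega>))"
proof -
  have "integrable (distr (D \<Otimes>\<^sub>M \<Omega>) \<Omega> (\<lambda>(x, \<omega>). case_nat x \<omega>)) g"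
    using assms by (simp add: seq.PiM_iter)
  then show ?thesis
    by (subst (asm) integrable_distr_eq) (use assms in \<open>auto simp: split_beta'\<close>)
qed

lemma integral_first_step:
  fixes g :: "(nat \<Rightarrow> 'x) \<Rightarrow> real"
  assumes int: "integrable \<Omega> g"
  shows "(\<integral>\<omega>. g \<omega> \<partial>\<Omega>) = (\<integral>x. (\<integral>\<omega>. g (case_nat x \<omega>) \<partial>\<Omega>) \<partial>D)"
proof -
  have [measurable]: "g \<in> borel_measurable \<Omega>" using int by auto
  have "(\<integral>\<omega>. g \<omega> \<partial>\<Omega>) = (\<integral>\<omega>. g \<omega> \<partial>distr (D \<Otimes>\<^sub>M \<Omega>) \<Omega> (\<lambda>(x, \<omega>). case_nat x \<omega>))"
    by (simp add: seq.PiM_iter)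
  also have "\<dots> = (\<integral>p. (case p of (x, \<omega>) \<Rightarrow> g (case_nat x \<omega>)) \<partial>(D \<Otimes>\<^sub>M \<Omega>))"
    by (subst integral_distr) (auto simp: split_beta')
  also have "\<dots> = (\<integral>x. (\<integral>\<omega>. g (case_nat x \<omega>) \<partial>\<Omega>) \<partial>D)"
    using D\<Omega>.integral_fst'[OF integrable_first_step[OF int]] by simp
  finally show ?thesis .
qed

lemma distr_shift: "distr \<Omega> \<Omega> shift = \<Omega>"
proof (rule measure_eqI)
  fix A assume "A \<in> sets (distr \<Omega> \<Omega> shift)"
  then have [measurable]: "A \<in> sets \<Omega>" by simp
  have "emeasure (distr \<Omega> \<Omega> shift) A = (\<integral>\<^sup>+\<omega>. indicator A (shift \<omega>) \<partial>\<Omega>)"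
    by (subst nn_integral_indicator[symmetric], simp, subst nn_integral_distr) simp_all
  also have "\<dots> = (\<integral>\<^sup>+x. (\<integral>\<^sup>+\<omega>. indicator A \<omega> \<partial>\<Omega>) \<partial>D)"
    by (subst nn_integral_first_step) simp_all
  also have "\<dots> = emeasure \<Omega> A" by (simp add: emeasure_space_1)
  finally show "emeasure (distr \<Omega> \<Omega> shift) A = emeasure \<Omega> A" .
qed simp

lemma integrable_shift:
  fixes g :: "(nat \<Rightarrow> 'x) \<Rightarrow> real"
  assumes "integrable \<Omega> g" shows "integrable \<Omega> (\<lambda>\<omega>. g (shift \<omega>))"
  using integrable_distr[of shift \<Omega> \<Omega> g] assms by (simp add: distr_shift)

lemma integral_shift:
  fixes g :: "(nat \<Rightarrow> 'x) \<Rightarrow> real"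
  assumes [measurable]: "g \<in> borel_measurable \<Omega>" shows "(\<integral>\<omega>. g (shift \<omega>) \<partial>\<Omega>) = (\<integral>\<omega>. g \<omega> \<partial>\<Omega>)"
  using integral_distr[of shift \<Omega> \<Omega> g] assms by (simp add: distr_shift)

lemma distr_coord: "distr \<Omega> D (\<lambda>\<omega>. \<omega> k) = D"
  using seq.PiM_component[of k] by simp

lemma integrable_coord:
  fixes f :: "'x \<Rightarrow> real"
  assumes "integrable D f" shows "integrable \<Omega> (\<lambda>\<omega>. f (\<omega> k))"
  using integrable_distr[of "\<lambda>\<omega>. \<omega> k" \<Omega> D f] assms by (simp add: distr_coord)

lemma AE_all_coords:
  assumes "AE x in D. Q x" shows "AE \<omega> in \<Omega>. \<forall>k. Q (\<omega> k)"
proof -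
  have "AE x in distr \<Omega> D (\<lambda>\<omega>. \<omega> k). Q x" for k
    using assms by (simp only: distr_coord)
  then have "AE \<omega> in \<Omega>. Q (\<omega> k)" for k
    by (rule AE_distrD[rotated]) simp
  then show ?thesis by (simp add: AE_all_countable)
qed

section \<open>Running maxima and divergence of walks with positive drift\<close>

text \<open>The maximum of the partial sums up to index \<open>n\<close>, the empty sum included.
  The recursion splits off the first coordinate, so that the shift enters.\<close>

primrec runmax :: "('x \<Rightarrow> real) \<Rightarrow> nat \<Rightarrow> (nat \<Rightarrow> 'x) \<Rightarrow> real" where
  "runmax \<psi> 0 \<omega> = 0"
| "runmax \<psi> (Suc n) \<omega> = max 0 (\<psi> (\<omega> 0) + runmax \<psi> n (shift \<omega>))"

lemma runmax_nonneg: "0 \<le> runmax \<psi> n \<omega>"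
  by (cases n) auto

lemma runmax_mono: "runmax \<psi> n \<omega> \<le> runmax \<psi> (Suc n) \<omega>"
proof (induction n arbitrary: \<omega>)
  case (Suc n)
  show ?case using Suc[of "shift \<omega>"] by simp
qed simp

lemma runmax_ge: "k \<le> n \<Longrightarrow> (\<Sum>i<k. \<psi> (\<omega> i)) \<le> runmax \<psi> n \<omega>"
proof (induction n arbitrary: k \<omega>)
  case (Suc n)
  show ?case
  proof (cases k)
    case (Suc j)
    then have "(\<Sum>i<k. \<psi> (\<omega> i)) = \<psi> (\<omega> 0) + (\<Sum>i<j. \<psi> (shift \<omega> i))"
      by (simp add: sum.lessThan_Suc_shift shift_def del: sum.lessThan_Suc)
    also have "\<dots> \<le> \<psi> (\<omega> 0) + runmax \<psi> n (shift \<omega>)" using Suc.IH[of j "shift \<omega>"] Suc.prems Suc by simp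
    finally show ?thesis by simp
  qed simp
qed simp

lemma runmax_integrable:
  assumes "integrable D \<psi>" shows "integrable \<Omega> (runmax \<psi> n)"
proof (induction n)
  case (Suc n)
  show ?case
    by (simp, intro integrable_max integrable_zero Bochner_Integration.integrable_add integrable_coord integrable_shift Suc assms)
qed simp

text \<open>Maximal ergodic argument: on the shift-invariant event \<open>G\<close> that the running maxima are unbounded,
  \<open>runmax (Suc n) - runmax n \<circ> shift\<close> has nonnegative mean and tends to \<open>\<psi> (\<omega> 0)\<close>.\<close>

lemma partial_sums_bdd_above:
  fixes \<psi> :: "'x \<Rightarrow> real"
  assumes int: "integrable D \<psi>" and neg: "(\<integral>x. \<psi> x \<partial>D) < 0"
  shows "AE \<omega> in \<Omega>. \<exists>b. \<forall>n. (\<Sum>i<n. \<psi> (\<omega> i)) \<le> b"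
proof -
  have [measurable]: "\<psi> \<in> borel_measurable D" using int by auto
  have [measurable]: "runmax \<psi> n \<in> borel_measurable \<Omega>" for n using runmax_integrable[OF int] by auto
  define G where "G = {\<omega> \<in> space \<Omega>. \<forall>b::nat. \<exists>n. real b < runmax \<psi> n \<omega>}"
  have [measurable]: "G \<in> sets \<Omega>" unfolding G_def by measurable
  have inv: "shift \<omega> \<in> G \<longleftrightarrow> \<omega> \<in> G" if sp: "\<omega> \<in> space \<Omega>" for \<omega>
  proof -
    have sp': "shift \<omega> \<in> space \<Omega>" using sp measurable_space[OF measurable_shift] by auto
    show ?thesis
    proof
      assume a: "shift \<omega> \<in> G"
      have "\<exists>n. real b < runmax \<psi> n \<omega>" for b
      proof -
        obtain b' :: nat where "real b - \<psi> (\<omega> 0) \<le> real b'" using real_arch_simple by blast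
        moreover obtain n where "real b' < runmax \<psi> n (shift \<omega>)" using a by (auto simp: G_def)
        ultimately show ?thesis by (intro exI[of _ "Suc n"]) auto
      qed
      then show "\<omega> \<in> G" using sp by (auto simp: G_def)
    next
      assume a: "\<omega> \<in> G"
      have "\<exists>n. real b < runmax \<psi> n (shift \<omega>)" for b
      proof -
        obtain b' :: nat where b': "real b + \<psi> (\<omega> 0) \<le> real b'" using real_arch_simple by blast
        obtain n where n: "real b' < runmax \<psi> n \<omega>" using a by (auto simp: G_def)
        then obtain m where "n = Suc m" by (cases n) auto
        then show ?thesis using n b' by (intro exI[of _ m]) (auto simp: max_def split: if_splits)
      qed
      then show "shift \<omega> \<in> G" using sp' by (auto simp: G_def)
    qed
  qed
  \<comment> \<open>On \<open>G\<close> this is \<open>runmax \<psi> (Suc n) \<omega> - runmax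
    \<psi> n (shift \<omega>)\<close>, rewritten through
    \<open>max 0 (a + m) - m = max (- m) a\<close>. The form shows both the bound by
    \<open>\<bar>\<psi> (\<omega> 0)\<bar>\<close> and the limit \<open>\<psi> (\<omega> 0)\<close>
    when the running maxima are unbounded.\<close>
  define u where "u n \<omega> = max (- runmax \<psi> n (shift \<omega>)) (\<psi> (\<omega> 0)) * indicator G \<omega>" for n \<omega>
  have ub: "\<bar>u n \<omega>\<bar> \<le> \<bar>\<psi> (\<omega> 0)\<bar>" for n \<omega>
    using runmax_nonneg[of \<psi> n "shift \<omega>"] by (auto simp: u_def indicator_def max_def)
  have [measurable]: "u n \<in> borel_measurable \<Omega>" for n unfolding u_def by measurable
  have iu: "integrable \<Omega> (u n)" for n
    by (rule Bochner_Integration.integrable_bound[OF integrable_coord[OF integrable_abs[OF int], of 0]]) (use ub in auto)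
  have u_nonneg: "0 \<le> (\<integral>\<omega>. u n \<omega> \<partial>\<Omega>)" for n
  proof -
    have i1: "integrable \<Omega> (\<lambda>\<omega>. runmax \<psi> n \<omega> * indicator G \<omega>)" for n
      by (intro integrable_mult_indicator[where f="runmax \<psi> n", simplified mult.commute[of "indicator _ _"] real_scaleR_def] runmax_integrable int) auto
    have "(\<integral>\<omega>. runmax \<psi> n \<omega> * indicator G \<omega> \<partial>\<Omega>) = (\<integral>\<omega>. runmax \<psi> n (shift \<omega>) * indicator G (shift \<omega>) \<partial>\<Omega>)"
      by (subst integral_shift[where g="\<lambda>\<omega>. runmax \<psi> n \<omega> * indicator G \<omega>"]) auto
    also have "\<dots> = (\<integral>\<omega>. runmax \<psi> n (shift \<omega>) * indicator G \<omega> \<partial>\<Omega>)"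
      by (intro Bochner_Integration.integral_cong) (auto simp: inv indicator_def)
    finally have e: "(\<integral>\<omega>. runmax \<psi> n (shift \<omega>) * indicator G \<omega> \<partial>\<Omega>) = (\<integral>\<omega>. runmax \<psi> n \<omega> * indicator G \<omega> \<partial>\<Omega>)" ..
    have i2: "integrable \<Omega> (\<lambda>\<omega>. runmax \<psi> n (shift \<omega>) * indicator G \<omega>)"
      by (intro integrable_mult_indicator[where f="\<lambda>\<omega>. runmax \<psi> n (shift \<omega>)", simplified mult.commute[of "indicator _ _"] real_scaleR_def] integrable_shift runmax_integrable int) auto
    have "u n \<omega> = runmax \<psi> (Suc n) \<omega> * indicator G \<omega> - runmax \<psi> n (shift \<omega>) * indicator G \<omega>" for \<omega>
      by (auto simp: u_def indicator_def max_def)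
    then have "(\<integral>\<omega>. u n \<omega> \<partial>\<Omega>) = (\<integral>\<omega>. runmax \<psi> (Suc n) \<omega> * indicator G \<omega> \<partial>\<Omega>) - (\<integral>\<omega>. runmax \<psi> n (shift \<omega>) * indicator G \<omega> \<partial>\<Omega>)"
      by (simp only: Bochner_Integration.integral_diff[OF i1 i2])
    moreover have "(\<integral>\<omega>. runmax \<psi> n \<omega> * indicator G \<omega> \<partial>\<Omega>) \<le> (\<integral>\<omega>. runmax \<psi> (Suc n) \<omega> * indicator G \<omega> \<partial>\<Omega>)"
      by (intro integral_mono i1) (auto simp: indicator_def runmax_mono simp del: runmax.simps)
    ultimately show ?thesis using e by linarith
  qed
  have "(\<lambda>n. \<integral>\<omega>. u n \<omega> \<partial>\<Omega>) \<longlonglongrightarrow> (\<integral>\<omega>. \<psi> (\<omega> 0) * indicator G \<omega> \<partial>\<Omega>)"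
  proof (rule integral_dominated_convergence[where w="\<lambda>\<omega>. \<bar>\<psi> (\<omega> 0)\<bar>"])
    show "integrable \<Omega> (\<lambda>\<omega>. \<bar>\<psi> (\<omega> 0)\<bar>)" using integrable_coord[OF integrable_abs[OF int], of 0] by simp
    show "AE \<omega> in \<Omega>. (\<lambda>n. u n \<omega>) \<longlonglongrightarrow> \<psi> (\<omega> 0) * indicator G \<omega>"
    proof (rule AE_I2)
      fix \<omega> assume sp: "\<omega> \<in> space \<Omega>"
      show "(\<lambda>n. u n \<omega>) \<longlonglongrightarrow> \<psi> (\<omega> 0) * indicator G \<omega>"
      proof (cases "\<omega> \<in> G")
        case True
        then have "shift \<omega> \<in> G" using inv[OF sp] by simp
        obtain b :: nat where b: "- \<psi> (\<omega> 0) \<le> real b" using real_arch_simple by blast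
        obtain N where N: "real b < runmax \<psi> N (shift \<omega>)" using \<open>shift \<omega> \<in> G\<close> by (auto simp: G_def)
        have "u n \<omega> = \<psi> (\<omega> 0) * indicator G \<omega>" if "n \<ge> N" for n
        proof -
          have "runmax \<psi> N (shift \<omega>) \<le> runmax \<psi> n (shift \<omega>)"
            using lift_Suc_mono_le[of "\<lambda>n. runmax \<psi> n (shift \<omega>)" N n] runmax_mono that by blast
          then show ?thesis using True b N by (simp add: u_def)
        qed
        then show ?thesis by (intro tendsto_eventually) (auto simp: eventually_sequentially)
      qed (simp add: u_def)
    qed
  qed (use ub in auto)
  then have "0 \<le> (\<integral>\<omega>. \<psi> (\<omega> 0) * indicator G \<omega> \<partial>\<Omega>)"
    by (rule LIMSEQ_le_const) (use u_nonneg in auto)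
  \<comment> \<open>By invariance, membership in \<open>G\<close> may be tested on the shifted path,
    which is independent of the first coordinate; the integral then factorises.\<close>
  also have "(\<integral>\<omega>. \<psi> (\<omega> 0) * indicator G \<omega> \<partial>\<Omega>) = (\<integral>\<omega>. \<psi> (\<omega> 0) * indicator G (shift \<omega>) \<partial>\<Omega>)"
    by (intro Bochner_Integration.integral_cong) (auto simp: inv indicator_def)
  also have "\<dots> = (\<integral>x. \<psi> x * measure \<Omega> G \<partial>D)"
  proof (subst integral_first_step)
    show "integrable \<Omega> (\<lambda>\<omega>. \<psi> (\<omega> 0) * indicator G (shift \<omega>))"
      by (rule Bochner_Integration.integrable_bound[OF integrable_coord[OF integrable_abs[OF int], of 0]]) (auto simp: indicator_def)
  qed simp
  also have "\<dots> = (\<integral>x. \<psi> x \<partial>D) * measure \<Omega> G" by simp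
  finally have "measure \<Omega> G \<le> 0" using neg by (simp add: zero_le_mult_iff)
  then have "measure \<Omega> G = 0" using measure_nonneg[of \<Omega> G] by linarith
  then have "AE \<omega> in \<Omega>. \<omega> \<notin> G"
    by (intro AE_not_in) (simp add: null_sets_def seq.P.emeasure_eq_measure)
  then show ?thesis
  proof (rule AE_mp[OF _ AE_I2[OF impI]])
    fix \<omega> assume "\<omega> \<in> space \<Omega>" "\<omega> \<notin> G"
    then obtain b :: nat where "\<And>n. runmax \<psi> n \<omega> \<le> real b" by (force simp: G_def not_less)
    then show "\<exists>b. \<forall>n. (\<Sum>i<n. \<psi> (\<omega> i)) \<le> b"
      by (intro exI[of _ "real b"] allI order_trans[OF runmax_ge[OF order_refl]])
  qed
qed

text \<open>The summands \<open>m - \<phi>\<close>, with \<open>m\<close> half the mean, still have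
  negative mean, so their sums are bounded above by some \<open>b\<close> and the walk stays above
  \<open>n * m - b\<close>.\<close>

lemma partial_sums_at_top:
  fixes \<phi> :: "'x \<Rightarrow> real"
  assumes int: "integrable D \<phi>" and pos: "0 < (\<integral>x. \<phi> x \<partial>D)"
  shows "AE \<omega> in \<Omega>. filterlim (\<lambda>n. \<Sum>i<n. \<phi> (\<omega> i)) at_top sequentially"
proof -
  define m where "m = (\<integral>x. \<phi> x \<partial>D) / 2"
  have m: "m > 0" using pos by (simp add: m_def)
  have "(\<integral>x. m - \<phi> x \<partial>D) < 0" using int pos by (simp add: prob_space m_def)
  from partial_sums_bdd_above[OF _ this] int
  have "AE \<omega> in \<Omega>. \<exists>b. \<forall>n. (\<Sum>i<n. m - \<phi> (\<omega> i)) \<le> b" by simp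
  then show ?thesis
  proof eventually_elim
    case (elim \<omega>)
    then obtain b where b: "\<And>n. (\<Sum>i<n. m - \<phi> (\<omega> i)) \<le> b" by blast
    have "filterlim (\<lambda>n. real n * m - b) at_top sequentially"
      using m by real_asymp
    then show ?case
    proof (rule filterlim_at_top_mono, intro always_eventually allI)
      show "real n * m - b \<le> (\<Sum>i<n. \<phi> (\<omega> i))" for n
        using b[of n] by (simp add: sum_subtractf)
    qed
  qed
qed

end

subsection \<open>Convergence of the overshoot distribution\<close>

locale random_walk = iid_seq D for D :: "'x measure" +
  fixes \<phi> :: "'x \<Rightarrow> real"
  assumes int_phi: "integrable D \<phi>"
    and mean_phi: "0 < (\<integral>x. \<phi> x \<partial>D)"
    and nonarith_phi: "\<not> arithmetic D \<phi>"
begin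

definition S :: "nat \<Rightarrow> (nat \<Rightarrow> 'x) \<Rightarrow> real" where
  "S n \<omega> = (\<Sum>i<n. \<phi> (\<omega> i))"

definition F where "F = distr D borel \<phi>"

lemma measurable_phi [measurable]: "\<phi> \<in> borel_measurable D"
  using int_phi by auto

lemma measurable_S [measurable]: "S n \<in> borel_measurable \<Omega>"
  unfolding S_def by measurable

lemma S_0 [simp]: "S 0 \<omega> = 0"
  by (simp add: S_def)

lemma S_Suc_cons: "S (Suc n) (case_nat y \<omega>) = \<phi> y + S n \<omega>"
  by (simp add: S_def sum.lessThan_Suc_shift del: sum.lessThan_Suc)

lemma S_at_top: "AE \<omega> in \<Omega>. filterlim (\<lambda>n. S n \<omega>) at_top sequentially"
  unfolding S_def by (rule partial_sums_at_top[OF int_phi mean_phi])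

sublocale FF: drift_law F
proof -
  interpret F: real_distribution F unfolding F_def by simp
  show "drift_law F"
  proof
    show "integrable F (\<lambda>x. x)" "0 < (\<integral>x. x \<partial>F)"
      unfolding F_def using int_phi mean_phi by (simp_all add: integrable_distr_eq integral_distr)
    show "\<not> arithmetic F (\<lambda>x. x)"
    proof
      assume "arithmetic F (\<lambda>x. x)"
      then obtain h where h: "h > 0" "AE x in F. x \<in> range (\<lambda>k::int. h * of_int k)"
        by (auto simp: arithmetic_def)
      have "AE x in D. \<phi> x \<in> range (\<lambda>k::int. h * of_int k)"
        using h(2) unfolding F_def by (rule AE_distrD[rotated]) simp
      then show False using nonarith_phi h(1) by (auto simp: arithmetic_def)
    qed
  qed
qed

section \<open>First passage events and overshoot probabilities\<close>

text \<open>Spelled out by quantifiers over times instead of by \<open>first_up\<close>, so that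
  measurability, also jointly in the level, and the decomposition at the first step can be read off.
  Paths that never reach \<open>c\<close> do not count.\<close>

definition crosses :: "real \<Rightarrow> real \<Rightarrow> (nat \<Rightarrow> 'x) \<Rightarrow> bool" where
  "crosses c x \<omega> \<longleftrightarrow> (\<exists>t. c \<le> S t \<omega> \<and> (\<forall>s<t. S s \<omega> < c) \<and> S t \<omega> - c \<le> x)"

definition ocdf :: "real \<Rightarrow> real \<Rightarrow> real" where
  "ocdf c x = (\<integral>\<omega>. of_bool (crosses c x \<omega>) \<partial>\<Omega>)"

lemma first_up_eq:
  assumes "c \<le> S t \<omega>" "\<forall>s<t. S s \<omega> < c"
  shows "first_up S c \<omega> = t"
  unfolding first_up_def using assms by (intro Least_equality) (auto simp: not_le[symmetric])

lemma first_up: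
  assumes "\<exists>t. c \<le> S t \<omega>"
  shows "c \<le> S (first_up S c \<omega>) \<omega>" "\<forall>s<first_up S c \<omega>. S s \<omega> < c"
  unfolding first_up_def using LeastI_ex[OF assms] not_less_Least[of _ "\<lambda>t. c \<le> S t \<omega>"]
  by (auto simp: not_le)

lemma crosses_iff:
  "crosses c x \<omega> \<longleftrightarrow> (\<exists>t. c \<le> S t \<omega>) \<and> S (first_up S c \<omega>) \<omega> - c \<le> x"
  unfolding crosses_def using first_up[of c \<omega>] first_up_eq[of c _ \<omega>] by blast

lemma measurable_crosses [measurable]: "Measurable.pred \<Omega> (crosses c x)"
  unfolding crosses_def by measurable

lemma measurable_crosses2 [measurable]: "Measurable.pred (borel \<Otimes>\<^sub>M \<Omega>) (\<lambda>p. crosses (fst p) x (snd p))"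
  unfolding crosses_def by measurable

lemma ocdf_measurable [measurable]: "(\<lambda>c. ocdf c x) \<in> borel_measurable borel"
  unfolding ocdf_def by (rule seq.P.borel_measurable_lebesgue_integral) (simp add: split_beta')

lemma ocdf_eq: "ocdf c x = measure \<Omega> {\<omega> \<in> space \<Omega>. (\<exists>t. c \<le> S t \<omega>) \<and> S (first_up S c \<omega>) \<omega> - c \<le> x}"
proof -
  have "ocdf c x = (\<integral>\<omega>. indicator {\<omega> \<in> space \<Omega>. crosses c x \<omega>} \<omega> \<partial>\<Omega>)"
    unfolding ocdf_def by (intro Bochner_Integration.integral_cong) (auto simp: indicator_def)
  also have "\<dots> = measure \<Omega> ({\<omega> \<in> space \<Omega>. crosses c x \<omega>} \<inter> space \<Omega>)" by simp
  also have "{\<omega> \<in> space \<Omega>. crosses c x \<omega>} \<inter> space \<Omega> = {\<omega> \<in> space \<Omega>. crosses c x \<omega>}" by auto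
  finally show ?thesis by (simp only: crosses_iff)
qed

lemma int_bool: "Measurable.pred \<Omega> Q \<Longrightarrow> integrable \<Omega> (\<lambda>\<omega>. of_bool (Q \<omega>) :: real)"
  by (rule seq.P.integrable_const_bound[where B=1]) auto

lemma ocdf_01: "0 \<le> ocdf c x" "ocdf c x \<le> 1"
  unfolding ocdf_eq by simp_all

lemma crosses_mono: "crosses c x \<omega> \<Longrightarrow> x \<le> y \<Longrightarrow> crosses c y \<omega>"
  unfolding crosses_def by force

text \<open>Level \<open>c\<close> is passed no later than \<open>c + d\<close>. If both are passed
  at once, the overshoot grows by \<open>d\<close>. If \<open>c\<close> is passed earlier, the walk
  is still below \<open>c + d\<close> there, so its overshoot is less than \<open>d\<close>; and
  \<open>x \<ge> 0\<close> because \<open>c + d\<close> was reached.\<close>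

lemma crosses_lower:
  assumes "0 \<le> d" "crosses (c + d) x \<omega>"
  shows "crosses c (x + d) \<omega>"
proof -
  obtain t where t: "c + d \<le> S t \<omega>" "\<forall>s<t. S s \<omega> < c + d" "S t \<omega> - (c + d) \<le> x"
    using assms(2) by (auto simp: crosses_def)
  have ex: "\<exists>t. c \<le> S t \<omega>" using t(1) assms(1) by (intro exI[of _ t]) simp
  note fu = first_up[OF ex]
  have "\<not> t < first_up S c \<omega>" using fu(2) t(1) assms(1) by force
  then consider "first_up S c \<omega> = t" | "first_up S c \<omega> < t" by linarith
  then have "S (first_up S c \<omega>) \<omega> - c \<le> x + d"
  proof cases
    case 2
    then have "S (first_up S c \<omega>) \<omega> < c + d" using t(2) by blast
    then show ?thesis using t by linarith
  qed (use t in simp)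
  then show ?thesis using ex by (simp add: crosses_iff)
qed

lemma ocdf_mono: "x \<le> y \<Longrightarrow> ocdf c x \<le> ocdf c y"
  unfolding ocdf_def by (intro integral_mono int_bool) (auto intro: crosses_mono)

lemma ocdf_lower: "0 \<le> d \<Longrightarrow> ocdf (c + d) x \<le> ocdf c (x + d)"
  unfolding ocdf_def by (intro integral_mono int_bool) (auto dest: crosses_lower)

text \<open>Positivity of \<open>c\<close> excludes passage at time 0; after one step the level is
  lowered by that step and all times by one.\<close>

lemma crosses_first_step:
  assumes "0 < c"
  shows "crosses c x (case_nat y \<omega>) \<longleftrightarrow> crosses (c - \<phi> y) x \<omega>"
proof
  assume "crosses c x (case_nat y \<omega>)"
  then obtain t where t: "c \<le> S t (case_nat y \<omega>)" "\<forall>s<t. S s (case_nat y \<omega>) < c" "S t (case_nat y \<omega>) - c \<le> x"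
    by (auto simp: crosses_def)
  then obtain k where k: "t = Suc k" using assms by (cases t) auto
  have "\<forall>s<k. S s \<omega> < c - \<phi> y" using t(2) k S_Suc_cons[of _ y \<omega>] by (auto simp: less_diff_eq add.commute)
  then show "crosses (c - \<phi> y) x \<omega>"
    unfolding crosses_def using t k by (intro exI[of _ k]) (auto simp: S_Suc_cons)
next
  assume "crosses (c - \<phi> y) x \<omega>"
  then obtain k where k: "c - \<phi> y \<le> S k \<omega>" "\<forall>s<k. S s \<omega> < c - \<phi> y" "S k \<omega> - (c - \<phi> y) \<le> x"
    by (auto simp: crosses_def)
  have "\<forall>s<Suc k. S s (case_nat y \<omega>) < c"
  proof safe
    fix s assume "s < Suc k"
    then show "S s (case_nat y \<omega>) < c" using assms k(2) by (cases s) (auto simp: S_Suc_cons less_diff_eq add.commute)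
  qed
  then show "crosses c x (case_nat y \<omega>)"
    unfolding crosses_def using k by (intro exI[of _ "Suc k"]) (auto simp: S_Suc_cons)
qed

lemma ocdf_harmonic: "0 < c \<Longrightarrow> ocdf c x = (\<integral>y. ocdf (c - y) x \<partial>F)"
proof -
  assume c: "0 < c"
  have "ocdf c x = (\<integral>y. (\<integral>\<omega>. of_bool (crosses c x (case_nat y \<omega>)) \<partial>\<Omega>) \<partial>D)"
    unfolding ocdf_def by (rule integral_first_step[OF int_bool]) simp
  also have "\<dots> = (\<integral>y. ocdf (c - \<phi> y) x \<partial>D)"
    by (simp add: crosses_first_step[OF c] ocdf_def)
  also have "\<dots> = (\<integral>y. ocdf (c - y) x \<partial>F)"
    unfolding F_def by (subst integral_distr) auto
  finally show ?thesis .
qed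

text \<open>Averaging over a window of levels makes the overshoot probabilities Lipschitz in the level.\<close>

definition avg :: "real \<Rightarrow> real \<Rightarrow> real \<Rightarrow> real" where
  "avg h x c = (\<integral>s. ocdf (c + s) x * indicator {0..<h} s \<partial>lborel) / h"

lemma int_window:
  assumes [measurable]: "g \<in> borel_measurable borel" and "\<And>s. \<bar>g s\<bar> \<le> (1::real)"
  shows "integrable lborel (\<lambda>s. g s * indicator {a..<b::real} s)"
proof (rule Bochner_Integration.integrable_bound[of _ "indicat_real {a..<b}"])
  show "integrable lborel (indicat_real {a..<b})"
    by (cases "a \<le> b") (auto simp: integrable_indicator_iff)
qed (use assms(2) in \<open>auto simp: indicator_def\<close>)

lemma int_ocdf_window: "integrable lborel (\<lambda>s. ocdf (c + s) x * indicator {a..<b} s)"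
  by (rule int_window) (use ocdf_01 in \<open>auto simp: abs_le_iff intro: order_trans[of _ 0]\<close>)

lemma avg_bounds:
  assumes "0 < h" "\<And>s. 0 \<le> s \<Longrightarrow> s < h \<Longrightarrow> a \<le> ocdf (c + s) x \<and> ocdf (c + s) x \<le> b"
  shows "a \<le> avg h x c" "avg h x c \<le> b"
proof -
  have i: "integrable lborel (\<lambda>s. k * indicat_real {0..<h} s)" for k
    using assms(1) by (intro integrable_mult_right) (simp add: integrable_indicator_iff)
  have v: "(\<integral>s. k * indicat_real {0..<h} s \<partial>lborel) = k * h" for k using assms(1) by simp
  have "a * h \<le> (\<integral>s. ocdf (c + s) x * indicator {0..<h} s \<partial>lborel)"
    unfolding v[symmetric] using assms(2) by (intro integral_mono i int_ocdf_window) (auto simp: indicator_def)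
  then show "a \<le> avg h x c" using assms(1) by (simp add: avg_def pos_le_divide_eq)
  have "(\<integral>s. ocdf (c + s) x * indicator {0..<h} s \<partial>lborel) \<le> b * h"
    unfolding v[symmetric] using assms(2) by (intro integral_mono i int_ocdf_window) (auto simp: indicator_def)
  then show "avg h x c \<le> b" using assms(1) by (simp add: avg_def pos_divide_le_eq)
qed

lemma window_shift: "(\<integral>s. ocdf (c + d + s) x * indicator {a..<b} s \<partial>lborel) = (\<integral>s. ocdf (c + s) x * indicator {a + d..<b + d} s \<partial>lborel)"
proof -
  have "(\<integral>s. ocdf (c + s) x * indicator {a + d..<b + d} s \<partial>lborel)
    = (\<integral>s. ocdf (c + (d + 1 * s)) x * indicator {a + d..<b + d} (d + 1 * s) \<partial>lborel)"
    by (subst lborel_integral_real_affine[where c=1 and t=d]) auto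
  also have "\<dots> = (\<integral>s. ocdf (c + d + s) x * indicator {a..<b} s \<partial>lborel)"
    by (intro Bochner_Integration.integral_cong) (auto simp: indicator_def algebra_simps)
  finally show ?thesis ..
qed

lemma avg_double:
  assumes h: "0 < h" shows "avg (2 * h) x c = (avg h x c + avg h x (c + h)) / 2"
proof -
  have "(\<integral>s. ocdf (c + s) x * indicator {0..<2*h} s \<partial>lborel)
     = (\<integral>s. ocdf (c + s) x * indicator {0..<h} s + ocdf (c + s) x * indicator {h..<2*h} s \<partial>lborel)"
    using h by (intro Bochner_Integration.integral_cong) (auto simp: indicator_def)
  also have "\<dots> = (\<integral>s. ocdf (c + s) x * indicator {0..<h} s \<partial>lborel) + (\<integral>s. ocdf (c + s) x * indicator {h..<2*h} s \<partial>lborel)"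
    by (rule Bochner_Integration.integral_add[OF int_ocdf_window int_ocdf_window])
  also have "(\<integral>s. ocdf (c + s) x * indicator {h..<2*h} s \<partial>lborel) = (\<integral>s. ocdf (c + h + s) x * indicator {0..<h} s \<partial>lborel)"
    using window_shift[of c h x 0 h] by simp
  finally show ?thesis using h by (simp add: avg_def field_simps)
qed

text \<open>Moving the window by \<open>d\<close> affects the integral only through two end pieces
  of length \<open>d\<close>, and the integrand lies between 0 and 1; dividing by \<open>h\<close>
  gives \<open>2 / h\<close>.\<close>

lemma avg_lipschitz:
  assumes h: "0 < h" shows "\<bar>avg h x c - avg h x c'\<bar> \<le> (2 / h) * \<bar>c - c'\<bar>"
proof -
  have *: "\<bar>avg h x c - avg h x (c + d)\<bar> \<le> (2 / h) * d" if d: "0 \<le> d" for c d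
  proof -
    have "\<bar>(\<integral>s. ocdf (c + s) x * indicator {0..<h} s \<partial>lborel) - (\<integral>s. ocdf (c + d + s) x * indicator {0..<h} s \<partial>lborel)\<bar>
      = \<bar>\<integral>s. ocdf (c + s) x * indicator {0..<h} s - ocdf (c + s) x * indicator {0 + d..<h + d} s \<partial>lborel\<bar>"
      unfolding window_shift by (subst Bochner_Integration.integral_diff[OF int_ocdf_window int_ocdf_window]) simp
    also have "\<dots> \<le> (\<integral>s. \<bar>ocdf (c + s) x * indicator {0..<h} s - ocdf (c + s) x * indicator {0 + d..<h + d} s\<bar> \<partial>lborel)"
      by (rule integral_abs_bound)
    also have "\<dots> \<le> (\<integral>s. indicat_real {0..<d} s + indicat_real {h..<h + d} s \<partial>lborel)"
    proof (intro integral_mono integrable_abs Bochner_Integration.integrable_diff int_ocdf_window Bochner_Integration.integrable_add)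
      show "integrable lborel (indicat_real {0..<d})" "integrable lborel (indicat_real {h..<h + d})"
        using d by (simp_all add: integrable_indicator_iff)
      show "\<bar>ocdf (c + s) x * indicator {0..<h} s - ocdf (c + s) x * indicator {0 + d..<h + d} s\<bar>
         \<le> indicat_real {0..<d} s + indicat_real {h..<h + d} s" for s
        using ocdf_01[of "c + s" x] d by (auto simp: indicator_def)
    qed
    also have "\<dots> = 2 * d"
      using d by (subst Bochner_Integration.integral_add) (simp_all add: integrable_indicator_iff)
    finally show ?thesis
      using h by (simp add: avg_def diff_divide_distrib[symmetric] abs_divide divide_right_mono)
  qed
  show ?thesis
  proof (cases "c \<le> c'")
    case True
    then show ?thesis using *[of "c' - c" c] by simp
  next
    case False
    then show ?thesis using *[of "c - c'" c'] by (simp add: abs_minus_commute)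
  qed
qed

text \<open>The window extends upwards from \<open>c\<close>, so for \<open>c > 0\<close> all its
  levels are positive and the first-step equation can be integrated over it.\<close>

lemma avg_harm:
  assumes h: "0 < h" shows "FF.harm (2 / h) (avg h x)"
  unfolding FF.harm_def
proof (intro conjI allI impI)
  fix c c'
  show "0 \<le> avg h x c" "avg h x c \<le> 1"
    using avg_bounds[OF h, of 0 c x 1] ocdf_01 by auto
  show "\<bar>avg h x c - avg h x c'\<bar> \<le> 2 / h * \<bar>c - c'\<bar>" by (rule avg_lipschitz[OF h])
next
  fix c :: real assume c: "0 < c"
  interpret LF: pair_sigma_finite lborel F ..
  have "(\<integral>s. ocdf (c + s) x * indicator {0..<h} s \<partial>lborel) = (\<integral>s. (\<integral>y. ocdf (c - y + s) x * indicator {0..<h} s \<partial>F) \<partial>lborel)"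
  proof (intro Bochner_Integration.integral_cong refl)
    fix s :: real
    show "ocdf (c + s) x * indicator {0..<h} s = (\<integral>y. ocdf (c - y + s) x * indicator {0..<h} s \<partial>F)"
      using ocdf_harmonic[of "c + s" x] c by (auto simp: indicator_def algebra_simps)
  qed
  also have "\<dots> = (\<integral>y. (\<integral>s. ocdf (c - y + s) x * indicator {0..<h} s \<partial>lborel) \<partial>F)"
  proof (rule LF.Fubini_integral[symmetric], rule Bochner_Integration.integrable_bound)
    show "integrable (lborel \<Otimes>\<^sub>M F) (indicat_real ({0..<h} \<times> UNIV))"
      using h by (subst integrable_indicator_iff) (auto simp: FF.emeasure_pair_measure_Times FF.emeasure_eq_measure)
  qed (use ocdf_01 in \<open>auto simp: indicator_def F_def\<close>)
  finally show "avg h x c = (\<integral>y. avg h x (c - y) \<partial>F)" by (simp add: avg_def)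
qed

section \<open>The limiting overshoot distribution function\<close>

definition limit_ocdf :: "real \<Rightarrow> real" where
  "limit_ocdf x = FF.hlim (avg 1 x)"

text \<open>Since a window of length \<open>2 h\<close> is the union of two windows of length \<open>h\<close>, the limit is the same
  for all dyadic window lengths.\<close>

lemma avg_tendsto: "((avg ((1/2)^n) x) \<longlongrightarrow> limit_ocdf x) at_top"
proof (induction n)
  case 0
  show ?case using FF.harm_tendsto[OF avg_harm[of 1 x]] by (simp add: limit_ocdf_def)
next
  case (Suc n)
  define h :: real where "h = (1/2)^(Suc n)"
  have h: "0 < h" by (simp add: h_def)
  have lim: "((avg h x) \<longlongrightarrow> FF.hlim (avg h x)) at_top"
    by (rule FF.harm_tendsto[OF avg_harm[OF h]])
  have "filterlim (\<lambda>c. c + h) at_top (at_top :: real filter)" using filterlim_shift_at_top[of "- h"] by simp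
  from filterlim_compose[OF lim this]
  have "((\<lambda>c. (avg h x c + avg h x (c + h)) / 2) \<longlongrightarrow> (FF.hlim (avg h x) + FF.hlim (avg h x)) / 2) at_top"
    by (intro tendsto_intros lim) auto
  moreover have "(\<lambda>c. (avg h x c + avg h x (c + h)) / 2) = avg ((1/2)^n) x"
    using avg_double[OF h, of x] by (simp add: h_def fun_eq_iff)
  ultimately have "FF.hlim (avg h x) = limit_ocdf x"
    using tendsto_unique[OF _ Suc] by auto
  then show ?case using lim by (simp add: h_def)
qed

text \<open>Only countably many levels \<open>r\<close> have \<open>P (S\<^sub>t = r + x) > 0\<close>, so after averaging the limit is continuous in \<open>x\<close>.\<close>

lemma good_levels:
  "AE r in lborel. \<forall>t. measure \<Omega> {\<omega> \<in> space \<Omega>. S t \<omega> = r + x} = 0"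
proof -
  have "countable {r. measure \<Omega> {\<omega> \<in> space \<Omega>. S t \<omega> = r + x} \<noteq> 0}" for t
  proof -
    interpret St: finite_measure "distr \<Omega> borel (\<lambda>\<omega>. S t \<omega> - x)"
      by (rule seq.P.finite_measure_distr) simp
    have "measure (distr \<Omega> borel (\<lambda>\<omega>. S t \<omega> - x)) {r} = measure \<Omega> {\<omega> \<in> space \<Omega>. S t \<omega> = r + x}" for r
      by (subst measure_distr) (auto intro!: arg_cong[where f="measure \<Omega>"])
    then show ?thesis using St.countable_support by simp
  qed
  then have "{r. measure \<Omega> {\<omega> \<in> space \<Omega>. S t \<omega> = r + x} \<noteq> 0} \<in> null_sets lborel" for t
    by (rule countable_imp_null_set_lborel)
  then have "AE r in lborel. r \<notin> {r. measure \<Omega> {\<omega> \<in> space \<Omega>. S t \<omega> = r + x} \<noteq> 0}" for t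
    by (rule AE_not_in)
  then show ?thesis by (simp add: AE_all_countable)
qed

lemma good_AE:
  assumes "\<forall>t. measure \<Omega> {\<omega> \<in> space \<Omega>. S t \<omega> = r + x} = 0"
  shows "AE \<omega> in \<Omega>. \<forall>t. S t \<omega> \<noteq> r + x"
proof -
  have "AE \<omega> in \<Omega>. \<not> S t \<omega> = r + x" for t
  proof -
    have "AE \<omega> in \<Omega>. \<omega> \<notin> {\<omega> \<in> space \<Omega>. S t \<omega> = r + x}"
      using assms by (subst seq.P.prob_eq_0[symmetric]) auto
    then show ?thesis using AE_space by eventually_elim simp
  qed
  then show ?thesis by (simp add: AE_all_countable)
qed

text \<open>Off the exceptional null set the overshoot differs from \<open>x\<close>, so its
  comparison with \<open>X n\<close> eventually agrees with its comparison with \<open>x\<close>;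
  dominated convergence does the rest.\<close>

lemma ocdf_continuous:
  assumes good: "AE \<omega> in \<Omega>. \<forall>t. S t \<omega> \<noteq> r + x" and X: "X \<longlonglongrightarrow> x"
  shows "(\<lambda>n. ocdf r (X n)) \<longlonglongrightarrow> ocdf r x"
  unfolding ocdf_def
proof (rule integral_dominated_convergence[where w="\<lambda>_. 1"])
  show "AE \<omega> in \<Omega>. (\<lambda>n. of_bool (crosses r (X n) \<omega>) :: real) \<longlonglongrightarrow> of_bool (crosses r x \<omega>)"
    using good
  proof eventually_elim
    case (elim \<omega>)
    define s where "s = S (first_up S r \<omega>) \<omega> - r"
    have "s \<noteq> x" using elim by (auto simp: s_def algebra_simps)
    then consider "s < x" | "x < s" by linarith
    then have "\<forall>\<^sub>F n in sequentially. (s \<le> X n) = (s \<le> x)"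
    proof cases
      case 1
      have "\<forall>\<^sub>F n in sequentially. s < X n" by (rule order_tendstoD(1)[OF X 1])
      then show ?thesis by eventually_elim (use 1 in auto)
    next
      case 2
      have "\<forall>\<^sub>F n in sequentially. X n < s" by (rule order_tendstoD(2)[OF X 2])
      then show ?thesis by eventually_elim (use 2 in auto)
    qed
    then show ?case
      unfolding crosses_iff s_def[symmetric]
      by (intro tendsto_eventually) (auto elim: eventually_mono)
  qed
qed auto

text \<open>An overshoot of at most 0 means that \<open>r\<close> is hit exactly. The shape
  \<open>r + 0\<close> is the one delivered by \<open>good_AE\<close>.\<close>

lemma ocdf_zero:
  assumes good: "AE \<omega> in \<Omega>. \<forall>t. S t \<omega> \<noteq> r + 0"
  shows "ocdf r 0 = 0"
proof -
  have "AE \<omega> in \<Omega>. (of_bool (crosses r 0 \<omega>) :: real) = 0"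
    using good by eventually_elim (auto simp: crosses_def antisym)
  then show ?thesis unfolding ocdf_def by (simp add: integral_eq_zero_AE)
qed

lemma ocdf_infinity:
  assumes X: "filterlim X at_top sequentially"
  shows "(\<lambda>n. ocdf r (X n)) \<longlonglongrightarrow> 1"
proof -
  have "(\<lambda>n. ocdf r (X n)) \<longlonglongrightarrow> (\<integral>\<omega>. 1 \<partial>\<Omega>)"
    unfolding ocdf_def
  proof (rule integral_dominated_convergence[where w="\<lambda>_. 1"])
    show "AE \<omega> in \<Omega>. (\<lambda>n. of_bool (crosses r (X n) \<omega>) :: real) \<longlonglongrightarrow> 1"
      using S_at_top
    proof eventually_elim
      case (elim \<omega>)
      then have "\<forall>\<^sub>F t in sequentially. r \<le> S t \<omega>" by (simp add: filterlim_at_top)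
      then have ex: "\<exists>t. r \<le> S t \<omega>" by (auto simp: eventually_sequentially)
      have "\<forall>\<^sub>F n in sequentially. S (first_up S r \<omega>) \<omega> - r \<le> X n"
        using X by (simp add: filterlim_at_top)
      then show ?case using ex
        by (intro tendsto_eventually) (auto elim: eventually_mono simp: crosses_iff)
    qed
  qed auto
  then show ?thesis by (simp add: seq.P.prob_space)
qed

text \<open>Convergence at almost every level is enough, because averaging ignores null sets of
  levels; this is how the exceptional levels are absorbed.\<close>

lemma avg_converge:
  assumes "AE r in lborel. (\<lambda>n. ocdf r (X n)) \<longlonglongrightarrow> g r" and [measurable]: "g \<in> borel_measurable borel"
  shows "(\<lambda>n. avg 1 (X n) c) \<longlonglongrightarrow> (\<integral>s. g (c + s) * indicator {0..<1} s \<partial>lborel)"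
  unfolding avg_def div_by_1
proof (rule integral_dominated_convergence[where w="indicat_real {0..<1}"])
  have "AE r in distr lborel borel ((+) c). (\<lambda>n. ocdf r (X n)) \<longlonglongrightarrow> g r"
    using assms(1) by (simp only: lborel_distr_plus)
  then have "AE s in lborel. (\<lambda>n. ocdf (c + s) (X n)) \<longlonglongrightarrow> g (c + s)"
    by (rule AE_distrD[rotated]) simp
  then show "AE s in lborel. (\<lambda>n. ocdf (c + s) (X n) * indicator {0..<1} s) \<longlonglongrightarrow> g (c + s) * indicator {0..<1} s"
    by eventually_elim (intro tendsto_intros)
  show "AE s in lborel. norm (ocdf (c + s) (X n) * indicator {0..<1} s) \<le> indicat_real {0..<1} s" for n
    using ocdf_01 by (auto simp: indicator_def)
qed (auto simp: integrable_indicator_iff)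

lemma limit_ocdf_continuous: "isCont limit_ocdf x"
proof (rule continuous_at_sequentiallyI)
  fix X assume X: "X \<longlonglongrightarrow> x"
  have "(\<lambda>n. FF.hlim (avg 1 (X n))) \<longlonglongrightarrow> FF.hlim (avg 1 x)"
  proof (rule FF.harm_stable)
    show "FF.harm (2 / 1) (avg 1 (X n))" "FF.harm (2 / 1) (avg 1 x)" for n by (rule avg_harm, simp)+
    fix c
    have "(\<lambda>n. avg 1 (X n) c) \<longlonglongrightarrow> (\<integral>s. ocdf (c + s) x * indicator {0..<1} s \<partial>lborel)"
    proof (rule avg_converge)
      show "AE r in lborel. (\<lambda>n. ocdf r (X n)) \<longlonglongrightarrow> ocdf r x"
        using good_levels[of x] by eventually_elim (intro ocdf_continuous good_AE X)
    qed simp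
    then show "(\<lambda>n. avg 1 (X n) c) \<longlonglongrightarrow> avg 1 x c" by (simp add: avg_def)
  qed
  then show "(\<lambda>n. limit_ocdf (X n)) \<longlonglongrightarrow> limit_ocdf x" by (simp add: limit_ocdf_def)
qed

lemma avg_1_tendsto: "(avg 1 x \<longlongrightarrow> limit_ocdf x) at_top"
  using avg_tendsto[of 0 x] by simp

lemma limit_ocdf_unique: "(avg 1 x \<longlongrightarrow> l) at_top \<Longrightarrow> limit_ocdf x = l"
  by (rule tendsto_unique[OF _ avg_1_tendsto]) simp

lemma limit_ocdf_mono: "x \<le> y \<Longrightarrow> limit_ocdf x \<le> limit_ocdf y"
proof (rule tendsto_le[OF _ avg_1_tendsto avg_1_tendsto])
  assume "x \<le> y"
  then show "\<forall>\<^sub>F c in at_top. avg 1 x c \<le> avg 1 y c"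
    unfolding avg_def
    by (intro always_eventually allI divide_right_mono integral_mono int_ocdf_window mult_right_mono ocdf_mono) auto
qed simp

text \<open>At almost every level an exact hit has probability 0. The value at 0, combined with
  continuity, later makes small overshoots improbable.\<close>

lemma limit_ocdf_nonpos:
  assumes "x \<le> 0" shows "limit_ocdf x = 0"
proof -
  have "limit_ocdf 0 = 0"
  proof (rule limit_ocdf_unique)
    have "avg 1 0 c = 0" for c
    proof -
      have "(\<lambda>n::nat. avg 1 0 c) \<longlonglongrightarrow> (\<integral>s. 0 * indicator {0..<1::real} s \<partial>lborel)"
      proof (rule avg_converge[where X="\<lambda>_. 0" and g="\<lambda>_. 0"])
        show "AE r in lborel. (\<lambda>n::nat. ocdf r 0) \<longlonglongrightarrow> 0"
          using good_levels[of 0]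
        proof eventually_elim
          case (elim r)
          show ?case unfolding ocdf_zero[OF good_AE[OF elim]] by simp
        qed
      qed simp
      then show ?thesis by (simp add: LIMSEQ_const_iff)
    qed
    then have "avg 1 0 = (\<lambda>_. 0)" by (simp add: fun_eq_iff)
    then show "(avg 1 0 \<longlongrightarrow> 0) at_top" by simp
  qed
  moreover have "0 \<le> limit_ocdf x"
    by (rule tendsto_lowerbound[OF avg_1_tendsto]) (use avg_bounds[of 1 0 _ x 1] ocdf_01 in auto)
  ultimately show ?thesis using limit_ocdf_mono[OF assms] by simp
qed

text \<open>No mass escapes: at each level the averaged probabilities tend to the constant 1, a
  harmonic function whose \<open>hlim\<close> is 1.\<close>

lemma limit_ocdf_at_top: "(limit_ocdf \<longlongrightarrow> 1) at_top"
proof (rule tendsto_at_topI_sequentially)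
  fix X :: "nat \<Rightarrow> real" assume X: "filterlim X at_top sequentially"
  have h1: "FF.harm (2 / 1) (\<lambda>_. 1)" by (simp add: FF.harm_def)
  have "(\<lambda>n. FF.hlim (avg 1 (X n))) \<longlonglongrightarrow> FF.hlim (\<lambda>_. 1)"
  proof (rule FF.harm_stable)
    show "FF.harm (2 / 1) (avg 1 (X n))" for n by (rule avg_harm) simp
    show "FF.harm (2 / 1) (\<lambda>_. 1)" by (rule h1)
    fix c
    have "(\<lambda>n. avg 1 (X n) c) \<longlonglongrightarrow> (\<integral>s. 1 * indicator {0..<1::real} s \<partial>lborel)"
      by (rule avg_converge[where g="\<lambda>_. 1"]) (use ocdf_infinity[OF X] in auto)
    then show "(\<lambda>n. avg 1 (X n) c) \<longlonglongrightarrow> 1" by simp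
  qed
  moreover have "FF.hlim (\<lambda>_. 1) = 1"
    using tendsto_unique[OF _ FF.harm_tendsto[OF h1] tendsto_const] by simp
  ultimately show "(\<lambda>n. limit_ocdf (X n)) \<longlonglongrightarrow> 1" by (simp add: limit_ocdf_def)
qed

text \<open>With \<open>h = (1/2)^n\<close>, \<open>crosses_lower\<close> yields
  \<open>avg h (x - h) c \<le> ocdf c x \<le> avg h (x + h) (c - h)\<close>. The bounds converge to
  \<open>limit_ocdf (x - h)\<close> and \<open>limit_ocdf (x + h)\<close>, and continuity closes the
  gap as \<open>h\<close> shrinks.\<close>

theorem ocdf_tendsto: "((\<lambda>c. ocdf c x) \<longlongrightarrow> limit_ocdf x) at_top"
proof (rule order_tendstoI)
  have hlim: "(\<lambda>n. (1/2)^n :: real) \<longlonglongrightarrow> 0" by (rule LIMSEQ_realpow_zero) auto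
  fix a assume a: "a < limit_ocdf x"
  have "(\<lambda>n. limit_ocdf (x - (1/2)^n)) \<longlonglongrightarrow> limit_ocdf (x - 0)"
    by (intro isCont_tendsto_compose[OF limit_ocdf_continuous] tendsto_intros hlim)
  then have "\<forall>\<^sub>F n in sequentially. a < limit_ocdf (x - (1/2)^n)"
    by (rule order_tendstoD) (use a in simp)
  then obtain n where n: "a < limit_ocdf (x - (1/2)^n)" by (auto simp: eventually_sequentially)
  have "\<forall>\<^sub>F c in at_top. a < avg ((1/2)^n) (x - (1/2)^n) c"
    by (rule order_tendstoD(1)[OF avg_tendsto n])
  then show "\<forall>\<^sub>F c in at_top. a < ocdf c x"
  proof eventually_elim
    case (elim c)
    have "avg ((1/2)^n) (x - (1/2)^n) c \<le> ocdf c x"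
    proof (rule avg_bounds)
      fix s :: real assume s: "0 \<le> s" "s < (1/2)^n"
      have "ocdf (c + s) (x - (1/2)^n) \<le> ocdf c (x - (1/2)^n + s)" by (rule ocdf_lower[OF s(1)])
      also have "\<dots> \<le> ocdf c x" by (rule ocdf_mono) (use s in simp)
      finally show "0 \<le> ocdf (c + s) (x - (1/2)^n) \<and> ocdf (c + s) (x - (1/2)^n) \<le> ocdf c x" using ocdf_01 by auto
    qed simp
    then show ?case using elim by simp
  qed
next
  have hlim: "(\<lambda>n. (1/2)^n :: real) \<longlonglongrightarrow> 0" by (rule LIMSEQ_realpow_zero) auto
  fix a assume a: "limit_ocdf x < a"
  have "(\<lambda>n. limit_ocdf (x + (1/2)^n)) \<longlonglongrightarrow> limit_ocdf (x + 0)"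
    by (intro isCont_tendsto_compose[OF limit_ocdf_continuous] tendsto_intros hlim)
  then have "\<forall>\<^sub>F n in sequentially. limit_ocdf (x + (1/2)^n) < a"
    by (rule order_tendstoD) (use a in simp)
  then obtain n where n: "limit_ocdf (x + (1/2)^n) < a" by (auto simp: eventually_sequentially)
  have "\<forall>\<^sub>F c in at_top. avg ((1/2)^n) (x + (1/2)^n) (c - (1/2)^n) < a"
    by (rule order_tendstoD(2)[OF filterlim_compose[OF avg_tendsto filterlim_shift_at_top] n])
  then show "\<forall>\<^sub>F c in at_top. ocdf c x < a"
  proof eventually_elim
    case (elim c)
    have "ocdf c x \<le> avg ((1/2)^n) (x + (1/2)^n) (c - (1/2)^n)"
    proof (rule avg_bounds(1)[where b=1])
      fix s :: real assume s: "0 \<le> s" "s < (1/2)^n"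
      have "ocdf c x \<le> ocdf (c - (1/2)^n + s) (x + ((1/2)^n - s))"
        using ocdf_lower[of "(1/2)^n - s" "c - (1/2)^n + s" x] s by simp
      also have "\<dots> \<le> ocdf (c - (1/2)^n + s) (x + (1/2)^n)" by (rule ocdf_mono) (use s in simp)
      finally show "ocdf c x \<le> ocdf (c - (1/2)^n + s) (x + (1/2)^n) \<and> ocdf (c - (1/2)^n + s) (x + (1/2)^n) \<le> 1" using ocdf_01 by auto
    qed simp
    then show ?case using elim by simp
  qed
qed

end

subsection \<open>First passage of a perturbed random walk\<close>

text \<open>The exponential of minus the overshoot of \<open>Y\<close> over \<open>c\<close>, set to 0 if there is no passage. As in
  the tests, time 0 does not count.\<close>

definition passage :: "(nat \<Rightarrow> 'w \<Rightarrow> real) \<Rightarrow> real \<Rightarrow> 'w \<Rightarrow> real" where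
  "passage Y c \<omega> = (if \<exists>t\<ge>1. c \<le> Y t \<omega> then exp (c - Y (LEAST t. 1 \<le> t \<and> c \<le> Y t \<omega>) \<omega>) else 0)"

lemma measurable_passage [measurable]:
  assumes [measurable]: "\<And>t. Y t \<in> borel_measurable M"
  shows "passage Y c \<in> borel_measurable M"
proof -
  have [measurable]: "(\<lambda>\<omega>. Y (LEAST t. 1 \<le> t \<and> c \<le> Y t \<omega>) \<omega>) \<in> borel_measurable M"
    by (rule measurable_compose_countable[of _ M]) measurable
  show ?thesis unfolding passage_def by measurable
qed

lemma passage_01: "0 \<le> passage Y c \<omega>" "passage Y c \<omega> \<le> 1"
proof -
  show "0 \<le> passage Y c \<omega>" by (simp add: passage_def)
  show "passage Y c \<omega> \<le> 1"
  proof (cases "\<exists>t\<ge>1. c \<le> Y t \<omega>")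
    case True
    then have "\<exists>t. 1 \<le> t \<and> c \<le> Y t \<omega>" by blast
    from LeastI_ex[OF this] show ?thesis using True by (simp add: passage_def)
  next
    case False
    then have "passage Y c \<omega> = 0" unfolding passage_def by (simp only: if_False)
    then show ?thesis by simp
  qed
qed

lemma abs_exp_diff_le:
  fixes a b :: real
  assumes "a \<le> 0" "b \<le> 0"
  shows "\<bar>exp a - exp b\<bar> \<le> \<bar>a - b\<bar>"
proof -
  have *: "exp b - exp a \<le> b - a" if "a \<le> b" "b \<le> 0" for a b :: real
  proof -
    have "exp b - exp a = exp b * (1 - exp (a - b))" by (simp add: algebra_simps flip: exp_add)
    also have "\<dots> \<le> 1 * (1 - exp (a - b))" using that by (intro mult_right_mono) auto
    also have "\<dots> \<le> b - a"
    proof -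
      define z where "z = exp (a - b)"
      have "1 + (a - b) \<le> z" unfolding z_def by (rule exp_ge_add_one_self)
      then show ?thesis unfolding z_def[symmetric] by simp
    qed
    finally show ?thesis .
  qed
  show ?thesis using *[of a b] *[of b a] assms by (cases "a \<le> b") auto
qed

context random_walk
begin

text \<open>Here the \<open>Lim\<close> of the definition is certified to be an actual
  limit.\<close>

lemma overshoot_up_cdf_eq: "overshoot_up_cdf \<Omega> S x = limit_ocdf x"
  unfolding overshoot_up_cdf_def ocdf_eq[symmetric] by (rule tendsto_Lim[OF _ ocdf_tendsto]) simp

text \<open>The exclusion of time 0 in \<open>passage\<close> makes no difference for
  \<open>c > 0\<close>, as the walk starts at 0.\<close>

lemma passage_S:
  assumes "0 < c" "\<exists>t. c \<le> S t \<omega>"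
  shows "passage S c \<omega> = exp (c - S (first_up S c \<omega>) \<omega>)"
proof -
  have nz: "t \<noteq> 0" if "c \<le> S t \<omega>" for t using that assms(1) by (cases t) auto
  have "(\<lambda>t. 1 \<le> t \<and> c \<le> S t \<omega>) = (\<lambda>t. c \<le> S t \<omega>)" using nz by (auto simp: fun_eq_iff Suc_le_eq)
  moreover have "\<exists>t\<ge>1. c \<le> S t \<omega>" using assms(2) nz by (metis less_one not_le)
  ultimately show ?thesis by (simp add: passage_def first_up_def)
qed

lemma AE_crosses: "AE \<omega> in \<Omega>. \<forall>c. \<exists>t. c \<le> S t \<omega>"
  using S_at_top
proof eventually_elim
  case (elim \<omega>)
  show ?case
  proof
    fix c
    have "\<forall>\<^sub>F t in sequentially. c \<le> S t \<omega>" using elim by (simp add: filterlim_at_top)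
    then show "\<exists>t. c \<le> S t \<omega>" by (auto simp: eventually_sequentially)
  qed
qed

text \<open>Convergence of distribution functions to that of a probability measure is weak
  convergence of the overshoot laws, and the exponential is a bounded continuous test function on
  the half-line that carries them.\<close>

lemma passage_S_tendsto: "((\<lambda>c. \<integral>\<omega>. passage S c \<omega> \<partial>\<Omega>) \<longlongrightarrow> laplace_at_one limit_ocdf) at_top"
proof (rule tendsto_at_topI_sequentially)
  fix X :: "nat \<Rightarrow> real" assume X: "filterlim X at_top sequentially"
  \<comment> \<open>The overshoot recovered from \<open>passage\<close>, which makes it measurable
    at once; its value on paths without passage is immaterial, as almost every path passes every
    level.\<close>
  define R where "R c \<omega> = - ln (passage S c \<omega>)" for c \<omega>
  have [measurable]: "R c \<in> borel_measurable \<Omega>" for c unfolding R_def by measurable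
  \<comment> \<open>The truncation keeps the test function bounded on the whole line and changes
    nothing on the nonnegative overshoots.\<close>
  define f where "f x = exp (- max 0 x)" for x :: real
  have [measurable]: "f \<in> borel_measurable borel" unfolding f_def by measurable
  have R: "R c \<omega> = S (first_up S c \<omega>) \<omega> - c" if "0 < c" "\<exists>t. c \<le> S t \<omega>" for c \<omega>
    by (simp add: R_def passage_S[OF that])
  let ?I = "interval_measure limit_ocdf"
  have rc: "continuous (at_right a) limit_ocdf" for a
    by (rule continuous_at_imp_continuous_at_within[OF limit_ocdf_continuous])
  have bot: "(limit_ocdf \<longlongrightarrow> 0) at_bot"
  proof (rule tendsto_eventually)
    show "\<forall>\<^sub>F x in at_bot. limit_ocdf x = 0"
      using eventually_le_at_bot[of 0] by eventually_elim (rule limit_ocdf_nonpos)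
  qed
  interpret I: real_distribution ?I
    by (rule real_distribution_interval_measure[OF limit_ocdf_mono rc bot limit_ocdf_at_top])
  have cdfI: "cdf ?I = limit_ocdf"
    by (rule cdf_interval_measure[OF limit_ocdf_mono rc bot])
  have cdfR: "cdf (distr \<Omega> borel (R c)) x = ocdf c x" if c: "0 < c" for c x
  proof -
    have "cdf (distr \<Omega> borel (R c)) x = measure \<Omega> {\<omega> \<in> space \<Omega>. R c \<omega> \<le> x}"
      unfolding cdf_def by (subst measure_distr) (auto intro!: arg_cong[where f="measure \<Omega>"])
    also have "\<dots> = measure \<Omega> {\<omega> \<in> space \<Omega>. crosses c x \<omega>}"
    proof (rule seq.P.finite_measure_eq_AE)
      show "AE \<omega> in \<Omega>. \<omega> \<in> {\<omega> \<in> space \<Omega>. R c \<omega> \<le> x} \<longleftrightarrow> \<omega> \<in> {\<omega> \<in> space \<Omega>. crosses c x \<omega>}"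
        using AE_crosses by eventually_elim (auto simp: R[OF c] crosses_iff)
    qed auto
    finally show ?thesis by (simp add: ocdf_eq crosses_iff)
  qed
  have wc: "weak_conv_m (\<lambda>n. distr \<Omega> borel (R (X n))) ?I"
    unfolding weak_conv_m_def weak_conv_def cdfI
  proof (intro allI impI)
    fix x
    have "(\<lambda>n. ocdf (X n) x) \<longlonglongrightarrow> limit_ocdf x"
      by (rule filterlim_compose[OF ocdf_tendsto X])
    moreover have "\<forall>\<^sub>F n in sequentially. 0 < X n" using X by (simp add: filterlim_at_top_dense)
    then have "\<forall>\<^sub>F n in sequentially. ocdf (X n) x = cdf (distr \<Omega> borel (R (X n))) x"
      by eventually_elim (simp add: cdfR)
    ultimately show "(\<lambda>n. cdf (distr \<Omega> borel (R (X n))) x) \<longlonglongrightarrow> limit_ocdf x"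
      using tendsto_cong by fast
  qed
  have "(\<lambda>n. integral\<^sup>L (distr \<Omega> borel (R (X n))) f) \<longlonglongrightarrow> integral\<^sup>L ?I f"
  proof (rule weak_conv_imp_integral_bdd_continuous_conv[OF _ _ wc])
    show "real_distribution (distr \<Omega> borel (R (X n)))" for n by (rule seq.P.real_distribution_distr) simp
    show "real_distribution ?I" ..
    show "isCont f x" for x unfolding f_def by (intro continuous_intros)
    show "norm (f x) \<le> 1" for x by (simp add: f_def)
  qed
  moreover have "integral\<^sup>L ?I f = laplace_at_one limit_ocdf"
    unfolding laplace_at_one_def set_lebesgue_integral_def
  proof (rule integral_cong_AE)
    have "measure ?I {..0} = 0" using cdfI limit_ocdf_nonpos[of 0] by (metis cdf_def order_refl)
    then have "{..0} \<in> null_sets ?I" by (simp add: null_sets_def I.emeasure_eq_measure)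
    then have "AE x in ?I. x \<notin> {..0}" by (rule AE_not_in)
    then show "AE x in ?I. f x = indicator {0..} x *\<^sub>R exp (- x)"
      by eventually_elim (auto simp: f_def)
  qed auto
  moreover have "\<forall>\<^sub>F n in sequentially. 0 < X n" using X by (simp add: filterlim_at_top_dense)
  then have "\<forall>\<^sub>F n in sequentially. integral\<^sup>L (distr \<Omega> borel (R (X n))) f = (\<integral>\<omega>. passage S (X n) \<omega> \<partial>\<Omega>)"
  proof eventually_elim
    case (elim n)
    have "integral\<^sup>L (distr \<Omega> borel (R (X n))) f = (\<integral>\<omega>. f (R (X n) \<omega>) \<partial>\<Omega>)"
      by (rule integral_distr) auto
    also have "\<dots> = (\<integral>\<omega>. passage S (X n) \<omega> \<partial>\<Omega>)"
    proof (rule integral_cong_AE)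
      show "AE \<omega> in \<Omega>. f (R (X n) \<omega>) = passage S (X n) \<omega>"
        using AE_crosses
      proof eventually_elim
        case e2: (elim \<omega>)
        have "0 < passage S (X n) \<omega>" using passage_S[OF elim] e2 by simp
        moreover have "0 \<le> R (X n) \<omega>" using first_up(1)[of "X n" \<omega>] e2 R[OF elim] by simp
        ultimately show ?case by (simp add: f_def R_def)
      qed
    qed auto
    finally show ?case .
  qed
  ultimately show "(\<lambda>n. \<integral>\<omega>. passage S (X n) \<omega> \<partial>\<Omega>) \<longlonglongrightarrow> laplace_at_one limit_ocdf"
    using tendsto_cong by force
qed

text \<open>Passage of \<open>Y\<close> over \<open>c\<close> is compared with passage of the walk
  over \<open>c - b\<close>. Outside \<open>J\<close>, \<open>Y\<close> stays below \<open>c\<close>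
  until the walk passes \<open>c - b\<close>; if the overshoot then exceeds \<open>2 * e\<close>,
  \<open>Y\<close> passes at the same time and the exponents differ by at most \<open>2 * e\<close>.
  What remains are small overshoots and the event \<open>J\<close>.\<close>

theorem passage_perturbed_tendsto:
  assumes [measurable]: "\<And>t. Y t \<in> borel_measurable \<Omega>"
    and lim: "AE \<omega> in \<Omega>. (\<lambda>t. Y t \<omega> - S t \<omega>) \<longlonglongrightarrow> \<kappa>"
  shows "((\<lambda>c. \<integral>\<omega>. passage Y c \<omega> \<partial>\<Omega>) \<longlongrightarrow> laplace_at_one limit_ocdf) at_top"
proof (rule tendstoI)
  let ?\<gamma> = "laplace_at_one limit_ocdf"
  fix \<delta> :: real assume \<delta>: "0 < \<delta>"
  \<comment> \<open>As \<open>limit_ocdf\<close> is continuous and vanishes at 0, some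
    \<open>e\<close> makes both the error in the exponent and the limiting probability of an
    overshoot up to \<open>2 * e\<close> small. The other three quarters of \<open>\<delta>\<close>
    pay for the three limits taken at the end.\<close>
  have "((\<lambda>e. 2 * e + limit_ocdf (2 * e)) \<longlongrightarrow> 2 * 0 + limit_ocdf (2 * 0)) (at 0)"
    by (intro tendsto_intros isCont_tendsto_compose[OF limit_ocdf_continuous])
  then have "((\<lambda>e. 2 * e + limit_ocdf (2 * e)) \<longlongrightarrow> 0) (at_right 0)"
    using tendsto_mono[OF at_le[of "{0<..}" UNIV "0::real"]] by (simp add: limit_ocdf_nonpos)
  then have "\<forall>\<^sub>F e in at_right 0. 2 * e + limit_ocdf (2 * e) < \<delta> / 4"
    by (rule order_tendstoD) (use \<delta> in simp)
  moreover have "\<forall>\<^sub>F e in at_right (0::real). 0 < e" by (rule eventually_at_right_less)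
  ultimately have "\<forall>\<^sub>F e in at_right 0. 0 < e \<and> 2 * e + limit_ocdf (2 * e) < \<delta> / 4"
    by (rule eventually_elim2) auto
  then obtain e where e: "0 < e" "2 * e + limit_ocdf (2 * e) < \<delta> / 4"
    using eventually_happens[of _ "at_right (0::real)"] by (auto simp: trivial_limit_at_right_real)
  \<comment> \<open>The extra \<open>e\<close> rules out that a settled \<open>Y\<close> passes
    \<open>c\<close> before the walk passes \<open>c - b\<close>.\<close>
  define b where "b = \<kappa> + e"
  \<comment> \<open>Some time that matters for one of the two passages at which the perturbation is
    not within \<open>e\<close> of \<open>\<kappa>\<close>. Almost every path has only finitely many
    such unsettled times, and a large \<open>c\<close> makes them all irrelevant.\<close>
  define J where "J c \<omega> \<longleftrightarrow> (\<exists>t. \<not> (Y t \<omega> < c \<and> S t \<omega> < c - b) \<and> \<not> \<bar>Y t \<omega> - S t \<omega> - \<kappa>\<bar> \<le> e)" for c \<omega>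
  have [measurable]: "Measurable.pred \<Omega> (J c)" for c unfolding J_def by measurable
  have J_lim: "((\<lambda>c. \<integral>\<omega>. of_bool (J c \<omega>) \<partial>\<Omega>) \<longlongrightarrow> (\<integral>\<omega>. (0::real) \<partial>\<Omega>)) at_top"
  proof (rule integral_dominated_convergence_at_top[where w="\<lambda>_. 1"])
    show "AE \<omega> in \<Omega>. ((\<lambda>c. of_bool (J c \<omega>) :: real) \<longlongrightarrow> 0) at_top"
      using lim
    proof eventually_elim
      case (elim \<omega>)
      have "\<forall>\<^sub>F t in sequentially. dist (Y t \<omega> - S t \<omega>) \<kappa> < e" by (rule tendstoD[OF elim e(1)])
      then obtain m where m: "\<And>t. t \<ge> m \<Longrightarrow> dist (Y t \<omega> - S t \<omega>) \<kappa> < e" by (auto simp: eventually_sequentially)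
      have "\<forall>\<^sub>F c in at_top. \<forall>t\<in>{..<m}. Y t \<omega> < c \<and> S t \<omega> + b < c"
        by (intro eventually_ball_finite ballI eventually_conj eventually_gt_at_top) simp
      then have "\<forall>\<^sub>F c in at_top. \<not> J c \<omega>"
      proof eventually_elim
        case e2: (elim c)
        show ?case unfolding J_def
        proof (clarify)
          fix t assume a: "\<not> (Y t \<omega> < c \<and> S t \<omega> < c - b)" "\<not> \<bar>Y t \<omega> - S t \<omega> - \<kappa>\<bar> \<le> e"
          show False
          proof (cases "t < m")
            case True
            then show False using e2 a(1) by (auto simp: less_diff_eq)
          next
            case False
            then show False using m[of t] a(2) by (simp add: dist_real_def)
          qed
        qed
      qed
      then show ?case by (intro tendsto_eventually) (auto elim: eventually_mono)
    qed
  qed auto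
  have close: "\<bar>passage Y c \<omega> - passage S (c - b) \<omega>\<bar> \<le> 2 * e + of_bool (J c \<omega>) + of_bool (crosses (c - b) (2 * e) \<omega>)"
    if c: "0 < c - b" and ex: "\<exists>t. c - b \<le> S t \<omega>" for c \<omega>
  proof (cases "J c \<omega> \<or> crosses (c - b) (2 * e) \<omega>")
    case True
    then have "1 \<le> of_bool (J c \<omega>) + (of_bool (crosses (c - b) (2 * e) \<omega>) :: real)" by auto
    then show ?thesis using passage_01[of Y c \<omega>] passage_01[of S "c - b" \<omega>] e(1) by linarith
  next
    case False
    define \<tau> where "\<tau> = first_up S (c - b) \<omega>"
    note \<tau> = first_up[OF ex, folded \<tau>_def]
    have far: "2 * e < S \<tau> \<omega> - (c - b)" using False ex by (simp add: crosses_iff \<tau>_def)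
    have alt: "(Y t \<omega> < c \<and> S t \<omega> < c - b) \<or> \<bar>Y t \<omega> - S t \<omega> - \<kappa>\<bar> \<le> e" for t
      using False unfolding J_def by blast
    have Y\<tau>: "\<bar>Y \<tau> \<omega> - S \<tau> \<omega> - \<kappa>\<bar> \<le> e" using alt[of \<tau>] \<tau>(1) by auto
    then have cY: "c \<le> Y \<tau> \<omega>" using far unfolding b_def by linarith
    have \<tau>1: "1 \<le> \<tau>" using \<tau>(1) c by (cases \<tau>) auto
    have least: "(LEAST t. 1 \<le> t \<and> c \<le> Y t \<omega>) = \<tau>"
    proof (rule Least_equality)
      fix t assume t: "1 \<le> t \<and> c \<le> Y t \<omega>"
      show "\<tau> \<le> t"
      proof (rule ccontr)
        assume "\<not> \<tau> \<le> t"
        then have "S t \<omega> < c - b" using \<tau>(2) by simp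
        then show False using alt[of t] t unfolding b_def by linarith
      qed
    qed (use \<tau>1 cY in simp)
    have "passage Y c \<omega> = exp (c - Y \<tau> \<omega>)"
      using \<tau>1 cY least by (auto simp: passage_def)
    moreover have "passage S (c - b) \<omega> = exp (c - b - S \<tau> \<omega>)"
      using passage_S[OF c ex] by (simp add: \<tau>_def)
    moreover have "\<bar>exp (c - Y \<tau> \<omega>) - exp (c - b - S \<tau> \<omega>)\<bar> \<le> \<bar>(c - Y \<tau> \<omega>) - (c - b - S \<tau> \<omega>)\<bar>"
      by (rule abs_exp_diff_le) (use cY \<tau>(1) in auto)
    moreover have "\<bar>(c - Y \<tau> \<omega>) - (c - b - S \<tau> \<omega>)\<bar> \<le> 2 * e" using Y\<tau> e(1) unfolding b_def by linarith
    ultimately show ?thesis by simp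
  qed
  have ip: "integrable \<Omega> (passage Z c)" if [measurable]: "\<And>t. Z t \<in> borel_measurable \<Omega>" for Z c
    by (rule seq.P.integrable_const_bound[where B=1]) (use passage_01[of Z c] in auto)
  have diff: "\<bar>(\<integral>\<omega>. passage Y c \<omega> \<partial>\<Omega>) - (\<integral>\<omega>. passage S (c - b) \<omega> \<partial>\<Omega>)\<bar>
      \<le> 2 * e + (\<integral>\<omega>. of_bool (J c \<omega>) \<partial>\<Omega>) + ocdf (c - b) (2 * e)" if c: "0 < c - b" for c
  proof -
    have "\<bar>(\<integral>\<omega>. passage Y c \<omega> \<partial>\<Omega>) - (\<integral>\<omega>. passage S (c - b) \<omega> \<partial>\<Omega>)\<bar> = \<bar>\<integral>\<omega>. passage Y c \<omega> - passage S (c - b) \<omega> \<partial>\<Omega>\<bar>"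
      by (subst Bochner_Integration.integral_diff) (auto intro: ip)
    also have "\<dots> \<le> (\<integral>\<omega>. \<bar>passage Y c \<omega> - passage S (c - b) \<omega>\<bar> \<partial>\<Omega>)" by (rule integral_abs_bound)
    also have "\<dots> \<le> (\<integral>\<omega>. 2 * e + of_bool (J c \<omega>) + of_bool (crosses (c - b) (2 * e) \<omega>) \<partial>\<Omega>)"
    proof (rule integral_mono_AE)
      show "AE \<omega> in \<Omega>. \<bar>passage Y c \<omega> - passage S (c - b) \<omega>\<bar> \<le> 2 * e + of_bool (J c \<omega>) + of_bool (crosses (c - b) (2 * e) \<omega>)"
        using AE_crosses by eventually_elim (rule close[OF c], blast)
    qed (intro integrable_abs Bochner_Integration.integrable_diff Bochner_Integration.integrable_add ip int_bool seq.P.integrable_const; simp)+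
    also have "\<dots> = 2 * e + (\<integral>\<omega>. of_bool (J c \<omega>) \<partial>\<Omega>) + ocdf (c - b) (2 * e)"
      unfolding ocdf_def by (simp add: int_bool seq.P.prob_space)
    finally show ?thesis .
  qed
  have sh: "filterlim (\<lambda>c. c - b) at_top (at_top :: real filter)" by (rule filterlim_shift_at_top)
  have "\<forall>\<^sub>F c in at_top. dist (\<integral>\<omega>. passage S (c - b) \<omega> \<partial>\<Omega>) ?\<gamma> < \<delta> / 4"
    by (rule tendstoD[OF filterlim_compose[OF passage_S_tendsto sh]]) (use \<delta> in simp)
  moreover have "\<forall>\<^sub>F c in at_top. (\<integral>\<omega>. of_bool (J c \<omega>) \<partial>\<Omega>) < \<delta> / 4"
    by (rule order_tendstoD(2)[OF J_lim]) (use \<delta> in simp)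
  moreover have "\<forall>\<^sub>F c in at_top. ocdf (c - b) (2 * e) < limit_ocdf (2 * e) + \<delta> / 4"
    by (rule order_tendstoD(2)[OF filterlim_compose[OF ocdf_tendsto sh]]) (use \<delta> in simp)
  moreover have "\<forall>\<^sub>F c in at_top. 0 < c - b"
    using eventually_gt_at_top[of b] by eventually_elim simp
  ultimately show "\<forall>\<^sub>F c in at_top. dist (\<integral>\<omega>. passage Y c \<omega> \<partial>\<Omega>) ?\<gamma> < \<delta>"
  proof eventually_elim
    case (elim c)
    show ?case using diff[OF elim(4)] elim(1-3) e(2) unfolding dist_real_def by linarith
  qed
qed

text \<open>Some \<open>x\<close> bounds the overshoot with limiting probability above one half, and
  on that event \<open>passage\<close> is at least \<open>exp (- x)\<close>. Positivity is what
  allows errors to be stated as factors \<open>1 + \<epsilon>\<close>.\<close>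

lemma laplace_limit_pos: "0 < laplace_at_one limit_ocdf"
proof -
  have "\<forall>\<^sub>F x in at_top. 1/2 < limit_ocdf x" by (rule order_tendstoD(1)[OF limit_ocdf_at_top]) simp
  then obtain x where x: "1/2 < limit_ocdf x" by (auto simp: eventually_at_top_linorder)
  have "exp (- x) * limit_ocdf x \<le> laplace_at_one limit_ocdf"
  proof (rule tendsto_le[OF _ passage_S_tendsto tendsto_mult_left[OF ocdf_tendsto]])
    show "\<forall>\<^sub>F c in at_top. exp (- x) * ocdf c x \<le> (\<integral>\<omega>. passage S c \<omega> \<partial>\<Omega>)"
      using eventually_gt_at_top[of 0]
    proof eventually_elim
      case (elim c)
      have "exp (- x) * ocdf c x = (\<integral>\<omega>. exp (- x) * of_bool (crosses c x \<omega>) \<partial>\<Omega>)"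
        by (simp add: ocdf_def)
      also have "\<dots> \<le> (\<integral>\<omega>. passage S c \<omega> \<partial>\<Omega>)"
      proof (rule integral_mono)
        show "integrable \<Omega> (passage S c)"
          by (rule seq.P.integrable_const_bound[where B=1]) (use passage_01[of S c] in auto)
        fix \<omega>
        show "exp (- x) * of_bool (crosses c x \<omega>) \<le> passage S c \<omega>"
          using passage_01(1)[of S c \<omega>] passage_S[OF elim, of \<omega>] by (auto simp: crosses_iff)
      qed (intro integrable_mult_right int_bool; simp)
      finally show ?case .
    qed
  qed simp
  moreover have "0 < exp (- x) * limit_ocdf x" using x by simp
  ultimately show ?thesis by linarith
qed

end

section \<open>Change of measure on finitely many coordinates\<close>

text \<open>Stands in for measurability with respect to the first \<open>n\<close> observations,
  without introducing the generated sigma-algebra.\<close>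

definition determined :: "nat \<Rightarrow> ((nat \<Rightarrow> 'x) \<Rightarrow> 'b) \<Rightarrow> bool" where
  "determined n g \<longleftrightarrow> (\<forall>\<omega> \<omega>'. (\<forall>k<n. \<omega> k = \<omega>' k) \<longrightarrow> g \<omega> = g \<omega>')"

text \<open>Two infinite product laws are in general mutually singular, so a density exists only for
  functions of finitely many coordinates. The induction integrates out the first coordinate.\<close>

lemma nn_integral_PiM_density:
  fixes g :: "(nat \<Rightarrow> 'x) \<Rightarrow> ennreal" and w :: "'x \<Rightarrow> ennreal"
  assumes D0: "prob_space D0" and D: "prob_space (density D0 w)"
    and w [measurable]: "w \<in> borel_measurable D0"
    and "g \<in> borel_measurable (PiM UNIV (\<lambda>_::nat. D0))" "determined n g"
  shows "(\<integral>\<^sup>+\<omega>. g \<omega> \<partial>PiM UNIV (\<lambda>_::nat. density D0 w))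
    = (\<integral>\<^sup>+\<omega>. g \<omega> * (\<Prod>k<n. w (\<omega> k)) \<partial>PiM UNIV (\<lambda>_::nat. D0))"
  using assms(4,5)
proof (induction n arbitrary: g)
  case 0
  interpret iid_seq D0 unfolding iid_seq_def by (rule D0)
  interpret D1: iid_seq "density D0 w" unfolding iid_seq_def by (rule D)
  have "g = (\<lambda>_. g undefined)" using 0(2) by (auto simp: determined_def fun_eq_iff)
  then obtain a where "g = (\<lambda>_. a)" by blast
  then show ?case by (simp add: seq.P.emeasure_space_1 D1.seq.P.emeasure_space_1)
next
  case (Suc n)
  interpret iid_seq D0 unfolding iid_seq_def by (rule D0)
  interpret D1: iid_seq "density D0 w" unfolding iid_seq_def by (rule D)
  note [measurable] = Suc.prems(1)
  have sets: "sets D1.\<Omega> = sets \<Omega>" by (intro sets_PiM_cong) auto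
  have [measurable]: "g \<in> borel_measurable D1.\<Omega>"
    using Suc.prems(1) measurable_cong_sets[OF sets refl] by blast
  have "(\<integral>\<^sup>+\<omega>. g \<omega> \<partial>D1.\<Omega>) = (\<integral>\<^sup>+x. (\<integral>\<^sup>+\<omega>. g (case_nat x \<omega>) \<partial>D1.\<Omega>) \<partial>density D0 w)"
    by (rule D1.nn_integral_first_step) simp
  also have "\<dots> = (\<integral>\<^sup>+x. (\<integral>\<^sup>+\<omega>. g (case_nat x \<omega>) * (\<Prod>k<n. w (\<omega> k)) \<partial>\<Omega>) \<partial>density D0 w)"
  proof (rule nn_integral_cong)
    fix x assume "x \<in> space (density D0 w)"
    then have [measurable]: "x \<in> space D0" by simp
    show "(\<integral>\<^sup>+\<omega>. g (case_nat x \<omega>) \<partial>D1.\<Omega>) = (\<integral>\<^sup>+\<omega>. g (case_nat x \<omega>) * (\<Prod>k<n. w (\<omega> k)) \<partial>\<Omega>)"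
    proof (rule Suc.IH)
      show "determined n (\<lambda>\<omega>. g (case_nat x \<omega>))"
        unfolding determined_def
      proof (intro allI impI)
        fix \<omega> \<omega>' assume "\<forall>k<n. \<omega> k = (\<omega>' k :: 'x)"
        then have "\<forall>k<Suc n. case_nat x \<omega> k = case_nat x \<omega>' k" by (auto split: nat.split)
        then show "g (case_nat x \<omega>) = g (case_nat x \<omega>')" using Suc.prems(2) unfolding determined_def by blast
      qed
      have "(\<lambda>\<omega>. case (x, \<omega>) of (x, \<omega>) \<Rightarrow> case_nat x \<omega>) \<in> measurable \<Omega> \<Omega>" by measurable
      then show "(\<lambda>\<omega>. g (case_nat x \<omega>)) \<in> borel_measurable \<Omega>"
        using measurable_compose[OF _ Suc.prems(1)] by simp
    qed
  qed
  also have "\<dots> = (\<integral>\<^sup>+x. w x * (\<integral>\<^sup>+\<omega>. g (case_nat x \<omega>) * (\<Prod>k<n. w (\<omega> k)) \<partial>\<Omega>) \<partial>D0)"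
  proof (rule nn_integral_density)
    have "(\<lambda>p. (g \<circ> (\<lambda>(x, \<omega>). case_nat x \<omega>)) p * (\<Prod>k<n. w (snd p k))) \<in> borel_measurable (D0 \<Otimes>\<^sub>M \<Omega>)"
      by measurable
    then have "(\<lambda>(x, \<omega>). g (case_nat x \<omega>) * (\<Prod>k<n. w (\<omega> k))) \<in> borel_measurable (D0 \<Otimes>\<^sub>M \<Omega>)"
      by (simp add: split_beta' comp_def)
    then show "(\<lambda>x. \<integral>\<^sup>+\<omega>. g (case_nat x \<omega>) * (\<Prod>k<n. w (\<omega> k)) \<partial>\<Omega>) \<in> borel_measurable D0"
      by (rule seq.P.borel_measurable_nn_integral)
  qed simp
  also have "\<dots> = (\<integral>\<^sup>+x. (\<integral>\<^sup>+\<omega>. g (case_nat x \<omega>) * (\<Prod>k<Suc n. w (case_nat x \<omega> k)) \<partial>\<Omega>) \<partial>D0)"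
  proof (rule nn_integral_cong)
    fix x assume x: "x \<in> space D0"
    have "(\<lambda>\<omega>. case (x, \<omega>) of (x, \<omega>) \<Rightarrow> case_nat x \<omega>) \<in> measurable \<Omega> \<Omega>" using x by measurable
    then have [measurable]: "(\<lambda>\<omega>. g (case_nat x \<omega>)) \<in> borel_measurable \<Omega>"
      using measurable_compose[OF _ Suc.prems(1)] by simp
    show "w x * (\<integral>\<^sup>+\<omega>. g (case_nat x \<omega>) * (\<Prod>k<n. w (\<omega> k)) \<partial>\<Omega>)
        = (\<integral>\<^sup>+\<omega>. g (case_nat x \<omega>) * (\<Prod>k<Suc n. w (case_nat x \<omega> k)) \<partial>\<Omega>)"
      by (subst nn_integral_cmult[symmetric])
        (auto simp: prod.lessThan_Suc_shift mult_ac simp del: prod.lessThan_Suc)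
  qed
  also have "\<dots> = (\<integral>\<^sup>+\<omega>. g \<omega> * (\<Prod>k<Suc n. w (\<omega> k)) \<partial>\<Omega>)"
    by (rule nn_integral_first_step[symmetric]) measurable
  finally show ?case .
qed

context iid_seq
begin

lemma nn_integral_prod:
  assumes [measurable]: "h \<in> borel_measurable D"
  shows "(\<integral>\<^sup>+\<omega>. (\<Prod>k<n. h (\<omega> k) :: ennreal) \<partial>\<Omega>) = (\<integral>\<^sup>+x. h x \<partial>D) ^ n"
proof (induction n)
  case (Suc n)
  have "(\<integral>\<^sup>+\<omega>. (\<Prod>k<Suc n. h (\<omega> k)) \<partial>\<Omega>) = (\<integral>\<^sup>+x. (\<integral>\<^sup>+\<omega>. h x * (\<Prod>k<n. h (\<omega> k)) \<partial>\<Omega>) \<partial>D)"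
    by (subst nn_integral_first_step) (auto simp: prod.lessThan_Suc_shift simp del: prod.lessThan_Suc)
  also have "\<dots> = (\<integral>\<^sup>+x. h x \<partial>D) * (\<integral>\<^sup>+\<omega>. (\<Prod>k<n. h (\<omega> k)) \<partial>\<Omega>)"
    by (simp add: nn_integral_cmult nn_integral_multc)
  finally show ?case by (simp add: Suc)
qed (simp add: seq.P.emeasure_space_1)

text \<open>The partial products have means \<open>\<rho> ^ n\<close>, which are summable; hence
  almost surely the products themselves have a finite sum and tend to 0.\<close>

lemma prod_tendsto_0:
  fixes h :: "'x \<Rightarrow> real"
  assumes [measurable]: "h \<in> borel_measurable D" and nn: "\<And>x. 0 \<le> h x"
    and lt: "(\<integral>\<^sup>+x. ennreal (h x) \<partial>D) < 1"
  shows "AE \<omega> in \<Omega>. (\<lambda>n. \<Prod>k<n. h (\<omega> k)) \<longlonglongrightarrow> 0"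
proof -
  obtain \<rho> where \<rho>: "0 \<le> \<rho>" "(\<integral>\<^sup>+x. ennreal (h x) \<partial>D) = ennreal \<rho>"
    using lt by (cases "\<integral>\<^sup>+x. ennreal (h x) \<partial>D") auto
  have \<rho>1: "\<rho> < 1" using lt \<rho> by simp
  have "(\<integral>\<^sup>+\<omega>. (\<Prod>k<n. ennreal (h (\<omega> k))) \<partial>\<Omega>) = ennreal \<rho> ^ n" for n
    using nn_integral_prod[of "\<lambda>x. ennreal (h x)" n] \<rho>(2) by simp
  then have "(\<integral>\<^sup>+\<omega>. (\<Sum>n. \<Prod>k<n. ennreal (h (\<omega> k))) \<partial>\<Omega>) = (\<Sum>n. ennreal \<rho> ^ n)"
    by (subst nn_integral_suminf) simp_all
  also have "\<dots> = (\<Sum>n. ennreal (\<rho> ^ n))" using \<rho>(1) by (simp add: ennreal_power)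
  also have "\<dots> = ennreal (\<Sum>n. \<rho> ^ n)"
    by (rule suminf_ennreal2) (use \<rho> \<rho>1 in \<open>auto intro!: summable_geometric\<close>)
  finally have "(\<integral>\<^sup>+\<omega>. (\<Sum>n. \<Prod>k<n. ennreal (h (\<omega> k))) \<partial>\<Omega>) \<noteq> \<infinity>" by simp
  then have "AE \<omega> in \<Omega>. (\<Sum>n. \<Prod>k<n. ennreal (h (\<omega> k))) \<noteq> \<infinity>"
    by (rule nn_integral_PInf_AE[rotated]) measurable
  then show ?thesis
  proof eventually_elim
    case (elim \<omega>)
    have e: "(\<Prod>k<n. ennreal (h (\<omega> k))) = ennreal (\<Prod>k<n. h (\<omega> k))" for n
      by (rule prod_ennreal) (rule nn)
    have "summable (\<lambda>n. \<Prod>k<n. h (\<omega> k))"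
      by (rule summable_suminf_not_top) (use elim in \<open>auto simp: e intro!: prod_nonneg nn\<close>)
    then show ?case by (rule summable_LIMSEQ_zero)
  qed
qed

end

section \<open>Transfer of overshoot distributions\<close>

text \<open>At the first downward passage \<open>Z + c \<le> 0\<close>, so the absolute value is the
  overshoot of \<open>- Z\<close> over \<open>c\<close>.\<close>

lemma overshoot_down_cdf_eq:
  "overshoot_down_cdf M Z = overshoot_up_cdf M (\<lambda>t \<omega>. - Z t \<omega>)"
proof -
  have le: "c \<le> - z \<longleftrightarrow> z \<le> - c" for c z :: real by auto
  have fd: "first_down Z c \<omega> = first_up (\<lambda>t \<omega>. - Z t \<omega>) c \<omega>" for c \<omega>
    by (simp add: first_down_def first_up_def le)
  have "((\<exists>t. Z t \<omega> \<le> - c) \<and> \<bar>Z (first_down Z c \<omega>) \<omega> + c\<bar> \<le> x)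
     \<longleftrightarrow> ((\<exists>t. c \<le> - Z t \<omega>) \<and> - Z (first_up (\<lambda>t \<omega>. - Z t \<omega>) c \<omega>) \<omega> - c \<le> x)" for \<omega> c x
  proof (cases "\<exists>t. Z t \<omega> \<le> - c")
    case True
    from LeastI_ex[OF True] have "Z (first_down Z c \<omega>) \<omega> \<le> - c" by (simp add: first_down_def)
    then show ?thesis using True by (auto simp: fd le)
  qed (simp add: le)
  then show ?thesis
    by (simp add: overshoot_down_cdf_def[abs_def] overshoot_up_cdf_def[abs_def])
qed

text \<open>\<open>LLR\<close> is the logarithm of a product and the walk a sum of logarithms; they
  are shown to agree on paths where all densities are positive, hence almost surely.\<close>

lemma overshoot_up_cdf_cong_AE:
  assumes "prob_space M"
    and [measurable]: "\<And>t. Y t \<in> borel_measurable M" "\<And>t. Z t \<in> borel_measurable M"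
    and eq: "AE \<omega> in M. \<forall>t. Y t \<omega> = Z t \<omega>"
  shows "overshoot_up_cdf M Y = overshoot_up_cdf M Z"
proof -
  interpret prob_space M by fact
  have m: "{\<omega> \<in> space M. (\<exists>t. c \<le> X t \<omega>) \<and> X (first_up X c \<omega>) \<omega> - c \<le> x} \<in> sets M"
    if [measurable]: "\<And>t. X t \<in> borel_measurable M" for X c x
  proof -
    have [measurable]: "(\<lambda>\<omega>. X (first_up X c \<omega>) \<omega>) \<in> borel_measurable M"
      unfolding first_up_def by (rule measurable_compose_countable[of _ M]) measurable
    show ?thesis by measurable
  qed
  have "measure M {\<omega> \<in> space M. (\<exists>t. c \<le> Y t \<omega>) \<and> Y (first_up Y c \<omega>) \<omega> - c \<le> x}
    = measure M {\<omega> \<in> space M. (\<exists>t. c \<le> Z t \<omega>) \<and> Z (first_up Z c \<omega>) \<omega> - c \<le> x}" for c x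
  proof (rule finite_measure_eq_AE[OF _ m m])
    show "AE \<omega> in M. (\<omega> \<in> {\<omega> \<in> space M. (\<exists>t. c \<le> Y t \<omega>) \<and> Y (first_up Y c \<omega>) \<omega> - c \<le> x})
      = (\<omega> \<in> {\<omega> \<in> space M. (\<exists>t. c \<le> Z t \<omega>) \<and> Z (first_up Z c \<omega>) \<omega> - c \<le> x})"
      using eq by eventually_elim (simp add: first_up_def)
  qed measurable
  then show ?thesis by (simp add: overshoot_up_cdf_def[abs_def])
qed

subsection \<open>The likelihood ratio model\<close>

context iid_seq
begin

lemma integrable_coord_iff:
  fixes g :: "'x \<Rightarrow> real"
  assumes [measurable]: "g \<in> borel_measurable D"
  shows "integrable \<Omega> (\<lambda>\<omega>. g (\<omega> k)) \<longleftrightarrow> integrable D g"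
proof -
  have "integrable (distr \<Omega> D (\<lambda>\<omega>. \<omega> k)) g \<longleftrightarrow> integrable \<Omega> (\<lambda>\<omega>. g (\<omega> k))"
    by (rule integrable_distr_eq) auto
  then show ?thesis by (simp only: distr_coord)
qed

lemma integral_coord:
  fixes g :: "'x \<Rightarrow> real"
  assumes [measurable]: "g \<in> borel_measurable D"
  shows "(\<integral>\<omega>. g (\<omega> k) \<partial>\<Omega>) = (\<integral>x. g x \<partial>D)"
proof -
  have "integral\<^sup>L (distr \<Omega> D (\<lambda>\<omega>. \<omega> k)) g = (\<integral>\<omega>. g (\<omega> k) \<partial>\<Omega>)"
    by (rule integral_distr) auto
  then show ?thesis by (simp only: distr_coord)
qed

lemma arithmetic_coord: "arithmetic D g \<Longrightarrow> arithmetic \<Omega> (\<lambda>\<omega>. g (\<omega> k))"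
  unfolding arithmetic_def using AE_all_coords by (auto elim!: eventually_mono) (metis (mono_tags, lifting) eventually_mono)

end

locale test_model =
  fixes \<nu> :: "'x measure" and f :: "nat \<Rightarrow> 'x \<Rightarrow> real" and K :: nat
  assumes K: "1 \<le> K"
    and f_meas: "\<And>j. j \<le> K \<Longrightarrow> f j \<in> borel_measurable \<nu>"
    and f_nonneg: "\<And>j x. j \<le> K \<Longrightarrow> 0 \<le> f j x"
    and f_density: "\<And>j. j \<le> K \<Longrightarrow> (\<integral>\<^sup>+ x. ennreal (f j x) \<partial>\<nu>) = 1"
    and common_support: "\<And>j. j \<le> K \<Longrightarrow> {x \<in> space \<nu>. 0 < f j x} = {x \<in> space \<nu>. 0 < f 0 x}"
    and f_distinct: "\<And>i. i \<in> {1..K} \<Longrightarrow> emeasure \<nu> {x \<in> space \<nu>. f i x \<noteq> f 0 x} > 0"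
    and nonarith0: "\<And>i. i \<in> {1..K} \<Longrightarrow> \<not> arithmetic (obs_law \<nu> f 0) (LLR f i 1)"
    and nonarith1: "\<And>i. i \<in> {1..K} \<Longrightarrow> \<not> arithmetic (obs_law \<nu> f i) (LLR f i 1)"
    and I_finite: "\<And>i. i \<in> {1..K} \<Longrightarrow> integrable (obs_law \<nu> f i) (LLR f i 1)"
    and I0_finite: "\<And>i. i \<in> {1..K} \<Longrightarrow> integrable (obs_law \<nu> f 0) (LLR f i 1)"
begin

abbreviation "D j \<equiv> density \<nu> (\<lambda>x. ennreal (f j x))"
abbreviation "P \<equiv> obs_law \<nu> f"
abbreviation "mix \<equiv> mixLR f K"
abbreviation "mx \<equiv> maxLR f K"
abbreviation "pos_weight q \<equiv> \<forall>i\<in>{1..K}. 0 < q i"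
abbreviation "pr j R \<equiv> measure (P j) {\<omega> \<in> space (P j). \<exists>n::nat. R n \<omega>}"

lemma P_eq: "P j = PiM UNIV (\<lambda>_::nat. D j)"
  by (simp add: obs_law_def)

lemma f_meas_D: "i \<le> K \<Longrightarrow> f i \<in> borel_measurable (D j)"
  using f_meas by simp

lemma f_pos_iff: "i \<le> K \<Longrightarrow> j \<le> K \<Longrightarrow> x \<in> space \<nu> \<Longrightarrow> 0 < f i x \<longleftrightarrow> 0 < f j x"
  using common_support[of i] common_support[of j] by blast

lemma prob_D: assumes "j \<le> K" shows "prob_space (D j)"
proof (rule prob_spaceI)
  note [measurable] = f_meas[OF assms]
  have "emeasure (D j) (space (D j)) = (\<integral>\<^sup>+ x. ennreal (f j x) * indicator (space \<nu>) x \<partial>\<nu>)"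
    by (simp add: emeasure_density)
  also have "\<dots> = (\<integral>\<^sup>+ x. ennreal (f j x) \<partial>\<nu>)" by (intro nn_integral_cong) simp
  finally show "emeasure (D j) (space (D j)) = 1" using f_density[OF assms] by simp
qed

lemma iid_D: "j \<le> K \<Longrightarrow> iid_seq (D j)"
  unfolding iid_seq_def by (rule prob_D)

lemma prob_P: assumes "j \<le> K" shows "prob_space (P j)"
proof -
  interpret iid_seq "D j" by (rule iid_D[OF assms])
  show ?thesis unfolding P_eq by (rule seq.P.prob_space_axioms)
qed

text \<open>Where \<open>f 0\<close> vanishes, so does \<open>f i\<close> by the common support, and
  the value of the quotient there is immaterial.\<close>

lemma D_density:
  assumes "i \<le> K" shows "D i = density (D 0) (\<lambda>x. ennreal (f i x / f 0 x))"
proof -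
  note [measurable] = f_meas[OF assms] f_meas[of 0]
  have "density (D 0) (\<lambda>x. ennreal (f i x / f 0 x)) = density \<nu> (\<lambda>x. ennreal (f 0 x) * ennreal (f i x / f 0 x))"
    by (rule density_density_eq) auto
  also have "\<dots> = D i"
  proof (rule density_cong)
    show "AE x in \<nu>. ennreal (f 0 x) * ennreal (f i x / f 0 x) = ennreal (f i x)"
    proof (rule AE_I2)
      fix x assume x: "x \<in> space \<nu>"
      have "f 0 x = 0 \<Longrightarrow> f i x = 0" using f_pos_iff[OF assms _ x, of 0] f_nonneg[OF assms, of x] by auto
      then show "ennreal (f 0 x) * ennreal (f i x / f 0 x) = ennreal (f i x)"
        using f_nonneg[OF assms, of x] f_nonneg[of 0 x] by (simp flip: ennreal_mult)
    qed
  qed auto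
  finally show ?thesis ..
qed

lemma AE_pos: assumes "j \<le> K" shows "AE x in D j. \<forall>i\<le>K. 0 < f i x"
proof -
  note [measurable] = f_meas[OF assms]
  show ?thesis
    by (subst AE_density) (auto intro!: AE_I2 simp: f_pos_iff[OF _ assms])
qed

text \<open>A set of full measure under every hypothesis at once, on which all quotients and
  logarithms of likelihoods behave as expected.\<close>

definition good :: "(nat \<Rightarrow> 'x) \<Rightarrow> bool" where
  "good \<omega> \<longleftrightarrow> (\<forall>k. \<forall>i\<le>K. 0 < f i (\<omega> k))"

lemma goodD: "good \<omega> \<Longrightarrow> i \<le> K \<Longrightarrow> 0 < f i (\<omega> k)"
  by (simp add: good_def)

lemma good_nonzero: "good \<omega> \<Longrightarrow> i \<le> K \<Longrightarrow> f i (\<omega> k) \<noteq> 0"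
  using goodD[of \<omega> i k] by simp

lemma AE_good: assumes "j \<le> K" shows "AE \<omega> in P j. good \<omega>"
proof -
  interpret iid_seq "D j" by (rule iid_D[OF assms])
  show ?thesis unfolding P_eq good_def by (rule AE_all_coords[OF AE_pos[OF assms]])
qed

lemma sets_P: "sets (P i) = sets (P j)"
  unfolding P_eq by (intro sets_PiM_cong) auto

lemma space_P: "space (P i) = space (P j)"
  by (rule sets_eq_imp_space_eq[OF sets_P])

lemma LR_measurable: "i \<le> K \<Longrightarrow> LR f i t \<in> borel_measurable (P j)"
proof -
  assume i: "i \<le> K"
  note [measurable] = f_meas_D[OF i, of j] f_meas_D[of 0 j]
  show ?thesis unfolding P_eq LR_def[abs_def] by measurable
qed

lemma LR_nonneg: "i \<le> K \<Longrightarrow> 0 \<le> LR f i t \<omega>"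
  unfolding LR_def by (intro prod_nonneg ballI divide_nonneg_nonneg f_nonneg) auto

lemma LR_pos: "good \<omega> \<Longrightarrow> i \<le> K \<Longrightarrow> 0 < LR f i t \<omega>"
  unfolding LR_def by (intro prod_pos ballI divide_pos_pos goodD) auto

lemma LLR_sum: "good \<omega> \<Longrightarrow> i \<le> K \<Longrightarrow> LLR f i t \<omega> = (\<Sum>k<t. ln (f i (\<omega> k) / f 0 (\<omega> k)))"
  unfolding LLR_def LR_def using goodD[of \<omega> i] goodD[of \<omega> 0] by (intro ln_prod) (auto simp: good_nonzero)

lemma LLR_1: "LLR f i 1 = (\<lambda>\<omega>. ln (f i (\<omega> 0) / f 0 (\<omega> 0)))"
  by (simp add: LLR_def[abs_def] LR_def)

lemma LR_ratio: "good \<omega> \<Longrightarrow> LR f i t \<omega> / LR f j t \<omega> = (\<Prod>k<t. f i (\<omega> k) / f j (\<omega> k))"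
  unfolding LR_def using goodD[of \<omega> 0]
  by (subst prod_dividef[symmetric], intro prod.cong) (auto simp: less_imp_neq[symmetric])

section \<open>Hellinger affinity and the sign of the drifts\<close>

text \<open>Let \<open>g\<close> be the root of the density ratio. Its second moment is 1, so the
  mean of \<open>(1 - g)\<^sup>2\<close> is 2 minus twice the mean of \<open>g\<close>; this
  vanishes only if \<open>g = 1\<close> almost everywhere on the support, against
  \<open>dist\<close>.\<close>

lemma hellinger:
  assumes ij: "i \<le> K" "j \<le> K" and dist: "emeasure \<nu> {x \<in> space \<nu>. f i x \<noteq> f j x} > 0"
  shows "integrable (D j) (\<lambda>x. sqrt (f i x / f j x))" "(\<integral>x. sqrt (f i x / f j x) \<partial>D j) < 1"
proof -
  note [measurable] = f_meas[OF ij(1)] f_meas[OF ij(2)]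
  interpret prob_space "D j" by (rule prob_D[OF ij(2)])
  define g where "g x = sqrt (f i x / f j x)" for x
  have [measurable]: "g \<in> borel_measurable \<nu>" unfolding g_def by measurable
  have g2: "(g x)\<^sup>2 = f i x / f j x" for x
    using f_nonneg[OF ij(1), of x] f_nonneg[OF ij(2), of x] by (simp add: g_def)
  have g0: "0 \<le> g x" for x using f_nonneg[OF ij(1), of x] f_nonneg[OF ij(2), of x] by (simp add: g_def)
  have "(\<integral>\<^sup>+x. ennreal ((g x)\<^sup>2) \<partial>D j) = (\<integral>\<^sup>+x. ennreal (f j x) * ennreal ((g x)\<^sup>2) \<partial>\<nu>)"
    by (rule nn_integral_density) auto
  also have "\<dots> = (\<integral>\<^sup>+x. ennreal (f i x) \<partial>\<nu>)"
  proof (rule nn_integral_cong)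
    fix x assume x: "x \<in> space \<nu>"
    have "f j x = 0 \<Longrightarrow> f i x = 0" using f_pos_iff[OF ij x] f_nonneg[OF ij(1), of x] by auto
    then show "ennreal (f j x) * ennreal ((g x)\<^sup>2) = ennreal (f i x)"
      using f_nonneg[OF ij(1), of x] f_nonneg[OF ij(2), of x] by (simp add: g2 flip: ennreal_mult)
  qed
  finally have n2: "(\<integral>\<^sup>+x. ennreal ((g x)\<^sup>2) \<partial>D j) = 1" using f_density[OF ij(1)] by simp
  have i2: "integrable (D j) (\<lambda>x. (g x)\<^sup>2)" by (rule integrableI_nonneg) (use n2 in auto)
  have v2: "(\<integral>x. (g x)\<^sup>2 \<partial>D j) = 1" by (subst integral_eq_nn_integral) (use n2 in auto)
  have i1: "integrable (D j) g"
  proof (rule Bochner_Integration.integrable_bound)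
    show "integrable (D j) (\<lambda>x. 1 + (g x)\<^sup>2)" using i2 by simp
    have "g x \<le> 1 + (g x)\<^sup>2" for x
      using zero_le_power2[of "g x - 1/2"] by (simp add: power2_diff power_divide)
    then show "AE x in D j. norm (g x) \<le> norm (1 + (g x)\<^sup>2)" using g0 by simp
  qed simp
  then show "integrable (D j) (\<lambda>x. sqrt (f i x / f j x))" by (simp add: g_def[abs_def])
  have "(\<integral>x. g x \<partial>D j) < 1"
  proof (rule ccontr)
    assume "\<not> (\<integral>x. g x \<partial>D j) < 1"
    have id: "integrable (D j) (\<lambda>x. (1 - g x)\<^sup>2)" using i1 i2 by (simp add: power2_diff)
    have "(\<integral>x. (1 - g x)\<^sup>2 \<partial>D j) = 2 - 2 * (\<integral>x. g x \<partial>D j)"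
      using i1 i2 v2 prob_space by (simp add: power2_diff)
    then have "(\<integral>x. (1 - g x)\<^sup>2 \<partial>D j) \<le> 0" using \<open>\<not> (\<integral>x. g x \<partial>D j) < 1\<close> by simp
    moreover have "0 \<le> (\<integral>x. (1 - g x)\<^sup>2 \<partial>D j)" by (rule integral_nonneg_AE) auto
    ultimately have "(\<integral>x. (1 - g x)\<^sup>2 \<partial>D j) = 0" by simp
    then have "AE x in D j. (1 - g x)\<^sup>2 = 0"
      using integral_nonneg_eq_0_iff_AE[OF id] by simp
    then have "AE x in \<nu>. 0 < f j x \<longrightarrow> (1 - g x)\<^sup>2 = 0"
      by (subst (asm) AE_density) auto
    then have "AE x in \<nu>. x \<notin> {x \<in> space \<nu>. f i x \<noteq> f j x}"
      using AE_space
    proof eventually_elim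
      case (elim x)
      show ?case
      proof (cases "0 < f j x")
        case True
        then have "(g x)\<^sup>2 = 1" using elim by simp
        then show ?thesis using True by (simp add: g2)
      next
        case False
        then show ?thesis using f_pos_iff[OF ij elim(2)] f_nonneg[OF ij(1), of x] f_nonneg[OF ij(2), of x] by auto
      qed
    qed
    then have "emeasure \<nu> {x \<in> space \<nu>. f i x \<noteq> f j x} = 0"
      by (subst (asm) AE_iff_null_sets[symmetric]) (auto simp: null_sets_def)
    then show False using dist by simp
  qed
  then show "(\<integral>x. sqrt (f i x / f j x) \<partial>D j) < 1" by (simp add: g_def)
qed

text \<open>Applying \<open>ln y \<le> y - 1\<close> to the root of the density ratio
  \<open>u\<close> gives \<open>- ln u \<ge> 2 * (1 - sqrt u)\<close>, so the information number is
  bounded below by the positive Hellinger deficit.\<close>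

lemma mean_log_pos:
  assumes ij: "i \<le> K" "j \<le> K" and dist: "emeasure \<nu> {x \<in> space \<nu>. f i x \<noteq> f j x} > 0"
    and int: "integrable (D j) (\<lambda>x. ln (f j x / f i x))"
  shows "0 < (\<integral>x. ln (f j x / f i x) \<partial>D j)"
proof -
  interpret prob_space "D j" by (rule prob_D[OF ij(2)])
  note h = hellinger[OF ij dist]
  have "0 < 2 * (1 - (\<integral>x. sqrt (f i x / f j x) \<partial>D j))" using h(2) by simp
  also have "\<dots> = (\<integral>x. 2 * (1 - sqrt (f i x / f j x)) \<partial>D j)" using h(1) prob_space by simp
  also have "\<dots> \<le> (\<integral>x. ln (f j x / f i x) \<partial>D j)"
  proof (rule integral_mono_AE[OF _ int])
    show "AE x in D j. 2 * (1 - sqrt (f i x / f j x)) \<le> ln (f j x / f i x)"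
      using AE_pos[OF ij(2)]
    proof eventually_elim
      case (elim x)
      then have p: "0 < f i x" "0 < f j x" using ij by auto
      define u where "u = f i x / f j x"
      have u: "0 < u" using p by (simp add: u_def)
      have "ln u = 2 * ln (sqrt u)" using u by (simp add: ln_sqrt)
      moreover have "ln (sqrt u) \<le> sqrt u - 1" by (rule ln_le_minus_one) (use u in simp)
      moreover have "ln (f j x / f i x) = - ln u" using p by (simp add: ln_div u_def)
      ultimately have "2 * (1 - sqrt u) \<le> ln (f j x / f i x)" by simp
      then show ?case unfolding u_def .
    qed
  qed (use h(1) in simp)
  finally show ?thesis .
qed

lemma meas_logratio: "i \<le> K \<Longrightarrow> (\<lambda>x. ln (f i x / f 0 x)) \<in> borel_measurable (D j)"
  using f_meas_D[of i j] f_meas_D[of 0 j] by measurable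

lemma int_logratio:
  assumes "i \<in> {1..K}" "j = 0 \<or> j = i"
  shows "integrable (D j) (\<lambda>x. ln (f i x / f 0 x))"
proof -
  have j: "j \<le> K" using assms by auto
  interpret iid_seq "D j" by (rule iid_D[OF j])
  have "integrable (P j) (LLR f i 1)" using assms I_finite I0_finite by auto
  then show ?thesis
    unfolding P_eq LLR_1 using integrable_coord_iff[OF meas_logratio, of i 0] assms by simp
qed

lemma integral_LLR_1:
  assumes "i \<le> K" "j \<le> K"
  shows "(\<integral>\<omega>. LLR f i 1 \<omega> \<partial>P j) = (\<integral>x. ln (f i x / f 0 x) \<partial>D j)"
proof -
  interpret iid_seq "D j" by (rule iid_D[OF assms(2)])
  show ?thesis unfolding P_eq LLR_1 by (rule integral_coord[OF meas_logratio[OF assms(1)]])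
qed

lemma random_walk_up:
  assumes i: "i \<in> {1..K}"
  shows "random_walk (D i) (\<lambda>x. ln (f i x / f 0 x))"
proof -
  have iK: "i \<le> K" using i by simp
  interpret iid_seq "D i" by (rule iid_D[OF iK])
  show ?thesis
  proof
    show "integrable (D i) (\<lambda>x. ln (f i x / f 0 x))" by (rule int_logratio[OF i]) simp
    have "emeasure \<nu> {x \<in> space \<nu>. f 0 x \<noteq> f i x} > 0" using f_distinct[OF i] by (simp add: eq_commute)
    then show "0 < (\<integral>x. ln (f i x / f 0 x) \<partial>D i)"
      using mean_log_pos[of 0 i] iK int_logratio[OF i, of i] by simp
    show "\<not> arithmetic (D i) (\<lambda>x. ln (f i x / f 0 x))"
      using nonarith1[OF i] arithmetic_coord[of _ 0] unfolding P_eq LLR_1 by blast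
  qed
qed

lemma random_walk_down:
  assumes i: "i \<in> {1..K}"
  shows "random_walk (D 0) (\<lambda>x. - ln (f i x / f 0 x))"
proof -
  have iK: "i \<le> K" using i by simp
  interpret iid_seq "D 0" by (rule iid_D) simp
  have int: "integrable (D 0) (\<lambda>x. ln (f i x / f 0 x))" by (rule int_logratio[OF i]) simp
  note [measurable] = f_meas[OF iK] f_meas[of 0]
  have eq: "AE x in D 0. ln (f 0 x / f i x) = - ln (f i x / f 0 x)"
    using AE_pos[of 0, simplified] by eventually_elim (use iK in \<open>simp add: ln_div\<close>)
  have int': "integrable (D 0) (\<lambda>x. ln (f 0 x / f i x))"
    by (subst integrable_cong_AE[OF _ _ eq]) (use int in auto)
  show ?thesis
  proof
    show "integrable (D 0) (\<lambda>x. - ln (f i x / f 0 x))" using int by simp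
    have "0 < (\<integral>x. ln (f 0 x / f i x) \<partial>D 0)"
      by (rule mean_log_pos[OF iK _ f_distinct[OF i] int']) simp
    also have "\<dots> = (\<integral>x. - ln (f i x / f 0 x) \<partial>D 0)"
      by (rule integral_cong_AE[OF _ _ eq]) auto
    finally show "0 < (\<integral>x. - ln (f i x / f 0 x) \<partial>D 0)" .
    show "\<not> arithmetic (D 0) (\<lambda>x. - ln (f i x / f 0 x))"
    proof
      assume "arithmetic (D 0) (\<lambda>x. - ln (f i x / f 0 x))"
      then obtain h where h: "h > 0" "AE x in D 0. - ln (f i x / f 0 x) \<in> range (\<lambda>k::int. h * of_int k)"
        by (auto simp: arithmetic_def)
      have neg: "- y \<in> range (\<lambda>k::int. h * of_int k) \<Longrightarrow> y \<in> range (\<lambda>k::int. h * of_int k)" for y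
      proof -
        assume "- y \<in> range (\<lambda>k::int. h * of_int k)"
        then obtain k :: int where "- y = h * of_int k" by blast
        then have "y = h * of_int (- k)" by simp
        then show ?thesis by blast
      qed
      have "AE x in D 0. ln (f i x / f 0 x) \<in> range (\<lambda>k::int. h * of_int k)"
        using h(2) by eventually_elim (rule neg)
      then have "arithmetic (D 0) (\<lambda>x. ln (f i x / f 0 x))" using h(1) unfolding arithmetic_def by blast
      then show False using nonarith0[OF i] arithmetic_coord[of _ 0] unfolding P_eq LLR_1 by blast
    qed
  qed
qed

lemma LLR_measurable: "i \<le> K \<Longrightarrow> LLR f i t \<in> borel_measurable (P j)"
  unfolding LLR_def[abs_def] using LR_measurable[of i t j] by measurable

section \<open>Overshoot constants and perturbed likelihood walks\<close>

lemma gamma_up_eq: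
  assumes i: "i \<in> {1..K}"
  shows "gamma_up \<nu> f i = laplace_at_one (random_walk.limit_ocdf (D i) (\<lambda>x. ln (f i x / f 0 x)))"
proof -
  have iK: "i \<le> K" using i by simp
  interpret rw: random_walk "D i" "\<lambda>x. ln (f i x / f 0 x)" by (rule random_walk_up[OF i])
  have "overshoot_up_cdf (P i) (LLR f i) = overshoot_up_cdf (P i) rw.S"
  proof (rule overshoot_up_cdf_cong_AE[OF prob_P[OF iK]])
    show "LLR f i t \<in> borel_measurable (P i)" for t by (rule LLR_measurable[OF iK])
    show "rw.S t \<in> borel_measurable (P i)" for t unfolding P_eq by (rule rw.measurable_S)
    show "AE \<omega> in P i. \<forall>t. LLR f i t \<omega> = rw.S t \<omega>"
      using AE_good[OF iK] by eventually_elim (simp add: LLR_sum iK rw.S_def)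
  qed
  also have "\<dots> = rw.limit_ocdf" unfolding P_eq by (rule ext) (rule rw.overshoot_up_cdf_eq)
  finally show ?thesis by (simp only: gamma_up_def)
qed

lemma gamma_down_eq:
  assumes i: "i \<in> {1..K}"
  shows "gamma_down \<nu> f i = laplace_at_one (random_walk.limit_ocdf (D 0) (\<lambda>x. - ln (f i x / f 0 x)))"
proof -
  have iK: "i \<le> K" using i by simp
  interpret rw: random_walk "D 0" "\<lambda>x. - ln (f i x / f 0 x)" by (rule random_walk_down[OF i])
  have "overshoot_up_cdf (P 0) (\<lambda>t \<omega>. - LLR f i t \<omega>) = overshoot_up_cdf (P 0) rw.S"
  proof (rule overshoot_up_cdf_cong_AE[OF prob_P])
    show "(\<lambda>\<omega>. - LLR f i t \<omega>) \<in> borel_measurable (P 0)" for t using LLR_measurable[OF iK] by measurable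
    show "rw.S t \<in> borel_measurable (P 0)" for t unfolding P_eq by (rule rw.measurable_S)
    show "AE \<omega> in P 0. \<forall>t. - LLR f i t \<omega> = rw.S t \<omega>"
      using AE_good[of 0, simplified] by eventually_elim (simp add: LLR_sum iK rw.S_def sum_negf)
  qed simp
  also have "\<dots> = rw.limit_ocdf" unfolding P_eq by (rule ext) (rule rw.overshoot_up_cdf_eq)
  finally show ?thesis by (simp only: gamma_down_def overshoot_down_cdf_eq)
qed

lemma gamma_up_pos: "i \<in> {1..K} \<Longrightarrow> 0 < gamma_up \<nu> f i"
  unfolding gamma_up_eq by (rule random_walk.laplace_limit_pos[OF random_walk_up])

lemma gamma_down_pos: "i \<in> {1..K} \<Longrightarrow> 0 < gamma_down \<nu> f i"
  unfolding gamma_down_eq by (rule random_walk.laplace_limit_pos[OF random_walk_down])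

text \<open>Two alternatives may have the same density almost everywhere; then the ratio is
  identically 1. Otherwise it is the square of a product of independent factors with mean below
  1.\<close>

lemma ratio_tendsto:
  assumes ij: "i \<le> K" "j \<le> K"
  shows "AE \<omega> in P j. (\<lambda>t. LR f i t \<omega> / LR f j t \<omega>) \<longlonglongrightarrow> of_bool (emeasure \<nu> {x \<in> space \<nu>. f i x \<noteq> f j x} = 0)"
proof (cases "emeasure \<nu> {x \<in> space \<nu>. f i x \<noteq> f j x} = 0")
  case True
  note [measurable] = f_meas[OF ij(1)] f_meas[OF ij(2)]
  interpret iid_seq "D j" by (rule iid_D[OF ij(2)])
  have "AE x in \<nu>. x \<notin> {x \<in> space \<nu>. f i x \<noteq> f j x}"
    by (rule AE_not_in) (simp add: null_sets_def True)
  then have "AE x in \<nu>. 0 < ennreal (f j x) \<longrightarrow> f i x = f j x"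
    using AE_space by eventually_elim auto
  then have "AE x in D j. f i x = f j x"
    by (subst AE_density) auto
  then have "AE \<omega> in P j. \<forall>k. f i (\<omega> k) = f j (\<omega> k)" unfolding P_eq by (rule AE_all_coords)
  then show ?thesis
    using AE_good[OF ij(2)]
  proof eventually_elim
    case (elim \<omega>)
    have 1: "LR f i t \<omega> / LR f j t \<omega> = 1" for t
    proof -
      have "LR f i t \<omega> = LR f j t \<omega>" using elim(1) by (simp add: LR_def)
      then show ?thesis using LR_pos[OF elim(2) ij(2), of t] by simp
    qed
    show ?case unfolding 1 using True by simp
  qed
next
  case False
  then have dist: "emeasure \<nu> {x \<in> space \<nu>. f i x \<noteq> f j x} > 0" by (simp add: zero_less_iff_neq_zero)
  note [measurable] = f_meas[OF ij(1)] f_meas[OF ij(2)]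
  interpret iid_seq "D j" by (rule iid_D[OF ij(2)])
  have nn: "0 \<le> sqrt (f i x / f j x)" for x using f_nonneg[OF ij(1), of x] f_nonneg[OF ij(2), of x] by simp
  have "AE \<omega> in P j. (\<lambda>t. \<Prod>k<t. sqrt (f i (\<omega> k) / f j (\<omega> k))) \<longlonglongrightarrow> 0"
    unfolding P_eq
  proof (rule prod_tendsto_0)
    have "(\<integral>\<^sup>+x. ennreal (sqrt (f i x / f j x)) \<partial>D j) = ennreal (\<integral>x. sqrt (f i x / f j x) \<partial>D j)"
      by (rule nn_integral_eq_integral) (use hellinger[OF ij dist] nn in auto)
    also have "\<dots> < 1" using hellinger(2)[OF ij dist] by simp
    finally show "(\<integral>\<^sup>+x. ennreal (sqrt (f i x / f j x)) \<partial>D j) < 1" .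
  qed (use nn in auto)
  then show ?thesis
    using AE_good[OF ij(2)]
  proof eventually_elim
    case (elim \<omega>)
    have "LR f i t \<omega> / LR f j t \<omega> = (\<Prod>k<t. sqrt (f i (\<omega> k) / f j (\<omega> k)))\<^sup>2" for t
      using f_nonneg[OF ij(1)] f_nonneg[OF ij(2)]
      by (simp add: LR_ratio[OF elim(2)] prod_power_distrib)
    moreover have "(\<lambda>t. (\<Prod>k<t. sqrt (f i (\<omega> k) / f j (\<omega> k)))\<^sup>2) \<longlonglongrightarrow> 0\<^sup>2"
      by (intro tendsto_power elim(1))
    ultimately show ?case using False by simp
  qed
qed

lemma mixLR_measurable: "mix q t \<in> borel_measurable (P j)"
  unfolding mixLR_def[abs_def] by (intro borel_measurable_sum borel_measurable_times borel_measurable_const LR_measurable) auto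

lemma mixLR_pos:
  assumes "good \<omega>" "pos_weight q" shows "0 < mix q t \<omega>"
  unfolding mixLR_def by (rule sum_pos) (use assms K LR_pos in auto)

lemma mix_passage_tendsto:
  assumes j: "j \<in> {1..K}" and q: "pos_weight q"
  shows "((\<lambda>c. \<integral>\<omega>. passage (\<lambda>t \<omega>. ln (mix q t \<omega>)) c \<omega> \<partial>P j) \<longlongrightarrow> gamma_up \<nu> f j) at_top"
proof -
  have jK: "j \<le> K" using j by simp
  interpret rw: random_walk "D j" "\<lambda>x. ln (f j x / f 0 x)" by (rule random_walk_up[OF j])
  define e where "e i = (of_bool (emeasure \<nu> {x \<in> space \<nu>. f i x \<noteq> f j x} = 0) :: real)" for i
  have "AE \<omega> in P j. \<forall>i\<in>{1..K}. (\<lambda>t. LR f i t \<omega> / LR f j t \<omega>) \<longlonglongrightarrow> e i"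
    unfolding e_def by (intro AE_finite_allI ratio_tendsto) (use jK in auto)
  then have "AE \<omega> in P j. (\<lambda>t. ln (mix q t \<omega>) - rw.S t \<omega>) \<longlonglongrightarrow> ln (\<Sum>i\<in>{1..K}. q i * e i)"
    using AE_good[OF jK]
  proof eventually_elim
    case (elim \<omega>)
    have "ln (mix q t \<omega>) - rw.S t \<omega> = ln (\<Sum>i\<in>{1..K}. q i * (LR f i t \<omega> / LR f j t \<omega>))" for t
    proof -
      have "rw.S t \<omega> = ln (LR f j t \<omega>)"
        using LLR_sum[OF elim(2) jK] by (simp add: rw.S_def LLR_def)
      then have "ln (mix q t \<omega>) - rw.S t \<omega> = ln (mix q t \<omega> / LR f j t \<omega>)"
        using mixLR_pos[OF elim(2) q, of t] LR_pos[OF elim(2) jK, of t] by (simp add: ln_div)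
      then show ?thesis by (simp add: mixLR_def sum_divide_distrib)
    qed
    moreover have "(\<lambda>t. ln (\<Sum>i\<in>{1..K}. q i * (LR f i t \<omega> / LR f j t \<omega>))) \<longlonglongrightarrow> ln (\<Sum>i\<in>{1..K}. q i * e i)"
    proof (intro tendsto_ln tendsto_sum tendsto_mult tendsto_const)
      show "(\<lambda>t. LR f i t \<omega> / LR f j t \<omega>) \<longlonglongrightarrow> e i" if "i \<in> {1..K}" for i using elim(1) that by blast
      \<comment> \<open>Since \<open>e j = 1\<close>, the term of index \<open>j\<close> keeps the
        limit inside the logarithm positive, so the perturbation has a finite limit.\<close>
      have "q j * e j \<le> (\<Sum>i\<in>{1..K}. q i * e i)"
        by (rule member_le_sum) (use j q in \<open>auto simp: e_def less_imp_le\<close>)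
      moreover have "0 < q j * e j" using j q by (simp add: e_def)
      ultimately show "(\<Sum>i\<in>{1..K}. q i * e i) \<noteq> 0" by linarith
    qed
    ultimately show ?case by simp
  qed
  then show ?thesis
    unfolding gamma_up_eq[OF j] P_eq
    by (intro rw.passage_perturbed_tendsto) (auto intro!: borel_measurable_ln mixLR_measurable[unfolded P_eq])
qed

text \<open>\<open>L\<close> is left open to serve for the mixture and the weighted maximum; both
  are asymptotically a multiple of the first likelihood ratio, which amounts to a constant shift of
  the walk.\<close>

lemma down_passage_tendsto:
  assumes L: "\<And>t. L t \<in> borel_measurable (P 0)" and pos: "\<And>t \<omega>. good \<omega> \<Longrightarrow> 0 < L t \<omega>"
    and a: "0 < a" and lim: "AE \<omega> in P 0. (\<lambda>t. L t \<omega> / LR f 1 t \<omega>) \<longlonglongrightarrow> a"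
  shows "((\<lambda>c. \<integral>\<omega>. passage (\<lambda>t \<omega>. - ln (L t \<omega>)) c \<omega> \<partial>P 0) \<longlongrightarrow> gamma_down \<nu> f 1) at_top"
proof -
  have 1: "1 \<in> {1..K}" using K by simp
  interpret rw: random_walk "D 0" "\<lambda>x. - ln (f 1 x / f 0 x)" by (rule random_walk_down[OF 1])
  have "AE \<omega> in P 0. (\<lambda>t. - ln (L t \<omega>) - rw.S t \<omega>) \<longlonglongrightarrow> - ln a"
    using lim AE_good[of 0, simplified]
  proof eventually_elim
    case (elim \<omega>)
    have "- ln (L t \<omega>) - rw.S t \<omega> = - ln (L t \<omega> / LR f 1 t \<omega>)" for t
    proof -
      have "rw.S t \<omega> = - ln (LR f 1 t \<omega>)"
        using LLR_sum[OF elim(2) K] by (simp add: rw.S_def LLR_def sum_negf del: One_nat_def)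
      then show ?thesis
        using pos[OF elim(2), of t] LR_pos[OF elim(2) K, of t] by (simp add: ln_div)
    qed
    moreover have "(\<lambda>t. - ln (L t \<omega> / LR f 1 t \<omega>)) \<longlonglongrightarrow> - ln a"
      by (intro tendsto_intros elim(1)) (use a in simp)
    ultimately show ?case by simp
  qed
  then show ?thesis
    unfolding gamma_down_eq[OF 1] P_eq
    by (intro rw.passage_perturbed_tendsto) (auto intro!: borel_measurable_ln borel_measurable_uminus L[unfolded P_eq])
qed

text \<open>Under the null law the logarithm of the inverse ratio is a walk whose drift is the
  difference of the two information numbers, positive by \<open>less\<close>.\<close>

lemma ratio_1_tendsto:
  assumes i: "i \<in> {1..K}" and less: "(\<integral>\<omega>. - LLR f 1 1 \<omega> \<partial>P 0) < (\<integral>\<omega>. - LLR f i 1 \<omega> \<partial>P 0)"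
  shows "AE \<omega> in P 0. (\<lambda>t. LR f i t \<omega> / LR f 1 t \<omega>) \<longlonglongrightarrow> 0"
proof -
  have iK: "i \<le> K" and 1: "1 \<in> {1..K}" using i K by auto
  interpret iid_seq "D 0" by (rule iid_D) simp
  have int: "integrable (D 0) (\<lambda>x. ln (f i x / f 0 x))" "integrable (D 0) (\<lambda>x. ln (f 1 x / f 0 x))"
    by (rule int_logratio[OF i], simp) (rule int_logratio[OF 1], simp)
  have "0 < (\<integral>x. ln (f 1 x / f 0 x) - ln (f i x / f 0 x) \<partial>D 0)"
    using less int integral_LLR_1[OF iK, of 0] integral_LLR_1[OF K, of 0] by simp
  then have "AE \<omega> in P 0. filterlim (\<lambda>n. \<Sum>k<n. ln (f 1 (\<omega> k) / f 0 (\<omega> k)) - ln (f i (\<omega> k) / f 0 (\<omega> k))) at_top sequentially"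
    unfolding P_eq by (intro partial_sums_at_top Bochner_Integration.integrable_diff int)
  then show ?thesis
    using AE_good[of 0, simplified]
  proof eventually_elim
    case (elim \<omega>)
    have "LR f i t \<omega> / LR f 1 t \<omega> = exp (- (\<Sum>k<t. ln (f 1 (\<omega> k) / f 0 (\<omega> k)) - ln (f i (\<omega> k) / f 0 (\<omega> k))))" for t
    proof -
      have "- (\<Sum>k<t. ln (f 1 (\<omega> k) / f 0 (\<omega> k)) - ln (f i (\<omega> k) / f 0 (\<omega> k))) = ln (LR f i t \<omega>) - ln (LR f 1 t \<omega>)"
        using LLR_sum[OF elim(2) iK, of t] LLR_sum[OF elim(2) K, of t] by (simp add: LLR_def sum_subtractf)
      then show ?thesis using LR_pos[OF elim(2) iK, of t] LR_pos[OF elim(2) K, of t] by (simp add: exp_diff)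
    qed
    moreover have "(\<lambda>t. exp (- (\<Sum>k<t. ln (f 1 (\<omega> k) / f 0 (\<omega> k)) - ln (f i (\<omega> k) / f 0 (\<omega> k))))) \<longlonglongrightarrow> 0"
      by (rule filterlim_compose[OF exp_at_bot], rule filterlim_compose[OF filterlim_uminus_at_bot_at_top elim(1)])
    ultimately show ?case by simp
  qed
qed

end

subsection \<open>Stopping rules\<close>

text \<open>Acceptance is split by the stopping time \<open>n\<close>, so that the change of measure
  can be done at each fixed \<open>n\<close>. If both boundaries are met at once, H1 is accepted;
  hence \<open>accept0_at\<close> demands that \<open>B\<close> is not reached.\<close>

definition accept1_at :: "(nat \<Rightarrow> 'w \<Rightarrow> real) \<Rightarrow> (nat \<Rightarrow> 'w \<Rightarrow> real) \<Rightarrow> real \<Rightarrow> real \<Rightarrow> nat \<Rightarrow> 'w \<Rightarrow> bool" where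
  "accept1_at L0 L1 A B n \<omega> \<longleftrightarrow> 1 \<le> n \<and> B \<le> L1 n \<omega>
     \<and> (\<forall>s. 1 \<le> s \<and> s < n \<longrightarrow> \<not> (B \<le> L1 s \<omega> \<or> L0 s \<omega> \<le> 1 / A))"

definition accept0_at :: "(nat \<Rightarrow> 'w \<Rightarrow> real) \<Rightarrow> (nat \<Rightarrow> 'w \<Rightarrow> real) \<Rightarrow> real \<Rightarrow> real \<Rightarrow> nat \<Rightarrow> 'w \<Rightarrow> bool" where
  "accept0_at L0 L1 A B n \<omega> \<longleftrightarrow> 1 \<le> n \<and> \<not> B \<le> L1 n \<omega> \<and> L0 n \<omega> \<le> 1 / A
     \<and> (\<forall>s. 1 \<le> s \<and> s < n \<longrightarrow> \<not> (B \<le> L1 s \<omega> \<or> L0 s \<omega> \<le> 1 / A))"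

lemma stop_time_eqI:
  assumes "1 \<le> n" "B \<le> L1 n \<omega> \<or> L0 n \<omega> \<le> 1 / A"
    "\<forall>s. 1 \<le> s \<and> s < n \<longrightarrow> \<not> (B \<le> L1 s \<omega> \<or> L0 s \<omega> \<le> 1 / A)"
  shows "stop_time L0 L1 A B \<omega> = n"
  unfolding stop_time_def using assms by (intro Least_equality) (auto simp: not_less[symmetric])

lemma stop_time:
  assumes "\<exists>t\<ge>1. B \<le> L1 t \<omega> \<or> L0 t \<omega> \<le> 1 / A"
  defines "n \<equiv> stop_time L0 L1 A B \<omega>"
  shows "1 \<le> n" "B \<le> L1 n \<omega> \<or> L0 n \<omega> \<le> 1 / A"
    "\<forall>s. 1 \<le> s \<and> s < n \<longrightarrow> \<not> (B \<le> L1 s \<omega> \<or> L0 s \<omega> \<le> 1 / A)"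
proof -
  have ex: "\<exists>t. 1 \<le> t \<and> (B \<le> L1 t \<omega> \<or> L0 t \<omega> \<le> 1 / A)" using assms(1) by blast
  show "1 \<le> n" "B \<le> L1 n \<omega> \<or> L0 n \<omega> \<le> 1 / A"
    using LeastI_ex[OF ex] unfolding n_def stop_time_def by blast+
  show "\<forall>s. 1 \<le> s \<and> s < n \<longrightarrow> \<not> (B \<le> L1 s \<omega> \<or> L0 s \<omega> \<le> 1 / A)"
    using not_less_Least[of _ "\<lambda>t. 1 \<le> t \<and> (B \<le> L1 t \<omega> \<or> L0 t \<omega> \<le> 1 / A)"]
    unfolding n_def stop_time_def by blast
qed

lemma accept1_eq: "accept1 M L0 L1 A B = {\<omega> \<in> space M. \<exists>n. accept1_at L0 L1 A B n \<omega>}"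
proof (intro set_eqI iffI)
  fix \<omega> assume "\<omega> \<in> accept1 M L0 L1 A B"
  then have ex: "\<exists>t\<ge>1. B \<le> L1 t \<omega> \<or> L0 t \<omega> \<le> 1 / A" and a: "\<omega> \<in> space M" "B \<le> L1 (stop_time L0 L1 A B \<omega>) \<omega>"
    by (auto simp: accept1_def)
  show "\<omega> \<in> {\<omega> \<in> space M. \<exists>n. accept1_at L0 L1 A B n \<omega>}"
    using stop_time[where B=B and \<omega>=\<omega> and ?L1.0=L1 and ?L0.0=L0 and A=A, OF ex] a unfolding accept1_at_def by blast
next
  fix \<omega> assume "\<omega> \<in> {\<omega> \<in> space M. \<exists>n. accept1_at L0 L1 A B n \<omega>}"
  then obtain n where n: "\<omega> \<in> space M" "accept1_at L0 L1 A B n \<omega>" by blast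
  then have "stop_time L0 L1 A B \<omega> = n" by (intro stop_time_eqI) (auto simp: accept1_at_def)
  then show "\<omega> \<in> accept1 M L0 L1 A B" using n by (auto simp: accept1_def accept1_at_def)
qed

lemma accept0_eq: "accept0 M L0 L1 A B = {\<omega> \<in> space M. \<exists>n. accept0_at L0 L1 A B n \<omega>}"
proof (intro set_eqI iffI)
  fix \<omega> assume "\<omega> \<in> accept0 M L0 L1 A B"
  then have ex: "\<exists>t\<ge>1. B \<le> L1 t \<omega> \<or> L0 t \<omega> \<le> 1 / A" and a: "\<omega> \<in> space M" "\<not> B \<le> L1 (stop_time L0 L1 A B \<omega>) \<omega>"
    by (auto simp: accept0_def)
  show "\<omega> \<in> {\<omega> \<in> space M. \<exists>n. accept0_at L0 L1 A B n \<omega>}"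
    using stop_time[where B=B and \<omega>=\<omega> and ?L1.0=L1 and ?L0.0=L0 and A=A, OF ex] a unfolding accept0_at_def by blast
next
  fix \<omega> assume "\<omega> \<in> {\<omega> \<in> space M. \<exists>n. accept0_at L0 L1 A B n \<omega>}"
  then obtain n where n: "\<omega> \<in> space M" "accept0_at L0 L1 A B n \<omega>" by blast
  then have "stop_time L0 L1 A B \<omega> = n" by (intro stop_time_eqI) (auto simp: accept0_at_def)
  then show "\<omega> \<in> accept0 M L0 L1 A B" using n by (auto simp: accept0_def accept0_at_def)
qed

text \<open>\<open>R n\<close> stands for stopping at time \<open>n\<close>. A series over
  \<open>n\<close> with factors \<open>of_bool (R n \<omega>)\<close> then has at most one nonzero
  term and represents a value at the stopping time, or 0 if there is no stopping.\<close>

definition exclusive :: "(nat \<Rightarrow> 'w \<Rightarrow> bool) \<Rightarrow> bool" where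
  "exclusive R \<longleftrightarrow> (\<forall>\<omega> m n. R m \<omega> \<longrightarrow> R n \<omega> \<longrightarrow> m = n)"

lemma exclusiveI:
  assumes "\<And>n \<omega>. R n \<omega> \<Longrightarrow> 1 \<le> n \<and> Q n \<omega>" "\<And>n s \<omega>. R n \<omega> \<Longrightarrow> 1 \<le> s \<Longrightarrow> s < n \<Longrightarrow> \<not> Q s \<omega>"
  shows "exclusive R"
  unfolding exclusive_def using assms by (metis linorder_neqE_nat)

lemma exclusive_accept1: "exclusive (accept1_at L0 L1 A B)"
  by (rule exclusiveI[where Q="\<lambda>n \<omega>. B \<le> L1 n \<omega> \<or> L0 n \<omega> \<le> 1 / A"]) (auto simp: accept1_at_def)

lemma exclusive_accept0: "exclusive (accept0_at L0 L1 A B)"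
  by (rule exclusiveI[where Q="\<lambda>n \<omega>. B \<le> L1 n \<omega> \<or> L0 n \<omega> \<le> 1 / A"]) (auto simp: accept0_at_def)

lemma suminf_exclusive:
  fixes a :: "nat \<Rightarrow> ennreal"
  assumes "exclusive R" "R n \<omega>"
  shows "(\<Sum>m. of_bool (R m \<omega>) * a m) = a n"
proof -
  have "(\<Sum>m. of_bool (R m \<omega>) * a m) = (\<Sum>m\<in>{n}. of_bool (R m \<omega>) * a m)"
    by (rule suminf_finite) (use assms in \<open>auto simp: exclusive_def\<close>)
  then show ?thesis using assms(2) by simp
qed

lemma passage_exp:
  assumes pos: "\<And>t. 0 < L t \<omega>" and B: "0 < B"
    and n: "1 \<le> n" "B \<le> L n \<omega>" "\<And>s. 1 \<le> s \<Longrightarrow> s < n \<Longrightarrow> \<not> B \<le> L s \<omega>"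
  shows "passage (\<lambda>t \<omega>. ln (L t \<omega>)) (ln B) \<omega> = B / L n \<omega>"
proof -
  have iff: "ln B \<le> ln (L t \<omega>) \<longleftrightarrow> B \<le> L t \<omega>" for t using pos B by simp
  have "(LEAST t. 1 \<le> t \<and> B \<le> L t \<omega>) = n"
    by (rule Least_equality) (use n in \<open>auto simp: not_less[symmetric]\<close>)
  then have "passage (\<lambda>t \<omega>. ln (L t \<omega>)) (ln B) \<omega> = exp (ln B - ln (L n \<omega>))"
    using n(1,2) unfolding passage_def iff by auto
  then show ?thesis using pos[of n] B by (simp add: exp_diff)
qed

lemma passage_none:
  assumes pos: "\<And>t. 0 < L t \<omega>" and B: "0 < B" and "\<not> (\<exists>t\<ge>1. B \<le> L t \<omega>)"
  shows "passage (\<lambda>t \<omega>. ln (L t \<omega>)) (ln B) \<omega> = 0"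
proof -
  have iff: "ln B \<le> ln (L t \<omega>) \<longleftrightarrow> B \<le> L t \<omega>" for t using pos B by simp
  show ?thesis using assms(3) unfolding passage_def iff by (rule if_not_P)
qed

lemma first_time:
  assumes "\<exists>t\<ge>1. Q t"
  obtains n :: nat where "1 \<le> n" "Q n" "\<And>s. 1 \<le> s \<Longrightarrow> s < n \<Longrightarrow> \<not> Q s"
proof -
  have ex: "\<exists>t. 1 \<le> t \<and> Q t" using assms by blast
  show thesis
    using that[of "LEAST t. 1 \<le> t \<and> Q t"] LeastI_ex[OF ex] not_less_Least[of _ "\<lambda>t. 1 \<le> t \<and> Q t"] by blast
qed

text \<open>Stated with the separate index \<open>s\<close> so that agreement of the first
  \<open>n\<close> observations gives equality at all times up to \<open>n\<close> in one
  go.\<close>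

definition adapted :: "(nat \<Rightarrow> (nat \<Rightarrow> 'x) \<Rightarrow> 'b) \<Rightarrow> bool" where
  "adapted L \<longleftrightarrow> (\<forall>n s \<omega> \<omega>'. (\<forall>k<n. \<omega> k = \<omega>' k) \<longrightarrow> s \<le> n \<longrightarrow> L s \<omega> = L s \<omega>')"

lemma adaptedD: "adapted L \<Longrightarrow> \<forall>k<n. \<omega> k = \<omega>' k \<Longrightarrow> s \<le> n \<Longrightarrow> L s \<omega> = L s \<omega>'"
  unfolding adapted_def by blast

lemma adapted_LR: "adapted (LR f i)"
  unfolding adapted_def LR_def by (intro allI impI prod.cong) auto

lemma adaptedI: "(\<And>n s \<omega> \<omega>'. \<forall>k<n. \<omega> k = \<omega>' k \<Longrightarrow> s \<le> n \<Longrightarrow> L s \<omega> = L s \<omega>') \<Longrightarrow> adapted L"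
  unfolding adapted_def by blast

lemma adapted_mixLR: "adapted (mixLR f K q)"
proof (rule adaptedI)
  fix n s and \<omega> \<omega>' :: "nat \<Rightarrow> 'a" assume a: "\<forall>k<n. \<omega> k = \<omega>' k" "s \<le> n"
  show "mixLR f K q s \<omega> = mixLR f K q s \<omega>'"
    unfolding mixLR_def using adaptedD[OF adapted_LR a, of f] by simp
qed

lemma adapted_maxLR: "adapted (maxLR f K q)"
proof (rule adaptedI)
  fix n s and \<omega> \<omega>' :: "nat \<Rightarrow> 'a" assume a: "\<forall>k<n. \<omega> k = \<omega>' k" "s \<le> n"
  show "maxLR f K q s \<omega> = maxLR f K q s \<omega>'"
    unfolding maxLR_def using adaptedD[OF adapted_LR a, of f] by simp
qed

lemma adapted_comp:
  assumes "adapted L0" "adapted L1" shows "adapted (\<lambda>s \<omega>. h (L0 s \<omega>) (L1 s \<omega>))"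
  by (rule adaptedI) (simp add: adaptedD[OF assms(1)] adaptedD[OF assms(2)])

lemma determined_first:
  assumes "adapted Q" "adapted Q'"
  shows "determined n (\<lambda>\<omega>. 1 \<le> n \<and> Q n \<omega> \<and> (\<forall>s. 1 \<le> s \<and> s < n \<longrightarrow> \<not> Q' s \<omega>))"
  unfolding determined_def
proof (intro allI impI)
  fix \<omega> \<omega>' :: "nat \<Rightarrow> 'a" assume eq: "\<forall>k<n. \<omega> k = \<omega>' k"
  have "Q n \<omega> = Q n \<omega>'" using adaptedD[OF assms(1) eq] by simp
  moreover have "Q' s \<omega> = Q' s \<omega>'" if "s < n" for s using adaptedD[OF assms(2) eq] that by simp
  ultimately show "(1 \<le> n \<and> Q n \<omega> \<and> (\<forall>s. 1 \<le> s \<and> s < n \<longrightarrow> \<not> Q' s \<omega>))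
    = (1 \<le> n \<and> Q n \<omega>' \<and> (\<forall>s. 1 \<le> s \<and> s < n \<longrightarrow> \<not> Q' s \<omega>'))" by auto
qed

lemma determined_accept:
  assumes "adapted L0" "adapted L1"
  shows "determined n (accept1_at L0 L1 A B n)" "determined n (accept0_at L0 L1 A B n)"
proof -
  note c = adapted_comp[OF assms]
  have Q': "adapted (\<lambda>s \<omega>. B \<le> L1 s \<omega> \<or> L0 s \<omega> \<le> 1 / A)" by (rule c)
  show "determined n (accept1_at L0 L1 A B n)"
    using determined_first[OF c[of "\<lambda>x y. B \<le> y"] Q'] by (simp only: accept1_at_def[abs_def])
  show "determined n (accept0_at L0 L1 A B n)"
    using determined_first[OF c[of "\<lambda>x y. \<not> B \<le> y \<and> x \<le> 1 / A"] Q'] by (simp only: accept0_at_def[abs_def] conj_assoc)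
qed

section \<open>Error probabilities as stopped expectations\<close>

context test_model
begin

lemma maxLR_measurable: "mx q t \<in> borel_measurable (P j)"
  unfolding maxLR_def[abs_def]
  by (intro borel_measurable_Max borel_measurable_times borel_measurable_const LR_measurable) (use K in auto)

lemma maxLR_ge: "i \<in> {1..K} \<Longrightarrow> q i * LR f i t \<omega> \<le> mx q t \<omega>"
  unfolding maxLR_def by (rule Max_ge) auto

lemma mixLR_ge: "i \<in> {1..K} \<Longrightarrow> pos_weight q \<Longrightarrow> q i * LR f i t \<omega> \<le> mix q t \<omega>"
  unfolding mixLR_def by (rule member_le_sum) (auto intro!: mult_nonneg_nonneg LR_nonneg simp: less_imp_le)

lemma maxLR_le_mixLR:
  assumes "pos_weight q" shows "mx q t \<omega> \<le> mix q t \<omega>"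
  unfolding maxLR_def by (rule Max.boundedI) (use assms mixLR_ge K in auto)

text \<open>Wald's likelihood ratio identity, one time at a time. In its uses \<open>h n\<close> is
  a payoff on the event of stopping at \<open>n\<close>, so paths that never stop contribute nothing
  to either side.\<close>

lemma change_of_measure:
  fixes h :: "nat \<Rightarrow> (nat \<Rightarrow> 'x) \<Rightarrow> ennreal"
  assumes i: "i \<le> K" and h [measurable]: "\<And>n. h n \<in> borel_measurable (P 0)" and det: "\<And>n. determined n (h n)"
  shows "(\<integral>\<^sup>+\<omega>. (\<Sum>n. h n \<omega>) \<partial>P i) = (\<integral>\<^sup>+\<omega>. (\<Sum>n. h n \<omega> * ennreal (LR f i n \<omega>)) \<partial>P 0)"
proof -
  note [measurable] = LR_measurable[OF i, of _ 0]
  have hi [measurable]: "h n \<in> borel_measurable (P i)" for n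
    using h measurable_cong_sets[OF sets_P refl] by blast
  have "(\<integral>\<^sup>+\<omega>. h n \<omega> \<partial>P i) = (\<integral>\<^sup>+\<omega>. h n \<omega> * ennreal (LR f i n \<omega>) \<partial>P 0)" for n
  proof -
    have "(\<integral>\<^sup>+\<omega>. h n \<omega> \<partial>PiM UNIV (\<lambda>_::nat. density (D 0) (\<lambda>x. ennreal (f i x / f 0 x))))
      = (\<integral>\<^sup>+\<omega>. h n \<omega> * (\<Prod>k<n. ennreal (f i (\<omega> k) / f 0 (\<omega> k))) \<partial>PiM UNIV (\<lambda>_::nat. D 0))"
    proof (rule nn_integral_PiM_density)
      show "prob_space (D 0)" by (rule prob_D) simp
      show "prob_space (density (D 0) (\<lambda>x. ennreal (f i x / f 0 x)))"
        unfolding D_density[OF i, symmetric] by (rule prob_D[OF i])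
      show "(\<lambda>x. ennreal (f i x / f 0 x)) \<in> borel_measurable (D 0)"
        using f_meas_D[OF i, of 0] f_meas_D[of 0 0] by measurable
      show "h n \<in> borel_measurable (PiM UNIV (\<lambda>_::nat. D 0))" using h[of n] unfolding P_eq .
    qed (rule det)
    moreover have "(\<Prod>k<n. ennreal (f i (\<omega> k) / f 0 (\<omega> k))) = ennreal (LR f i n \<omega>)" for \<omega>
      unfolding LR_def by (rule prod_ennreal) (use f_nonneg[OF i] f_nonneg[of 0] in auto)
    ultimately show ?thesis unfolding P_eq D_density[OF i, symmetric] by simp
  qed
  then show ?thesis by (simp add: nn_integral_suminf)
qed

lemma measurable_event:
  fixes R :: "nat \<Rightarrow> (nat \<Rightarrow> 'x) \<Rightarrow> bool"
  assumes "\<And>n. Measurable.pred (P 0) (R n)"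
  shows "{\<omega> \<in> space (P j). \<exists>n. R n \<omega>} \<in> sets (P j)"
proof -
  have "{\<omega> \<in> space (P 0). \<exists>n. R n \<omega>} = (\<Union>n. {\<omega> \<in> space (P 0). R n \<omega>})" by auto
  also have "\<dots> \<in> sets (P 0)" using assms by (auto simp: pred_def)
  finally have "{\<omega> \<in> space (P 0). \<exists>n. R n \<omega>} \<in> sets (P 0)" .
  then show ?thesis using sets_P[of 0 j] space_P[of 0 j] by simp
qed

lemma emeasure_event:
  assumes j: "j \<le> K" and R: "exclusive R" "\<And>n. Measurable.pred (P 0) (R n)"
  shows "(\<integral>\<^sup>+\<omega>. (\<Sum>n. of_bool (R n \<omega>) * a) \<partial>P j) = a * ennreal (pr j R)"
proof -
  interpret prob_space "P j" by (rule prob_P[OF j])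
  have "(\<integral>\<^sup>+\<omega>. (\<Sum>n. of_bool (R n \<omega>) * a) \<partial>P j) = (\<integral>\<^sup>+\<omega>. a * indicator {\<omega> \<in> space (P j). \<exists>n. R n \<omega>} \<omega> \<partial>P j)"
  proof (rule nn_integral_cong)
    fix \<omega> assume sp: "\<omega> \<in> space (P j)"
    show "(\<Sum>n. of_bool (R n \<omega>) * a) = a * indicator {\<omega> \<in> space (P j). \<exists>n. R n \<omega>} \<omega>"
    proof (cases "\<exists>n. R n \<omega>")
      case True
      then obtain n where n: "R n \<omega>" by blast
      have "indicator {\<omega> \<in> space (P j). \<exists>n. R n \<omega>} \<omega> = (1 :: ennreal)"
        by (rule indicator_simps(1)) (use sp n in auto)
      then show ?thesis unfolding suminf_exclusive[where R=R and a="\<lambda>_. a", OF R(1) n] by simp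
    next
      case False
      then show ?thesis by simp
    qed
  qed
  also have "\<dots> = a * emeasure (P j) {\<omega> \<in> space (P j). \<exists>n. R n \<omega>}"
    by (rule nn_integral_cmult_indicator[OF measurable_event[OF R(2)]])
  finally show ?thesis by (simp add: emeasure_eq_measure)
qed

lemma measurable_of_bool_mult:
  assumes [measurable]: "Measurable.pred M Q" "g \<in> borel_measurable M"
  shows "(\<lambda>\<omega>. of_bool (Q \<omega>) * g \<omega> :: ennreal) \<in> borel_measurable M"
proof -
  have "(\<lambda>\<omega>. of_bool (Q \<omega>) * g \<omega>) = (\<lambda>\<omega>. if Q \<omega> then g \<omega> else 0)" by auto
  then show ?thesis by simp
qed

lemma determined_mult:
  fixes R :: "(nat \<Rightarrow> 'c) \<Rightarrow> bool"
  assumes "determined n R" "determined n g"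
  shows "determined n (\<lambda>\<omega>. of_bool (R \<omega>) * g \<omega> :: ennreal)"
  unfolding determined_def
proof (intro allI impI)
  fix \<omega> \<omega>' assume eq: "\<forall>k<n. \<omega> k = (\<omega>' k :: 'c)"
  have "R \<omega> = R \<omega>'" "g \<omega> = g \<omega>'" using assms eq unfolding determined_def by blast+
  then show "of_bool (R \<omega>) * g \<omega> = of_bool (R \<omega>') * g \<omega>'" by simp
qed

text \<open>The weighted sum of the alternatives is a single measure whose likelihood with respect
  to the null law, at the stopping time, is the mixture.\<close>

lemma mix_stopped:
  assumes q: "pos_weight q"
    and R: "exclusive R" "\<And>n. Measurable.pred (P 0) (R n)" "\<And>n. determined n (R n)"
    and g: "\<And>n. g n \<in> borel_measurable (P 0)" "\<And>n. determined n (g n)"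
  shows "(\<Sum>j\<in>{1..K}. ennreal (q j) * (\<integral>\<^sup>+\<omega>. (\<Sum>n. of_bool (R n \<omega>) * g n \<omega>) \<partial>P j))
    = (\<integral>\<^sup>+\<omega>. (\<Sum>n. of_bool (R n \<omega>) * (g n \<omega> * ennreal (mix q n \<omega>))) \<partial>P 0)"
proof -
  note [measurable] = R(2) g(1) LR_measurable[of _ _ 0]
  have "(\<Sum>j\<in>{1..K}. ennreal (q j) * (\<integral>\<^sup>+\<omega>. (\<Sum>n. of_bool (R n \<omega>) * g n \<omega>) \<partial>P j))
    = (\<Sum>j\<in>{1..K}. ennreal (q j) * (\<integral>\<^sup>+\<omega>. (\<Sum>n. of_bool (R n \<omega>) * g n \<omega> * ennreal (LR f j n \<omega>)) \<partial>P 0))"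
    by (intro sum.cong refl arg_cong2[where f="(*)"] change_of_measure measurable_of_bool_mult determined_mult R g) auto
  also have "\<dots> = (\<integral>\<^sup>+\<omega>. (\<Sum>j\<in>{1..K}. ennreal (q j) * (\<Sum>n. of_bool (R n \<omega>) * g n \<omega> * ennreal (LR f j n \<omega>))) \<partial>P 0)"
    by (subst nn_integral_sum)
      (auto intro!: sum.cong nn_integral_cmult[symmetric] borel_measurable_times borel_measurable_const borel_measurable_suminf_order
        measurable_of_bool_mult measurable_compose[OF _ measurable_ennreal])
  also have "\<dots> = (\<integral>\<^sup>+\<omega>. (\<Sum>n. of_bool (R n \<omega>) * (g n \<omega> * ennreal (mix q n \<omega>))) \<partial>P 0)"
  proof (rule nn_integral_cong)
    fix \<omega>
    show "(\<Sum>j\<in>{1..K}. ennreal (q j) * (\<Sum>n. of_bool (R n \<omega>) * g n \<omega> * ennreal (LR f j n \<omega>)))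
      = (\<Sum>n. of_bool (R n \<omega>) * (g n \<omega> * ennreal (mix q n \<omega>)))"
    proof (cases "\<exists>n. R n \<omega>")
      case True
      then obtain n where n: "R n \<omega>" by blast
      have "ennreal (mix q n \<omega>) = (\<Sum>j\<in>{1..K}. ennreal (q j * LR f j n \<omega>))"
        unfolding mixLR_def by (rule sum_ennreal[symmetric]) (use q in \<open>auto intro!: mult_nonneg_nonneg LR_nonneg simp: less_imp_le\<close>)
      also have "\<dots> = (\<Sum>j\<in>{1..K}. ennreal (q j) * ennreal (LR f j n \<omega>))"
        by (intro sum.cong refl ennreal_mult) (use q in \<open>auto intro!: LR_nonneg simp: less_imp_le\<close>)
      finally have mix: "ennreal (mix q n \<omega>) = (\<Sum>j\<in>{1..K}. ennreal (q j) * ennreal (LR f j n \<omega>))" .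
      have "(\<Sum>n. of_bool (R n \<omega>) * g n \<omega> * ennreal (LR f j n \<omega>)) = g n \<omega> * ennreal (LR f j n \<omega>)" for j
        using suminf_exclusive[where R=R and a="\<lambda>n. g n \<omega> * ennreal (LR f j n \<omega>)", OF R(1) n] by (simp only: mult.assoc)
      then show ?thesis
        unfolding suminf_exclusive[where R=R and a="\<lambda>n. g n \<omega> * ennreal (mix q n \<omega>)", OF R(1) n] mix
        by (simp add: sum_distrib_left mult_ac)
    qed simp
  qed
  finally show ?thesis .
qed

text \<open>On the event the stopped mixture likelihood is at least \<open>B\<close>. The
  probabilities under the alternatives are kept rather than bounded by 1, because
  \<open>hit_le_accept1\<close> needs them to be small.\<close>

lemma P0_event_le:
  assumes q: "pos_weight q" and B: "0 \<le> B"
    and R: "exclusive R" "\<And>n. Measurable.pred (P 0) (R n)" "\<And>n. determined n (R n)"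
    and le: "\<And>n \<omega>. R n \<omega> \<Longrightarrow> B \<le> mix q n \<omega>"
  shows "B * pr 0 R
    \<le> (\<Sum>j\<in>{1..K}. q j * pr j R)"
proof -
  have "ennreal B * ennreal (pr 0 R) = (\<integral>\<^sup>+\<omega>. (\<Sum>n. of_bool (R n \<omega>) * ennreal B) \<partial>P 0)"
    by (rule emeasure_event[OF _ R(1,2), symmetric]) simp
  also have "\<dots> \<le> (\<integral>\<^sup>+\<omega>. (\<Sum>n. of_bool (R n \<omega>) * (1 * ennreal (mix q n \<omega>))) \<partial>P 0)"
    by (intro nn_integral_mono suminf_le) (auto intro!: ennreal_leI le simp: of_bool_def)
  also have "\<dots> = (\<Sum>j\<in>{1..K}. ennreal (q j) * (\<integral>\<^sup>+\<omega>. (\<Sum>n. of_bool (R n \<omega>) * 1) \<partial>P j))"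
    by (rule mix_stopped[OF q R, symmetric]) (auto simp: determined_def)
  also have "\<dots> = (\<Sum>j\<in>{1..K}. ennreal (q j) * ennreal (pr j R))"
    by (intro sum.cong refl arg_cong2[where f="(*)"]) (subst emeasure_event[OF _ R(1,2)], auto)
  also have "\<dots> = ennreal (\<Sum>j\<in>{1..K}. q j * pr j R)"
    by (subst sum_ennreal[symmetric]) (use q in \<open>auto intro!: sum.cong ennreal_mult[symmetric] mult_nonneg_nonneg simp: less_imp_le\<close>)
  finally have "ennreal (B * pr 0 R)
      \<le> ennreal (\<Sum>j\<in>{1..K}. q j * pr j R)"
    using B by (subst ennreal_mult) auto
  moreover have "0 \<le> (\<Sum>j\<in>{1..K}. q j * pr j R)"
    using q by (intro sum_nonneg mult_nonneg_nonneg) (auto simp: less_imp_le)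
  ultimately show ?thesis by (simp only: ennreal_le_iff)
qed

text \<open>Dual to \<open>P0_event_le\<close>: after the change of measure the stopped ratio
  contributes at most \<open>b\<close> on the event, whose null probability is at most 1.\<close>

lemma Pi_event_le:
  assumes i: "i \<le> K" and a: "0 \<le> a" "0 \<le> b"
    and R: "exclusive R" "\<And>n. Measurable.pred (P 0) (R n)" "\<And>n. determined n (R n)"
    and le: "\<And>n \<omega>. R n \<omega> \<Longrightarrow> a * LR f i n \<omega> \<le> b"
  shows "a * pr i R \<le> b"
proof -
  interpret P0: prob_space "P 0" by (rule prob_P) simp
  have "ennreal a * ennreal (pr i R) = (\<integral>\<^sup>+\<omega>. (\<Sum>n. of_bool (R n \<omega>) * ennreal a) \<partial>P i)"
    by (rule emeasure_event[OF i R(1,2), symmetric])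
  also have "\<dots> = (\<integral>\<^sup>+\<omega>. (\<Sum>n. of_bool (R n \<omega>) * ennreal a * ennreal (LR f i n \<omega>)) \<partial>P 0)"
    by (intro change_of_measure[OF i] measurable_of_bool_mult R determined_mult) (auto simp: determined_def)
  also have "\<dots> \<le> (\<integral>\<^sup>+\<omega>. (\<Sum>n. of_bool (R n \<omega>) * ennreal b) \<partial>P 0)"
  proof (intro nn_integral_mono suminf_le)
    fix \<omega> n
    show "of_bool (R n \<omega>) * ennreal a * ennreal (LR f i n \<omega>) \<le> of_bool (R n \<omega>) * ennreal b"
      using le[of n \<omega>] a LR_nonneg[OF i, of n \<omega>] by (cases "R n \<omega>") (auto simp flip: ennreal_mult intro: ennreal_leI)
  qed auto
  also have "\<dots> = ennreal b * ennreal (pr 0 R)"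
    by (rule emeasure_event[OF _ R(1,2)]) simp
  also have "\<dots> \<le> ennreal b * ennreal 1" by (intro mult_left_mono ennreal_leI) auto
  finally show ?thesis
    using a by (subst (asm) ennreal_mult[symmetric]) (auto simp: ennreal_le_iff)
qed

lemma measurable_accept:
  assumes [measurable]: "\<And>t. L0 t \<in> borel_measurable M" "\<And>t. L1 t \<in> borel_measurable M"
  shows "Measurable.pred M (accept1_at L0 L1 A B n)" "Measurable.pred M (accept0_at L0 L1 A B n)"
  unfolding accept1_at_def accept0_at_def by measurable

lemma accept1_bound:
  assumes q: "pos_weight q" and B: "0 < B"
    and L: "\<And>t. L0 t \<in> borel_measurable (P 0)" "\<And>t. L1 t \<in> borel_measurable (P 0)" "adapted L0" "adapted L1"
    and le: "\<And>t \<omega>. L1 t \<omega> \<le> mix q t \<omega>"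
  shows "measure (P 0) (accept1 (P 0) L0 L1 A B) \<le> (\<Sum>i\<in>{1..K}. q i) / B"
proof -
  have "B * pr 0 (accept1_at L0 L1 A B)
    \<le> (\<Sum>j\<in>{1..K}. q j * pr j (accept1_at L0 L1 A B))"
    using B by (intro P0_event_le q exclusive_accept1 measurable_accept determined_accept L) (auto simp: accept1_at_def intro: order_trans[OF _ le])
  also have "\<dots> \<le> (\<Sum>j\<in>{1..K}. q j * 1)"
    by (intro sum_mono mult_left_mono prob_space.prob_le_1 prob_P) (use q in \<open>auto intro: less_imp_le\<close>)
  finally show ?thesis using B by (simp add: accept1_eq pos_le_divide_eq mult.commute)
qed

lemma accept0_bound:
  assumes i: "i \<in> {1..K}" and q: "0 < q" and A: "0 < A"
    and L: "\<And>t. L0 t \<in> borel_measurable (P 0)" "\<And>t. L1 t \<in> borel_measurable (P 0)" "adapted L0" "adapted L1"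
    and le: "\<And>t \<omega>. q * LR f i t \<omega> \<le> L0 t \<omega>"
  shows "measure (P i) (accept0 (P i) L0 L1 A B) \<le> 1 / (A * q)"
proof -
  have "q * pr i (accept0_at L0 L1 A B) \<le> 1 / A"
    using i q A by (intro Pi_event_le exclusive_accept0 measurable_accept determined_accept L) (auto simp: accept0_at_def intro: order_trans[OF le])
  then show ?thesis using q A by (simp add: accept0_eq field_simps)
qed

section \<open>The one-sided mixture rule and acceptance of H1\<close>

text \<open>First passage of the mixture over \<open>B\<close> with the lower boundary removed; its
  null probability has an exact formula, and the two-sided tests are compared with it.\<close>

definition hits :: "(nat \<Rightarrow> real) \<Rightarrow> real \<Rightarrow> nat \<Rightarrow> (nat \<Rightarrow> 'x) \<Rightarrow> bool" where
  "hits q B n \<omega> \<longleftrightarrow> 1 \<le> n \<and> B \<le> mix q n \<omega> \<and> (\<forall>s. 1 \<le> s \<and> s < n \<longrightarrow> \<not> B \<le> mix q s \<omega>)"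

lemma ex_hits: "(\<exists>n. hits q B n \<omega>) \<longleftrightarrow> (\<exists>t\<ge>1. B \<le> mix q t \<omega>)"
proof
  assume "\<exists>t\<ge>1. B \<le> mix q t \<omega>"
  then obtain n where "1 \<le> n" "B \<le> mix q n \<omega>" "\<And>s. 1 \<le> s \<Longrightarrow> s < n \<Longrightarrow> \<not> B \<le> mix q s \<omega>"
    by (rule first_time[where Q="\<lambda>t. B \<le> mix q t \<omega>"]) blast
  then show "\<exists>n. hits q B n \<omega>" unfolding hits_def by blast
qed (auto simp: hits_def)

lemma exclusive_hits: "exclusive (hits q B)"
  by (rule exclusiveI[where Q="\<lambda>n \<omega>. B \<le> mix q n \<omega>"]) (auto simp: hits_def)

lemma measurable_hits: "Measurable.pred (P j) (hits q B n)"
proof -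
  note [measurable] = mixLR_measurable[of q _ j]
  show ?thesis unfolding hits_def by measurable
qed

lemma determined_hits: "determined n (hits q B n)"
  using adapted_comp[OF adapted_mixLR adapted_mixLR, of "\<lambda>x y. B \<le> y"]
  unfolding hits_def[abs_def] by (intro determined_first)

text \<open>The payoff \<open>B / mix q n\<close> at the hitting time is the value of
  \<open>passage\<close>. Weighted and summed over the alternatives, its means become one mean under
  the null law in which \<open>mix q n\<close> cancels and \<open>B\<close> is left on the event of
  hitting.\<close>

lemma hit_probability:
  assumes q: "pos_weight q" and B: "1 < B"
  shows "B * pr 0 (hits q B)
    = (\<Sum>j\<in>{1..K}. q j * (\<integral>\<omega>. passage (\<lambda>t \<omega>. ln (mix q t \<omega>)) (ln B) \<omega> \<partial>P j))"
proof -
  let ?p = "passage (\<lambda>t \<omega>. ln (mix q t \<omega>)) (ln B)"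
  note [measurable] = mixLR_measurable[of q _ 0]
  have E: "(\<integral>\<^sup>+\<omega>. (\<Sum>n. of_bool (hits q B n \<omega>) * ennreal (B / mix q n \<omega>)) \<partial>P j) = ennreal (\<integral>\<omega>. ?p \<omega> \<partial>P j)"
    if j: "j \<in> {1..K}" for j
  proof -
    have jK: "j \<le> K" using j by simp
    interpret prob_space "P j" by (rule prob_P[OF jK])
    note [measurable] = mixLR_measurable[of q _ j]
    have "(\<integral>\<^sup>+\<omega>. (\<Sum>n. of_bool (hits q B n \<omega>) * ennreal (B / mix q n \<omega>)) \<partial>P j) = (\<integral>\<^sup>+\<omega>. ennreal (?p \<omega>) \<partial>P j)"
    proof (rule nn_integral_cong_AE)
      show "AE \<omega> in P j. (\<Sum>n. of_bool (hits q B n \<omega>) * ennreal (B / mix q n \<omega>)) = ennreal (?p \<omega>)"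
        using AE_good[OF jK]
      proof eventually_elim
        case (elim \<omega>)
        note pos = mixLR_pos[OF elim q]
        show ?case
        proof (cases "\<exists>n. hits q B n \<omega>")
          case True
          then obtain n where n: "hits q B n \<omega>" by blast
          then have "?p \<omega> = B / mix q n \<omega>"
            using B by (intro passage_exp pos) (auto simp: hits_def)
          then show ?thesis using suminf_exclusive[where R="hits q B", OF exclusive_hits n] by simp
        next
          case False
          then have "?p \<omega> = 0" using B pos unfolding ex_hits by (intro passage_none) auto
          then show ?thesis using False by simp
        qed
      qed
    qed
    also have "\<dots> = ennreal (\<integral>\<omega>. ?p \<omega> \<partial>P j)"
    proof (rule nn_integral_eq_integral)
      show "integrable (P j) ?p"
        by (rule integrable_const_bound[where B=1]) (auto simp: passage_01)
    qed (simp add: passage_01)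
    finally show ?thesis .
  qed
  have pos_int: "0 \<le> (\<integral>\<omega>. ?p \<omega> \<partial>P j)" for j by (rule integral_nonneg_AE) (simp add: passage_01)
  have "(\<Sum>j\<in>{1..K}. ennreal (q j) * ennreal (\<integral>\<omega>. ?p \<omega> \<partial>P j))
    = (\<Sum>j\<in>{1..K}. ennreal (q j) * (\<integral>\<^sup>+\<omega>. (\<Sum>n. of_bool (hits q B n \<omega>) * ennreal (B / mix q n \<omega>)) \<partial>P j))"
    by (intro sum.cong refl) (simp add: E)
  also have "\<dots> = (\<integral>\<^sup>+\<omega>. (\<Sum>n. of_bool (hits q B n \<omega>) * (ennreal (B / mix q n \<omega>) * ennreal (mix q n \<omega>))) \<partial>P 0)"
    using adaptedD[OF adapted_mixLR[of f K q]]
    by (intro mix_stopped q exclusive_hits measurable_hits determined_hits)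
      (measurable, auto simp: determined_def)
  also have "\<dots> = (\<integral>\<^sup>+\<omega>. (\<Sum>n. of_bool (hits q B n \<omega>) * ennreal B) \<partial>P 0)"
  proof (intro nn_integral_cong suminf_cong)
    fix \<omega> n
    have "ennreal (B / mix q n \<omega>) * ennreal (mix q n \<omega>) = ennreal B" if "hits q B n \<omega>"
    proof -
      have "0 < mix q n \<omega>" using that B by (auto simp: hits_def)
      then show ?thesis using B by (simp flip: ennreal_mult)
    qed
    then show "of_bool (hits q B n \<omega>) * (ennreal (B / mix q n \<omega>) * ennreal (mix q n \<omega>)) = of_bool (hits q B n \<omega>) * ennreal B"
      by (cases "hits q B n \<omega>") auto
  qed
  also have "\<dots> = ennreal B * ennreal (pr 0 (hits q B))"
    by (rule emeasure_event[OF _ exclusive_hits measurable_hits]) simp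
  finally have "ennreal (\<Sum>j\<in>{1..K}. q j * (\<integral>\<omega>. ?p \<omega> \<partial>P j)) = ennreal (B * pr 0 (hits q B))"
    using q B pos_int by (subst sum_ennreal[symmetric]) (auto simp: ennreal_mult less_imp_le intro!: mult_nonneg_nonneg)
  then show ?thesis
    using q B pos_int by (subst (asm) ennreal_inj) (auto intro!: sum_nonneg mult_nonneg_nonneg simp: less_imp_le)
qed

lemma hit_probability_tendsto:
  assumes q: "pos_weight q"
  shows "((\<lambda>B. B * pr 0 (hits q B)) \<longlongrightarrow> (\<Sum>j\<in>{1..K}. q j * gamma_up \<nu> f j)) at_top"
proof -
  have "((\<lambda>B. \<Sum>j\<in>{1..K}. q j * (\<integral>\<omega>. passage (\<lambda>t \<omega>. ln (mix q t \<omega>)) (ln B) \<omega> \<partial>P j)) \<longlongrightarrow> (\<Sum>j\<in>{1..K}. q j * gamma_up \<nu> f j)) at_top"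
    by (intro tendsto_sum tendsto_mult tendsto_const filterlim_compose[OF mix_passage_tendsto ln_at_top] q)
  moreover have "\<forall>\<^sub>F B in at_top. (\<Sum>j\<in>{1..K}. q j * (\<integral>\<omega>. passage (\<lambda>t \<omega>. ln (mix q t \<omega>)) (ln B) \<omega> \<partial>P j))
    = B * pr 0 (hits q B)"
    using eventually_gt_at_top[of 1] by eventually_elim (simp add: hit_probability[OF q])
  ultimately show ?thesis by (rule Lim_transform_eventually)
qed

text \<open>Acceptance of H1 forces the mixture to be at least \<open>B\<close> at the stopping
  time, since the statistic lies below the mixture.\<close>

lemma accept1_le_hit:
  assumes q: "pos_weight q" and le: "\<And>t \<omega>. L1 t \<omega> \<le> mix q t \<omega>"
  shows "measure (P 0) (accept1 (P 0) L0 L1 A B) \<le> pr 0 (hits q B)"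
proof -
  interpret prob_space "P 0" by (rule prob_P) simp
  show ?thesis
  proof (rule finite_measure_mono)
    show "accept1 (P 0) L0 L1 A B \<subseteq> {\<omega> \<in> space (P 0). \<exists>n. hits q B n \<omega>}"
      unfolding accept1_eq ex_hits using order_trans[OF _ le] by (auto simp: accept1_at_def)
    show "{\<omega> \<in> space (P 0). \<exists>n. hits q B n \<omega>} \<in> events" by (rule measurable_event[OF measurable_hits])
  qed
qed

text \<open>If the mixture with \<open>q1\<close> reaches \<open>B\<close> but the test does not
  stop with H1 at that time, the mixture with \<open>q0\<close> fell to \<open>1 / A\<close>
  strictly earlier. Multiplied by \<open>B\<close>, the null probability of this is at most a
  weighted sum of its probabilities under the alternatives, each of order
  \<open>1 / A\<close>.\<close>

lemma hit_le_accept1: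
  assumes q0: "pos_weight q0" and q1: "pos_weight q1" and A: "0 < A" and B: "0 < B"
  shows "B * pr 0 (hits q1 B)
    \<le> B * measure (P 0) (accept1 (P 0) (mix q0) (mix q1) A B) + (\<Sum>j\<in>{1..K}. q1 j / q0 j) / A"
proof -
  define R where "R n \<omega> \<longleftrightarrow> hits q1 B n \<omega> \<and> (\<exists>s. 1 \<le> s \<and> s < n \<and> mix q0 s \<omega> \<le> 1 / A)" for n \<omega>
  define Q where "Q n \<omega> \<longleftrightarrow> 1 \<le> n \<and> mix q0 n \<omega> \<le> 1 / A \<and> (\<forall>s. 1 \<le> s \<and> s < n \<longrightarrow> \<not> mix q0 s \<omega> \<le> 1 / A)" for n \<omega>
  interpret P0: prob_space "P 0" by (rule prob_P) simp
  note [measurable] = mixLR_measurable[of _ _ 0] measurable_hits[where j=0]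
  have R_meas: "Measurable.pred (P 0) (R n)" for n unfolding R_def by measurable
  have Q_meas: "Measurable.pred (P 0) (Q n)" for n unfolding Q_def by measurable
  have R_ex: "exclusive R" using exclusive_hits unfolding exclusive_def R_def by blast
  have Q_ex: "exclusive Q"
    by (rule exclusiveI[where Q="\<lambda>n \<omega>. mix q0 n \<omega> \<le> 1 / A"]) (auto simp: Q_def)
  have R_det: "determined n (R n)" for n
  proof -
    have "R n \<omega> = R n \<omega>'" if eq: "\<forall>k<n. \<omega> k = \<omega>' k" for \<omega> \<omega>'
    proof -
      have "hits q1 B n \<omega> = hits q1 B n \<omega>'" using determined_hits eq unfolding determined_def by blast
      moreover have "mix q0 s \<omega> = mix q0 s \<omega>'" if "s < n" for s
        using adaptedD[OF adapted_mixLR eq] that by simp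
      ultimately show ?thesis unfolding R_def by auto
    qed
    then show ?thesis unfolding determined_def by blast
  qed
  have Q_det: "determined n (Q n)" for n
    using adapted_comp[OF adapted_mixLR adapted_mixLR, of "\<lambda>x y. y \<le> 1 / A"]
    unfolding Q_def[abs_def] by (intro determined_first)
  \<comment> \<open>\<open>R\<close> implies that the first descent \<open>Q\<close> of the
    \<open>q0\<close>-mixture to \<open>1 / A\<close> occurs, and at that time
    \<open>q0 j * LR f j\<close> is at most \<open>1 / A\<close> as well.\<close>
  have QP: "q1 j * pr j R \<le> q1 j / q0 j / A" if j: "j \<in> {1..K}" for j
  proof -
    have jK: "j \<le> K" using j by simp
    interpret Pj: prob_space "P j" by (rule prob_P[OF jK])
    have "q0 j * pr j Q \<le> 1 / A"
      using q0 j A by (intro Pi_event_le jK Q_ex Q_meas Q_det)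
        (auto simp: Q_def less_imp_le intro: order_trans[OF mixLR_ge])
    moreover have "pr j R \<le> pr j Q"
    proof (rule Pj.finite_measure_mono)
      show "{\<omega> \<in> space (P j). \<exists>n. R n \<omega>} \<subseteq> {\<omega> \<in> space (P j). \<exists>n. Q n \<omega>}"
      proof safe
        fix \<omega> n assume "R n \<omega>"
        then have "\<exists>s\<ge>1. mix q0 s \<omega> \<le> 1 / A" by (auto simp: R_def)
        then obtain m where "1 \<le> m" "mix q0 m \<omega> \<le> 1 / A" "\<And>s. 1 \<le> s \<Longrightarrow> s < m \<Longrightarrow> \<not> mix q0 s \<omega> \<le> 1 / A"
          by (rule first_time[where Q="\<lambda>t. mix q0 t \<omega> \<le> 1 / A"]) blast
        then show "\<exists>n. Q n \<omega>" unfolding Q_def by blast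
      qed
    qed (rule measurable_event[OF Q_meas])
    ultimately have "q0 j * pr j R \<le> 1 / A"
      using q0 j by (meson less_imp_le mult_left_mono order_trans)
    then have "pr j R \<le> 1 / q0 j / A"
      using q0 j A by (simp add: field_simps)
    then have "q1 j * pr j R \<le> q1 j * (1 / q0 j / A)"
      using q1 j by (intro mult_left_mono) (auto simp: less_imp_le)
    then show ?thesis by simp
  qed
  have m1: "accept1 (P 0) (mix q0) (mix q1) A B \<in> P0.events"
    unfolding accept1_eq by (intro measurable_event measurable_accept mixLR_measurable)
  have m2: "{\<omega> \<in> space (P 0). \<exists>n. R n \<omega>} \<in> P0.events" by (rule measurable_event[OF R_meas])
  have "{\<omega> \<in> space (P 0). \<exists>n. hits q1 B n \<omega>}
    \<subseteq> accept1 (P 0) (mix q0) (mix q1) A B \<union> {\<omega> \<in> space (P 0). \<exists>n. R n \<omega>}"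
  proof
    fix \<omega> assume "\<omega> \<in> {\<omega> \<in> space (P 0). \<exists>n. hits q1 B n \<omega>}"
    then obtain n where n: "\<omega> \<in> space (P 0)" "hits q1 B n \<omega>" by blast
    show "\<omega> \<in> accept1 (P 0) (mix q0) (mix q1) A B \<union> {\<omega> \<in> space (P 0). \<exists>n. R n \<omega>}"
    proof (cases "\<exists>s. 1 \<le> s \<and> s < n \<and> mix q0 s \<omega> \<le> 1 / A")
      case True
      then show ?thesis using n unfolding R_def by blast
    next
      case False
      then have "accept1_at (mix q0) (mix q1) A B n \<omega>"
        using n(2) unfolding hits_def accept1_at_def by blast
      then show ?thesis using n(1) unfolding accept1_eq by blast
    qed
  qed
  then have "pr 0 (hits q1 B)
    \<le> measure (P 0) (accept1 (P 0) (mix q0) (mix q1) A B \<union> {\<omega> \<in> space (P 0). \<exists>n. R n \<omega>})"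
    by (rule P0.finite_measure_mono) (use m1 m2 in auto)
  also have "\<dots> \<le> measure (P 0) (accept1 (P 0) (mix q0) (mix q1) A B) + pr 0 R"
    by (rule measure_Un_le[OF m1 m2])
  finally have "B * pr 0 (hits q1 B)
    \<le> B * measure (P 0) (accept1 (P 0) (mix q0) (mix q1) A B) + B * pr 0 R"
    using B by (simp flip: distrib_left)
  also have "B * pr 0 R \<le> (\<Sum>j\<in>{1..K}. q1 j * pr j R)"
    by (rule P0_event_le[OF q1 _ R_ex R_meas R_det]) (use B in \<open>auto simp: R_def hits_def\<close>)
  also have "\<dots> \<le> (\<Sum>j\<in>{1..K}. q1 j / q0 j / A)" by (rule sum_mono[OF QP])
  finally show ?thesis by (simp add: sum_divide_distrib)
qed

section \<open>Acceptance of H0 under the alternatives\<close>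

text \<open>The probability under \<open>P i\<close> is a null expectation of the stopped
  \<open>LR f i\<close>, and \<open>q * LR f i\<close> is at most \<open>L0\<close>. The resulting
  bound involves only \<open>L0\<close> under the null law, which is why the limit is governed by
  the first alternative for every \<open>i\<close>.\<close>

lemma accept0_le_passage:
  assumes i: "i \<in> {1..K}" and q: "0 < q" and A: "1 < A"
    and L: "\<And>t. L0 t \<in> borel_measurable (P 0)" "\<And>t. L1 t \<in> borel_measurable (P 0)" "adapted L0" "adapted L1"
    and pos: "\<And>t \<omega>. good \<omega> \<Longrightarrow> 0 < L0 t \<omega>"
    and le: "\<And>t \<omega>. q * LR f i t \<omega> \<le> L0 t \<omega>"
  shows "q * A * measure (P i) (accept0 (P i) L0 L1 A B) \<le> (\<integral>\<omega>. passage (\<lambda>t \<omega>. - ln (L0 t \<omega>)) (ln A) \<omega> \<partial>P 0)"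
proof -
  have iK: "i \<le> K" using i by simp
  let ?p = "passage (\<lambda>t \<omega>. - ln (L0 t \<omega>)) (ln A)"
  let ?R = "accept0_at L0 L1 A B"
  interpret P0: prob_space "P 0" by (rule prob_P) simp
  note [measurable] = L(1,2)
  have "ennreal (q * A) * ennreal (pr i ?R) = (\<integral>\<^sup>+\<omega>. (\<Sum>n. of_bool (?R n \<omega>) * ennreal (q * A)) \<partial>P i)"
    by (rule emeasure_event[symmetric]) (intro iK exclusive_accept0 measurable_accept L)+
  also have "\<dots> = (\<integral>\<^sup>+\<omega>. (\<Sum>n. of_bool (?R n \<omega>) * ennreal (q * A) * ennreal (LR f i n \<omega>)) \<partial>P 0)"
    by (intro change_of_measure[OF iK] measurable_of_bool_mult measurable_accept L determined_mult determined_accept) (auto simp: determined_def)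
  also have "\<dots> \<le> (\<integral>\<^sup>+\<omega>. ennreal (?p \<omega>) \<partial>P 0)"
  proof (rule nn_integral_mono_AE)
    show "AE \<omega> in P 0. (\<Sum>n. of_bool (?R n \<omega>) * ennreal (q * A) * ennreal (LR f i n \<omega>)) \<le> ennreal (?p \<omega>)"
      using AE_good[of 0, simplified]
    proof eventually_elim
      case (elim \<omega>)
      note p = pos[OF elim]
      show ?case
      proof (cases "\<exists>n. ?R n \<omega>")
        case True
        then obtain n where n: "?R n \<omega>" by blast
        \<comment> \<open>Descent of \<open>L0\<close> to \<open>1 / A\<close> is ascent of
          \<open>1 / L0\<close> to \<open>A\<close>. A path accepting H0 at \<open>n\<close> had no
          earlier descent, so \<open>n\<close> is this first passage.\<close>
        have inv: "- ln (L0 t \<omega>) = ln (1 / L0 t \<omega>)" for t using p[of t] by (simp add: ln_div)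
        have iff: "A \<le> 1 / L0 t \<omega> \<longleftrightarrow> L0 t \<omega> \<le> 1 / A" for t using p[of t] A by (simp add: field_simps)
        have "?p \<omega> = passage (\<lambda>t \<omega>. ln (1 / L0 t \<omega>)) (ln A) \<omega>" unfolding passage_def inv ..
        also have "\<dots> = A / (1 / L0 n \<omega>)"
          using n A p by (intro passage_exp) (auto simp: accept0_at_def iff)
        finally have "?p \<omega> = A * L0 n \<omega>" by simp
        moreover have "(\<Sum>n. of_bool (?R n \<omega>) * ennreal (q * A) * ennreal (LR f i n \<omega>)) = ennreal (q * A) * ennreal (LR f i n \<omega>)"
          using suminf_exclusive[where R="?R" and a="\<lambda>n. ennreal (q * A) * ennreal (LR f i n \<omega>)", OF exclusive_accept0 n]
          by (simp add: mult.assoc)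
        moreover have "ennreal (q * A) * ennreal (LR f i n \<omega>) = ennreal (q * A * LR f i n \<omega>)"
          using q A LR_nonneg[OF iK] by (subst ennreal_mult[symmetric]) auto
        moreover have "q * A * LR f i n \<omega> \<le> A * L0 n \<omega>"
          using mult_left_mono[OF le[of n \<omega>], of A] A by (simp add: mult_ac)
        ultimately show ?thesis by (simp add: ennreal_leI)
      qed simp
    qed
  qed
  also have "\<dots> = ennreal (\<integral>\<omega>. ?p \<omega> \<partial>P 0)"
  proof (rule nn_integral_eq_integral)
    show "integrable (P 0) ?p"
      by (rule P0.integrable_const_bound[where B=1]) (auto simp: passage_01)
  qed (simp add: passage_01)
  finally show ?thesis
    unfolding accept0_eq
    using q A by (subst (asm) ennreal_mult[symmetric]) (auto simp: ennreal_le_iff integral_nonneg_AE passage_01)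
qed

lemma ratios_tendsto:
  assumes gap: "\<And>i. i \<in> {2..K} \<Longrightarrow> (\<integral>\<omega>. - LLR f 1 1 \<omega> \<partial>P 0) < (\<integral>\<omega>. - LLR f i 1 \<omega> \<partial>P 0)"
  shows "AE \<omega> in P 0. \<forall>i\<in>{1..K}. (\<lambda>t. LR f i t \<omega> / LR f 1 t \<omega>) \<longlonglongrightarrow> of_bool (i = 1)"
proof (rule AE_finite_allI)
  fix i assume i: "i \<in> {1..K}"
  show "AE \<omega> in P 0. (\<lambda>t. LR f i t \<omega> / LR f 1 t \<omega>) \<longlonglongrightarrow> of_bool (i = 1)"
  proof (cases "i = 1")
    case True
    show ?thesis
      using AE_good[of 0, simplified]
    proof eventually_elim
      case (elim \<omega>)
      have "LR f i t \<omega> / LR f 1 t \<omega> = 1" for t using LR_pos[OF elim K, of t] True by simp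
      then show ?case using True by simp
    qed
  next
    case False
    then have "i \<in> {2..K}" using i by auto
    from ratio_1_tendsto[OF i gap[OF this]] show ?thesis using False by simp
  qed
qed simp

lemma mixLR_ratio_tendsto:
  assumes gap: "\<And>i. i \<in> {2..K} \<Longrightarrow> (\<integral>\<omega>. - LLR f 1 1 \<omega> \<partial>P 0) < (\<integral>\<omega>. - LLR f i 1 \<omega> \<partial>P 0)"
  shows "AE \<omega> in P 0. (\<lambda>t. mix q t \<omega> / LR f 1 t \<omega>) \<longlonglongrightarrow> q 1"
proof -
  have "AE \<omega> in P 0. \<forall>i\<in>{1..K}. (\<lambda>t. LR f i t \<omega> / LR f 1 t \<omega>) \<longlonglongrightarrow> of_bool (i = 1)"
    by (rule ratios_tendsto) (rule gap)
  then show ?thesis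
  proof eventually_elim
    case (elim \<omega>)
    have "(\<lambda>t. \<Sum>i\<in>{1..K}. q i * (LR f i t \<omega> / LR f 1 t \<omega>)) \<longlonglongrightarrow> (\<Sum>i\<in>{1..K}. q i * of_bool (i = 1))"
      by (intro tendsto_sum tendsto_mult tendsto_const) (use elim in blast)
    moreover have "(\<Sum>i\<in>{1..K}. q i * of_bool (i = 1)) = q 1"
    proof -
      have "(\<Sum>i\<in>{1..K}. q i * of_bool (i = 1)) = (\<Sum>i\<in>{1..K}. if i = 1 then q i else 0)"
        by (rule sum.cong) auto
      then show ?thesis using K by (simp add: sum.delta)
    qed
    ultimately show ?case by (simp add: mixLR_def sum_divide_distrib)
  qed
qed

text \<open>All other ratios tend to 0, so eventually index 1 attains the maximum and the quotient
  is exactly \<open>q 1\<close>.\<close>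

lemma maxLR_ratio_tendsto:
  assumes gap: "\<And>i. i \<in> {2..K} \<Longrightarrow> (\<integral>\<omega>. - LLR f 1 1 \<omega> \<partial>P 0) < (\<integral>\<omega>. - LLR f i 1 \<omega> \<partial>P 0)"
    and q: "pos_weight q"
  shows "AE \<omega> in P 0. (\<lambda>t. mx q t \<omega> / LR f 1 t \<omega>) \<longlonglongrightarrow> q 1"
proof -
  have "AE \<omega> in P 0. \<forall>i\<in>{1..K}. (\<lambda>t. LR f i t \<omega> / LR f 1 t \<omega>) \<longlonglongrightarrow> of_bool (i = 1)"
    by (rule ratios_tendsto) (rule gap)
  then show ?thesis
    using AE_good[of 0, simplified]
  proof eventually_elim
    case (elim \<omega>)
    have q1: "0 < q 1" using q K by simp
    have "\<forall>\<^sub>F t in sequentially. \<forall>i\<in>{1..K}. q i * (LR f i t \<omega> / LR f 1 t \<omega>) \<le> q 1"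
    proof (intro eventually_ball_finite ballI)
      fix i assume i: "i \<in> {1..K}"
      show "\<forall>\<^sub>F t in sequentially. q i * (LR f i t \<omega> / LR f 1 t \<omega>) \<le> q 1"
      proof (cases "i = 1")
        case True
        then show ?thesis using LR_pos[OF elim(2) K] q1 by (intro always_eventually) (auto simp: less_imp_neq[symmetric])
      next
        case False
        have "(\<lambda>t. q i * (LR f i t \<omega> / LR f 1 t \<omega>)) \<longlonglongrightarrow> q i * of_bool (i = 1)"
          by (intro tendsto_mult tendsto_const) (use elim i in blast)
        then have "\<forall>\<^sub>F t in sequentially. q i * (LR f i t \<omega> / LR f 1 t \<omega>) < q 1"
          by (rule order_tendstoD) (use False q1 in simp)
        then show ?thesis by eventually_elim simp
      qed
    qed simp
    then have "\<forall>\<^sub>F t in sequentially. mx q t \<omega> / LR f 1 t \<omega> = q 1"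
    proof eventually_elim
      case e2: (elim t)
      note p = LR_pos[OF elim(2) K, of t]
      have "mx q t \<omega> = q 1 * LR f 1 t \<omega>"
        unfolding maxLR_def
      proof (rule Max_eqI)
        fix y assume "y \<in> (\<lambda>i. q i * LR f i t \<omega>) ` {1..K}"
        then obtain i where "i \<in> {1..K}" "y = q i * LR f i t \<omega>" by blast
        then show "y \<le> q 1 * LR f 1 t \<omega>" using e2 p by (auto simp: pos_divide_le_eq)
      qed (use K in auto)
      then show ?case using p by simp
    qed
    then show ?case by (rule tendsto_eventually)
  qed
qed

lemma maxLR_pos:
  assumes "good \<omega>" "pos_weight q" shows "0 < mx q t \<omega>"
proof -
  have "0 < q 1 * LR f 1 t \<omega>" using assms K LR_pos[OF assms(1) K] by simp
  also have "\<dots> \<le> mx q t \<omega>" by (rule maxLR_ge) (use K in simp)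
  finally show ?thesis .
qed

text \<open>The bound from \<open>accept0_le_passage\<close> depends on \<open>A\<close> alone, so
  the estimate is uniform in \<open>B\<close>. Since \<open>gamma_down\<close> is positive,
  \<open>1 + \<epsilon>\<close> leaves a strict margin above the limit.\<close>

lemma accept0_asymptotic:
  assumes i: "i \<in> {1..K}" and q: "0 < q" and a: "0 < a" and \<epsilon>: "0 < (\<epsilon>::real)"
    and L: "\<And>t. L0 t \<in> borel_measurable (P 0)" "\<And>t. L1 t \<in> borel_measurable (P 0)" "adapted L0" "adapted L1"
    and pos: "\<And>t \<omega>. good \<omega> \<Longrightarrow> 0 < L0 t \<omega>"
    and le: "\<And>t \<omega>. q * LR f i t \<omega> \<le> L0 t \<omega>"
    and lim: "AE \<omega> in P 0. (\<lambda>t. L0 t \<omega> / LR f 1 t \<omega>) \<longlonglongrightarrow> a"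
  shows "\<forall>\<^sub>F p in at_top \<times>\<^sub>F at_top. q * fst p * measure (P i) (accept0 (P i) L0 L1 (fst p) (snd p)) \<le> gamma_down \<nu> f 1 * (1 + \<epsilon>)"
proof -
  have g: "0 < gamma_down \<nu> f 1" using gamma_down_pos[of 1] K by simp
  have f1: "filterlim fst at_top (at_top \<times>\<^sub>F at_top :: (real \<times> real) filter)" by (rule filterlim_fst)
  have "\<forall>\<^sub>F p in (at_top :: real filter) \<times>\<^sub>F (at_top :: real filter). (\<integral>\<omega>. passage (\<lambda>t \<omega>. - ln (L0 t \<omega>)) (ln (fst p)) \<omega> \<partial>P 0) < gamma_down \<nu> f 1 * (1 + \<epsilon>)"
    by (rule order_tendstoD(2)[OF filterlim_compose[OF filterlim_compose[OF down_passage_tendsto[OF L(1) pos a lim] ln_at_top] f1]])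
      (use g \<epsilon> in \<open>auto simp: algebra_simps\<close>)
  moreover have "\<forall>\<^sub>F p in (at_top :: real filter) \<times>\<^sub>F (at_top :: real filter). (1::real) < fst p"
    using f1 by (simp add: filterlim_at_top_dense)
  ultimately show ?thesis
  proof eventually_elim
    case (elim p)
    show ?case using accept0_le_passage[OF i q elim(2) L pos le, of "snd p"] elim(1) by simp
  qed
qed

text \<open>A sandwich: the one-sided probability from above, and from below the same minus an error
  depending on \<open>A\<close> only.\<close>

lemma mix_accept1_tendsto:
  assumes q0: "pos_weight q0" and q1: "pos_weight q1"
  shows "((\<lambda>p. snd p * measure (P 0) (accept1 (P 0) (mix q0) (mix q1) (fst p) (snd p)))
    \<longlongrightarrow> (\<Sum>j\<in>{1..K}. q1 j * gamma_up \<nu> f j)) (at_top \<times>\<^sub>F at_top)"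
proof -
  let ?h = "\<lambda>B. B * pr 0 (hits q1 B)"
  let ?C = "\<Sum>j\<in>{1..K}. q1 j / q0 j"
  have f1: "filterlim fst at_top (at_top \<times>\<^sub>F at_top :: (real \<times> real) filter)" by (rule filterlim_fst)
  have f2: "filterlim snd at_top (at_top \<times>\<^sub>F at_top :: (real \<times> real) filter)" by (rule filterlim_snd)
  have h: "((\<lambda>p. ?h (snd p)) \<longlongrightarrow> (\<Sum>j\<in>{1..K}. q1 j * gamma_up \<nu> f j)) ((at_top :: real filter) \<times>\<^sub>F (at_top :: real filter))"
    by (rule filterlim_compose[OF hit_probability_tendsto[OF q1] f2])
  have "((\<lambda>p. ?C / fst p) \<longlongrightarrow> 0) ((at_top :: real filter) \<times>\<^sub>F (at_top :: real filter))"
    by (rule tendsto_divide_0[OF tendsto_const filterlim_at_top_imp_at_infinity[OF f1]])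
  from tendsto_diff[OF h this]
  have l: "((\<lambda>p. ?h (snd p) - ?C / fst p) \<longlongrightarrow> (\<Sum>j\<in>{1..K}. q1 j * gamma_up \<nu> f j)) ((at_top :: real filter) \<times>\<^sub>F (at_top :: real filter))" by simp
  have ev: "\<forall>\<^sub>F p in (at_top :: real filter) \<times>\<^sub>F (at_top :: real filter). (0::real) < fst p" "\<forall>\<^sub>F p in (at_top :: real filter) \<times>\<^sub>F (at_top :: real filter). (0::real) < snd p"
    using f1 f2 by (simp_all add: filterlim_at_top_dense)
  show ?thesis
  proof (rule tendsto_sandwich[OF _ _ l h])
    show "\<forall>\<^sub>F p in at_top \<times>\<^sub>F at_top. ?h (snd p) - ?C / fst p \<le> snd p * measure (P 0) (accept1 (P 0) (mix q0) (mix q1) (fst p) (snd p))"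
      using ev
    proof eventually_elim
      case (elim p)
      show ?case using hit_le_accept1[OF q0 q1 elim] by linarith
    qed
    show "\<forall>\<^sub>F p in at_top \<times>\<^sub>F at_top. snd p * measure (P 0) (accept1 (P 0) (mix q0) (mix q1) (fst p) (snd p)) \<le> ?h (snd p)"
      using ev(2) by eventually_elim (intro mult_left_mono accept1_le_hit q1, auto)
  qed
qed

lemma max_accept1_eventually:
  assumes q1: "pos_weight q1" and \<epsilon>: "0 < (\<epsilon>::real)"
  shows "\<forall>\<^sub>F p in at_top \<times>\<^sub>F at_top. snd p * measure (P 0) (accept1 (P 0) (mx q0) (mx q1) (fst p) (snd p))
    \<le> (\<Sum>j\<in>{1..K}. q1 j * gamma_up \<nu> f j) * (1 + \<epsilon>)"
proof -
  let ?h = "\<lambda>B. B * pr 0 (hits q1 B)"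
  have f2: "filterlim snd at_top (at_top \<times>\<^sub>F at_top :: (real \<times> real) filter)" by (rule filterlim_snd)
  have g: "0 < (\<Sum>j\<in>{1..K}. q1 j * gamma_up \<nu> f j)"
    by (rule sum_pos) (use q1 gamma_up_pos K in auto)
  have "\<forall>\<^sub>F p in (at_top :: real filter) \<times>\<^sub>F (at_top :: real filter). ?h (snd p) < (\<Sum>j\<in>{1..K}. q1 j * gamma_up \<nu> f j) * (1 + \<epsilon>)"
    by (rule order_tendstoD(2)[OF filterlim_compose[OF hit_probability_tendsto[OF q1] f2]]) (use g \<epsilon> in \<open>simp add: distrib_left\<close>)
  moreover have "\<forall>\<^sub>F p in (at_top :: real filter) \<times>\<^sub>F (at_top :: real filter). (0::real) < snd p"
    using f2 by (simp add: filterlim_at_top_dense)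
  ultimately show ?thesis
  proof eventually_elim
    case (elim p)
    have "snd p * measure (P 0) (accept1 (P 0) (mx q0) (mx q1) (fst p) (snd p)) \<le> ?h (snd p)"
      using elim(2) by (intro mult_left_mono accept1_le_hit q1 maxLR_le_mixLR) auto
    then show ?case using elim(1) by simp
  qed
qed

end

text \<open>As the constants are positive, an equality up to \<open>1 + o(1)\<close> is convergence
  of the rescaled probability, and an inequality up to \<open>1 + o(1)\<close> is an eventual bound
  for every \<open>\<epsilon>\<close>. The product filter lets both thresholds grow
  independently.\<close>

theorem theorem1:
  fixes \<nu> :: "(real ^ 'd) measure"
    and f :: "nat \<Rightarrow> real ^ 'd \<Rightarrow> real"
    and K r :: nat
  defines "P \<equiv> obs_law \<nu> f"
  defines "I0 \<equiv> (\<lambda>i. integral\<^sup>L (P 0) (\<lambda>\<omega>. - LLR f i 1 \<omega>))"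
  assumes K: "1 \<le> K"
    and sigma_fin: "sigma_finite_measure \<nu>"
    and sets_nu: "sets \<nu> = sets borel"
    and nondegenerate: "emeasure \<nu> (space \<nu>) > 0"
    and f_meas: "\<And>j. j \<le> K \<Longrightarrow> f j \<in> borel_measurable \<nu>"
    and f_nonneg: "\<And>j x. j \<le> K \<Longrightarrow> 0 \<le> f j x"
    and f_density: "\<And>j. j \<le> K \<Longrightarrow> (\<integral>\<^sup>+ x. ennreal (f j x) \<partial>\<nu>) = 1"
    and common_support: "\<And>j. j \<le> K \<Longrightarrow>
          {x \<in> space \<nu>. 0 < f j x} = {x \<in> space \<nu>. 0 < f 0 x}"
    and f_distinct: "\<And>i. i \<in> {1..K} \<Longrightarrow> emeasure \<nu> {x \<in> space \<nu>. f i x \<noteq> f 0 x} > 0"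
    and nonarith0: "\<And>i. i \<in> {1..K} \<Longrightarrow> \<not> arithmetic (P 0) (LLR f i 1)"
    and nonarith1: "\<And>i. i \<in> {1..K} \<Longrightarrow> \<not> arithmetic (P i) (LLR f i 1)"
    and I_finite: "\<And>i. i \<in> {1..K} \<Longrightarrow> integrable (P i) (LLR f i 1)"
    and I0_finite: "\<And>i. i \<in> {1..K} \<Longrightarrow> integrable (P 0) (LLR f i 1)"
    and r: "1 \<le> r" "r \<le> K"
    and ord_eq: "\<And>i. i \<in> {1..r} \<Longrightarrow> I0 i = I0 1"
    and ord_gap: "\<And>i. i \<in> {r+1..K} \<Longrightarrow> I0 r < I0 i"
    and ord_mono: "\<And>i j. r + 1 \<le> i \<Longrightarrow> i \<le> j \<Longrightarrow> j \<le> K \<Longrightarrow> I0 i \<le> I0 j"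
  shows
    "(\<forall>A B q0 q1. 1 < A \<and> 1 < B \<and> (\<forall>i\<in>{1..K}. 0 < q0 i \<and> 0 < q1 i) \<longrightarrow>
        measure (P 0) (accept1 (P 0) (mixLR f K q0) (mixLR f K q1) A B) \<le> (\<Sum>i\<in>{1..K}. q1 i) / B
      \<and> measure (P 0) (accept1 (P 0) (maxLR f K q0) (maxLR f K q1) A B) \<le> (\<Sum>i\<in>{1..K}. q1 i) / B
      \<and> (\<forall>i\<in>{1..K}.
           measure (P i) (accept0 (P i) (mixLR f K q0) (mixLR f K q1) A B) \<le> 1 / (A * q0 i)
         \<and> measure (P i) (accept0 (P i) (maxLR f K q0) (maxLR f K q1) A B) \<le> 1 / (A * q0 i)))
   \<and> (\<forall>q0 q1. (\<forall>i\<in>{1..K}. 0 < q0 i \<and> 0 < q1 i) \<longrightarrow>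
        ((\<lambda>(A, B). B * measure (P 0) (accept1 (P 0) (mixLR f K q0) (mixLR f K q1) A B))
            \<longlongrightarrow> (\<Sum>j\<in>{1..K}. q1 j * gamma_up \<nu> f j)) (at_top \<times>\<^sub>F at_top)
      \<and> (\<forall>\<epsilon>>0. \<forall>\<^sub>F (A, B) in at_top \<times>\<^sub>F at_top.
            B * measure (P 0) (accept1 (P 0) (maxLR f K q0) (maxLR f K q1) A B)
              \<le> (\<Sum>j\<in>{1..K}. q1 j * gamma_up \<nu> f j) * (1 + \<epsilon>))
      \<and> (r = 1 \<longrightarrow> (\<forall>i\<in>{1..K}. \<forall>\<epsilon>>0. \<forall>\<^sub>F (A, B) in at_top \<times>\<^sub>F at_top.
            q0 i * A * measure (P i) (accept0 (P i) (mixLR f K q0) (mixLR f K q1) A B)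
              \<le> gamma_down \<nu> f 1 * (1 + \<epsilon>)
          \<and> q0 i * A * measure (P i) (accept0 (P i) (maxLR f K q0) (maxLR f K q1) A B)
              \<le> gamma_down \<nu> f 1 * (1 + \<epsilon>))))"
proof -
  interpret M: test_model \<nu> f K
    by (rule test_model.intro)
      (rule K f_meas f_nonneg f_density common_support f_distinct nonarith0[unfolded P_def]
        nonarith1[unfolded P_def] I_finite[unfolded P_def] I0_finite[unfolded P_def] | assumption)+
  note mix = M.mixLR_measurable adapted_mixLR
  note mx = M.maxLR_measurable adapted_maxLR
  have eps: "(\<forall>\<^sub>F (A, B) in at_top \<times>\<^sub>F at_top. Q A B) \<longleftrightarrow> (\<forall>\<^sub>F p in at_top \<times>\<^sub>F at_top. Q (fst p) (snd p))"
    for Q :: "real \<Rightarrow> real \<Rightarrow> bool"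
    by (simp add: split_beta')
  show ?thesis
    unfolding P_def
  proof (intro conjI allI impI ballI)
    fix A B :: real and q0 q1 :: "nat \<Rightarrow> real"
    assume h: "1 < A \<and> 1 < B \<and> (\<forall>i\<in>{1..K}. 0 < q0 i \<and> 0 < q1 i)"
    then have q: "\<forall>i\<in>{1..K}. 0 < q0 i" "\<forall>i\<in>{1..K}. 0 < q1 i" and A: "0 < A" and B: "0 < B" by auto
    show "measure (obs_law \<nu> f 0) (accept1 (obs_law \<nu> f 0) (mixLR f K q0) (mixLR f K q1) A B) \<le> (\<Sum>i\<in>{1..K}. q1 i) / B"
      by (rule M.accept1_bound[OF q(2) B]) (rule mix order_refl)+
    show "measure (obs_law \<nu> f 0) (accept1 (obs_law \<nu> f 0) (maxLR f K q0) (maxLR f K q1) A B) \<le> (\<Sum>i\<in>{1..K}. q1 i) / B"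
      by (rule M.accept1_bound[OF q(2) B]) (rule mx M.maxLR_le_mixLR[OF q(2)])+
    fix i assume i: "i \<in> {1..K}"
    then have qi: "0 < q0 i" using q by blast
    show "measure (obs_law \<nu> f i) (accept0 (obs_law \<nu> f i) (mixLR f K q0) (mixLR f K q1) A B) \<le> 1 / (A * q0 i)"
      by (rule M.accept0_bound[OF i qi A]) (rule mix M.mixLR_ge[OF i q(1)])+
    show "measure (obs_law \<nu> f i) (accept0 (obs_law \<nu> f i) (maxLR f K q0) (maxLR f K q1) A B) \<le> 1 / (A * q0 i)"
      by (rule M.accept0_bound[OF i qi A]) (rule mx M.maxLR_ge[OF i])+
  next
    fix q0 q1 :: "nat \<Rightarrow> real"
    assume "\<forall>i\<in>{1..K}. 0 < q0 i \<and> 0 < q1 i"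
    then have q: "\<forall>i\<in>{1..K}. 0 < q0 i" "\<forall>i\<in>{1..K}. 0 < q1 i" by auto
    show "((\<lambda>(A, B). B * measure (obs_law \<nu> f 0) (accept1 (obs_law \<nu> f 0) (mixLR f K q0) (mixLR f K q1) A B))
        \<longlongrightarrow> (\<Sum>j\<in>{1..K}. q1 j * gamma_up \<nu> f j)) (at_top \<times>\<^sub>F at_top)"
      using M.mix_accept1_tendsto[OF q] by (simp add: split_beta')
    fix \<epsilon> :: real assume \<epsilon>: "0 < \<epsilon>"
    show "\<forall>\<^sub>F (A, B) in at_top \<times>\<^sub>F at_top.
        B * measure (obs_law \<nu> f 0) (accept1 (obs_law \<nu> f 0) (maxLR f K q0) (maxLR f K q1) A B)
          \<le> (\<Sum>j\<in>{1..K}. q1 j * gamma_up \<nu> f j) * (1 + \<epsilon>)"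
      unfolding eps by (rule M.max_accept1_eventually[OF q(2) \<epsilon>])
  next
    fix q0 q1 :: "nat \<Rightarrow> real" and i and \<epsilon> :: real
    assume "\<forall>i\<in>{1..K}. 0 < q0 i \<and> 0 < q1 i" and r1: "r = 1" and i: "i \<in> {1..K}" and \<epsilon>: "0 < \<epsilon>"
    then have q: "\<forall>i\<in>{1..K}. 0 < q0 i" "\<forall>i\<in>{1..K}. 0 < q1 i" by auto
    have q01: "0 < q0 1" using q K by simp
    have qi: "0 < q0 i" using q i by blast
    \<comment> \<open>For \<open>r = 1\<close> the indices above \<open>r\<close> are exactly
      \<open>2..K\<close>, and \<open>I0 r\<close> is \<open>I0 1\<close>.\<close>
    have gap: "(\<integral>\<omega>. - LLR f 1 1 \<omega> \<partial>obs_law \<nu> f 0) < (\<integral>\<omega>. - LLR f i 1 \<omega> \<partial>obs_law \<nu> f 0)" if "i \<in> {2..K}" for i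
      using ord_gap[of i] that r1 by (simp add: I0_def P_def)
    have "\<forall>\<^sub>F p in at_top \<times>\<^sub>F at_top. q0 i * fst p * measure (obs_law \<nu> f i)
        (accept0 (obs_law \<nu> f i) (mixLR f K q0) (mixLR f K q1) (fst p) (snd p)) \<le> gamma_down \<nu> f 1 * (1 + \<epsilon>)"
      by (rule M.accept0_asymptotic[OF i qi q01 \<epsilon>])
        (rule mix M.mixLR_ge[OF i q(1)] M.mixLR_pos[OF _ q(1)] M.mixLR_ratio_tendsto gap | assumption)+
    moreover have "\<forall>\<^sub>F p in at_top \<times>\<^sub>F at_top. q0 i * fst p * measure (obs_law \<nu> f i)
        (accept0 (obs_law \<nu> f i) (maxLR f K q0) (maxLR f K q1) (fst p) (snd p)) \<le> gamma_down \<nu> f 1 * (1 + \<epsilon>)"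
      by (rule M.accept0_asymptotic[OF i qi q01 \<epsilon>])
        (rule mx M.maxLR_ge[OF i] M.maxLR_pos[OF _ q(1)] M.maxLR_ratio_tendsto[OF _ q(1)] gap | assumption)+
    ultimately show "\<forall>\<^sub>F (A, B) in at_top \<times>\<^sub>F at_top.
        q0 i * A * measure (obs_law \<nu> f i) (accept0 (obs_law \<nu> f i) (mixLR f K q0) (mixLR f K q1) A B)
          \<le> gamma_down \<nu> f 1 * (1 + \<epsilon>)
      \<and> q0 i * A * measure (obs_law \<nu> f i) (accept0 (obs_law \<nu> f i) (maxLR f K q0) (maxLR f K q1) A B)
          \<le> gamma_down \<nu> f 1 * (1 + \<epsilon>)"
      unfolding eps by (rule eventually_conj)
  qed
qed

end
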